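(* Let $G$ be a discrete group with amenable radical $R_a(G)$. For every tracial state $\tau$ on $\mathrm{C}^*_r(G)$, we have $\tau=\tau\circ E_{R_a(G)}$; equivalently, $\tau(\lambda_s)=0$ for every $s\in G\setminus R_a(G)$.
   Context: The amenable radical $R_a(G)$ is the largest amenable normal subgroup of $G$. $\lambda$ is the left regular representation and $\mathrm{C}^*_r(G)$ the reduced group C*-algebra. For a subgroup $H<G$, $E_H:\mathrm{C}^*_r(G)\to\mathrm{C}^*_r(H)$ is the canonical conditional expectation with $E_H(\lambda_s)=\lambda_s$ for $s\in H$ and $0$ otherwise. *)

theory Defs
  imports "HOL-Analysis.Analysis" "HOL-Algebra.Coset"
begin

definition l2 :: "'a monoid \<Rightarrow> ('a \<Rightarrow> complex) set" where
  "l2 G = {f. (\<forall>g. g \<notin> carrier G \<longrightarrow> f g = 0) \<and>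
              (\<lambda>g. (cmod (f g))^2) summable_on carrier G}"

definition l2inner :: "'a monoid \<Rightarrow> ('a \<Rightarrow> complex) \<Rightarrow> ('a \<Rightarrow> complex) \<Rightarrow> complex" where
  "l2inner G f h = infsum (\<lambda>g. f g * cnj (h g)) (carrier G)"

definition l2norm :: "'a monoid \<Rightarrow> ('a \<Rightarrow> complex) \<Rightarrow> real" where
  "l2norm G f = sqrt (infsum (\<lambda>g. (cmod (f g))^2) (carrier G))"

type_synonym 'a op = "('a \<Rightarrow> complex) \<Rightarrow> ('a \<Rightarrow> complex)"

definition Bop :: "'a monoid \<Rightarrow> 'a op set" where
  "Bop G = {T. (\<forall>f\<in>l2 G. T f \<in> l2 G)
     \<and> (\<forall>f\<in>l2 G. \<forall>h\<in>l2 G. \<forall>a b. T (\<lambda>g. a * f g + b * h g) = (\<lambda>g. a * T f g + b * T h g))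
     \<and> (\<exists>C. \<forall>f\<in>l2 G. l2norm G (T f) \<le> C * l2norm G f)
     \<and> (\<forall>f. f \<notin> l2 G \<longrightarrow> T f = (\<lambda>_. 0))}"

definition opnorm :: "'a monoid \<Rightarrow> 'a op \<Rightarrow> real" where
  "opnorm G T = Sup {l2norm G (T f) | f. f \<in> l2 G \<and> l2norm G f \<le> 1}"

definition op_add :: "'a op \<Rightarrow> 'a op \<Rightarrow> 'a op" where
  "op_add T S = (\<lambda>f g. T f g + S f g)"

definition op_diff :: "'a op \<Rightarrow> 'a op \<Rightarrow> 'a op" where
  "op_diff T S = (\<lambda>f g. T f g - S f g)"

definition op_scale :: "complex \<Rightarrow> 'a op \<Rightarrow> 'a op" where
  "op_scale c T = (\<lambda>f g. c * T f g)"

definition op_adj :: "'a monoid \<Rightarrow> 'a op \<Rightarrow> 'a op" where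
  "op_adj G T = (THE S. S \<in> Bop G \<and>
     (\<forall>f\<in>l2 G. \<forall>h\<in>l2 G. l2inner G (T f) h = l2inner G f (S h)))"

definition lreg :: "'a monoid \<Rightarrow> 'a \<Rightarrow> 'a op" where
  "lreg G s = (\<lambda>f g. if f \<in> l2 G \<and> g \<in> carrier G then f (inv\<^bsub>G\<^esub> s \<otimes>\<^bsub>G\<^esub> g) else 0)"

definition lreg_comb :: "'a monoid \<Rightarrow> ('a \<Rightarrow> complex) \<Rightarrow> 'a op" where
  "lreg_comb G c = (\<lambda>f g. \<Sum>s\<in>{s\<in>carrier G. c s \<noteq> 0}. c s * lreg G s f g)"

definition Cred :: "'a monoid \<Rightarrow> 'a op set" where
  "Cred G = {T \<in> Bop G. \<forall>\<epsilon>>0. \<exists>c. finite {s\<in>carrier G. c s \<noteq> 0} \<and>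
                 opnorm G (op_diff T (lreg_comb G c)) < \<epsilon>}"

definition tracial_state :: "'a monoid \<Rightarrow> ('a op \<Rightarrow> complex) \<Rightarrow> bool" where
  "tracial_state G \<tau> \<longleftrightarrow>
     (\<forall>x\<in>Cred G. \<forall>y\<in>Cred G. \<tau> (op_add x y) = \<tau> x + \<tau> y)
   \<and> (\<forall>x\<in>Cred G. \<forall>c. \<tau> (op_scale c x) = c * \<tau> x)
   \<and> (\<forall>x\<in>Cred G. Im (\<tau> (op_adj G x \<circ> x)) = 0 \<and> Re (\<tau> (op_adj G x \<circ> x)) \<ge> 0)
   \<and> \<tau> (lreg G \<one>\<^bsub>G\<^esub>) = 1
   \<and> (\<forall>x\<in>Cred G. \<forall>y\<in>Cred G. \<tau> (x \<circ> y) = \<tau> (y \<circ> x))"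

definition linf :: "'a set \<Rightarrow> ('a \<Rightarrow> real) set" where
  "linf H = {f. (\<exists>B. \<forall>h\<in>H. \<bar>f h\<bar> \<le> B) \<and> (\<forall>x. x \<notin> H \<longrightarrow> f x = 0)}"

definition amenable_subgroup :: "'a monoid \<Rightarrow> 'a set \<Rightarrow> bool" where
  "amenable_subgroup G H \<longleftrightarrow> subgroup H G \<and>
    (\<exists>m :: ('a \<Rightarrow> real) \<Rightarrow> real.
       (\<forall>f\<in>linf H. \<forall>k\<in>linf H. \<forall>a b. m (\<lambda>x. a * f x + b * k x) = a * m f + b * m k)
     \<and> (\<forall>f\<in>linf H. (\<forall>h\<in>H. f h \<ge> 0) \<longrightarrow> m f \<ge> 0)
     \<and> m (\<lambda>x. if x \<in> H then 1 else 0) = 1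
     \<and> (\<forall>f\<in>linf H. \<forall>s\<in>H. m (\<lambda>x. if x \<in> H then f (s \<otimes>\<^bsub>G\<^esub> x) else 0) = m f))"

text \<open>Amenable radical: the union of all amenable normal subgroups (which is the
  largest amenable normal subgroup).\<close>
definition amenable_radical :: "'a monoid \<Rightarrow> 'a set" where
  "amenable_radical G = \<Union>{N. N \<lhd> G \<and> amenable_subgroup G N}"

definition fcoef :: "'a monoid \<Rightarrow> 'a op \<Rightarrow> 'a \<Rightarrow> complex" where
  "fcoef G x s = x (\<lambda>g. if g = \<one>\<^bsub>G\<^esub> then 1 else 0) s"

text \<open>Canonical conditional expectation E_H: C*_r(G) to C*_r(H) \<subseteq> C*_r(G),
  characterised by cutting the Fourier coefficients down to H
  (so E_H(lambda_s) = lambda_s for s in H and 0 otherwise).\<close>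
definition cond_exp :: "'a monoid \<Rightarrow> 'a set \<Rightarrow> 'a op \<Rightarrow> 'a op" where
  "cond_exp G H x = (THE y. y \<in> Cred G \<and>
      (\<forall>s. fcoef G y s = (if s \<in> H then fcoef G x s else 0)))"

end

theory Submission
  imports Defs
begin

text \<open>
  Realise amenability through sublinear functionals on bounded functions. Let \<open>p\<close> be minimal among
  the left-invariant sublinear functionals below the supremum: it is the support function of an
  irreducible affine flow of means, and the elements of \<open>G\<close> acting trivially on that flow form an
  amenable normal subgroup, which is the amenable radical. If \<open>r\<close> is any other invariant sublinear
  functional and \<open>P\<close> a Poisson transform, then \<open>r \<circ> P = p\<close> by minimality. Apply this with
  \<open>r f\<close> the least trace of an element of the reduced algebra dominating multiplication by \<open>f\<close>
  (invariant because \<open>\<tau>\<close> is a trace): every mean of the flow is obtained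
  from an extension of \<open>\<tau>\<close>. If \<open>s\<close> moves a point of the flow, some such extension is
  almost concentrated at a point which \<open>s\<close> displaces, and a Cauchy-Schwarz estimate
  forces \<open>\<tau>(\<lambda>\<^sub>s) = 0\<close>. Continuity of \<open>\<tau>\<close>, and its positivity on positive operators, come
  from a square root constructed inside the reduced algebra.
\<close>

section \<open>Sublinear functionals\<close>

text \<open>Closed convex invariant sets of means are handled through their support functions:
  inclusion becomes the pointwise order, Zorn's lemma needs only infima along chains, and
  Hahn-Banach recovers the points, so no compactness argument is made. The obstacle is
  concentration. In the classical argument a state restricting to a point mass is multiplicative on
  functions, and a group element moving that point has trace 0. An irreducible affine flow gives no
  point masses directly. They are replaced by a variance bound: if \<open>y\<close> almost maximises
  a strictly convex function \<open>q\<close> over the flow, any extension with barycentre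
  \<open>y\<close> has small variance. Only the two coordinates \<open>x a\<close> and
  \<open>x b\<close>, with \<open>b\<close> a translate of \<open>a\<close>, have to concentrate, so
  a planar quadratic suffices; a large linear term in \<open>q\<close> keeps the two coordinates of
  \<open>y\<close> apart, that is, makes \<open>s\<close> move \<open>y\<close>. Extensions of
  \<tau> are used only on bounded functions, as linear functionals below \<open>upper\<close>. The
  final estimate is therefore an operator inequality,
  \<open>\<epsilon> - Re (z \<lambda>\<^sub>s)\<close> dominating multiplication by
  \<open>- F\<close>, whose trace can be compared with \<open>upper\<close>.\<close>

definition lin_space :: "('a \<Rightarrow> real) set \<Rightarrow> bool" where
  "lin_space V \<longleftrightarrow> (\<lambda>_. 0) \<in> V \<and> (\<forall>f\<in>V. \<forall>k\<in>V. (\<lambda>x. f x + k x) \<in> V) \<and> (\<forall>f\<in>V. \<forall>c. (\<lambda>x. c * f x) \<in> V)"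

text \<open>Homogeneity is only an inequality, which leaves one-sided checks for infima and suprema;
  for \<open>c > 0\<close> the reverse inequality follows by scaling back with
  \<open>inverse c\<close>.\<close>

definition sublinear :: "('a \<Rightarrow> real) set \<Rightarrow> (('a \<Rightarrow> real) \<Rightarrow> real) \<Rightarrow> bool" where
  "sublinear V p \<longleftrightarrow> (\<forall>f\<in>V. \<forall>k\<in>V. p (\<lambda>x. f x + k x) \<le> p f + p k)
     \<and> (\<forall>f\<in>V. \<forall>c\<ge>0. p (\<lambda>x. c * f x) \<le> c * p f)"

definition linear_func :: "('a \<Rightarrow> real) set \<Rightarrow> (('a \<Rightarrow> real) \<Rightarrow> real) \<Rightarrow> bool" where
  "linear_func V m \<longleftrightarrow> (\<forall>f\<in>V. \<forall>k\<in>V. m (\<lambda>x. f x + k x) = m f + m k)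
     \<and> (\<forall>f\<in>V. \<forall>c. m (\<lambda>x. c * f x) = c * m f)"

lemma lin_space_add: "lin_space V \<Longrightarrow> f \<in> V \<Longrightarrow> k \<in> V \<Longrightarrow> (\<lambda>x. f x + k x) \<in> V"
  and lin_space_scale: "lin_space V \<Longrightarrow> f \<in> V \<Longrightarrow> (\<lambda>x. c * f x) \<in> V"
  and lin_space_zero: "lin_space V \<Longrightarrow> (\<lambda>_. 0) \<in> V"
  by (auto simp: lin_space_def)

lemma lin_space_uminus: "lin_space V \<Longrightarrow> f \<in> V \<Longrightarrow> (\<lambda>x. - f x) \<in> V"
  using lin_space_scale[of V f "-1"] by simp

lemma sublinear_zero: "lin_space V \<Longrightarrow> sublinear V p \<Longrightarrow> p (\<lambda>_. 0) = 0"
proof -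
  assume V: "lin_space V" and p: "sublinear V p"
  have "p (\<lambda>_. 0 + 0) \<le> p (\<lambda>_. 0) + p (\<lambda>_. 0)"
    using p[unfolded sublinear_def, THEN conjunct1, THEN bspec, OF lin_space_zero[OF V],
        THEN bspec, OF lin_space_zero[OF V]] .
  moreover have "p (\<lambda>_. 0 * 0) \<le> 0 * p (\<lambda>_. 0)"
    using p[unfolded sublinear_def, THEN conjunct2, THEN bspec, OF lin_space_zero[OF V],
        THEN spec, of 0] by simp
  ultimately show ?thesis by simp
qed

lemma sublinear_add: "sublinear V p \<Longrightarrow> f \<in> V \<Longrightarrow> k \<in> V \<Longrightarrow> p (\<lambda>x. f x + k x) \<le> p f + p k"
  and sublinear_scale: "sublinear V p \<Longrightarrow> f \<in> V \<Longrightarrow> c \<ge> 0 \<Longrightarrow> p (\<lambda>x. c * f x) \<le> c * p f"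
  by (auto simp: sublinear_def)

lemma sublinear_uminus:
  assumes "lin_space V" "sublinear V p" "f \<in> V"
  shows "- p (\<lambda>x. - f x) \<le> p f"
  using sublinear_add[OF assms(2,3) lin_space_uminus[OF assms(1,3)]] sublinear_zero[OF assms(1,2)] by simp

text \<open>Zorn's lemma for the pointwise order. The family \<Phi> of invariances is a parameter
  because two cases are needed: with \<Phi> empty a minimal functional turns out linear, and with
  the left translations it is the support function of a minimal flow.\<close>

lemma minimal_sublinear_exists:
  assumes V: "lin_space V" and p: "sublinear V p"
    and pinv: "\<And>\<phi> f. \<phi> \<in> \<Phi> \<Longrightarrow> f \<in> V \<Longrightarrow> p (\<phi> f) = p f"
    and \<Phi>: "\<And>\<phi> f. \<phi> \<in> \<Phi> \<Longrightarrow> f \<in> V \<Longrightarrow> \<phi> f \<in> V"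
  shows "\<exists>q. sublinear V q \<and> (\<forall>f\<in>V. q f \<le> p f) \<and> (\<forall>\<phi>\<in>\<Phi>. \<forall>f\<in>V. q (\<phi> f) = q f)
    \<and> (\<forall>q'. sublinear V q' \<longrightarrow> (\<forall>f\<in>V. q' f \<le> q f) \<longrightarrow> (\<forall>\<phi>\<in>\<Phi>. \<forall>f\<in>V. q' (\<phi> f) = q' f)
         \<longrightarrow> (\<forall>f\<in>V. q' f = q f))"
proof -
  \<comment> \<open>Normalising to 0 outside \<open>V\<close> makes the order of functions agree
    with comparison on \<open>V\<close>. The order is reversed in \<open>P\<close> because Zorn's
    lemma delivers maximal elements.\<close>
  define A where "A = {q. sublinear V q \<and> (\<forall>f\<in>V. q f \<le> p f) \<and> (\<forall>\<phi>\<in>\<Phi>. \<forall>f\<in>V. q (\<phi> f) = q f)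
      \<and> (\<forall>f. f \<notin> V \<longrightarrow> q f = 0)}"
  define P where "P = (\<lambda>q q' :: ('a \<Rightarrow> real) \<Rightarrow> real. q' \<le> q)"
  define ext where "ext = (\<lambda>q :: ('a \<Rightarrow> real) \<Rightarrow> real. \<lambda>f. if f \<in> V then q f else 0)"
  have ext: "sublinear V (ext q) = sublinear V q" for q
    using V unfolding sublinear_def ext_def lin_space_def by auto
  have po: "partial_order_on A (relation_of P A)"
    by (rule partial_order_on_relation_ofI) (auto simp: P_def)
  have ch: "\<exists>u\<in>A. \<forall>a\<in>C. P a u" if C: "C \<in> Chains (relation_of P A)" for C
  proof (cases "C = {}")
    case True
    have "ext p \<in> A" using p pinv \<Phi> V ext by (auto simp: A_def) (auto simp: ext_def)
    then show ?thesis using True by blast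
  next
    case False
    have CA: "C \<subseteq> A" and tot: "\<And>q q'. q \<in> C \<Longrightarrow> q' \<in> C \<Longrightarrow> q \<le> q' \<or> q' \<le> q"
      using C unfolding Chains_def relation_of_def P_def by auto
    define u where "u = ext (\<lambda>f. INF q\<in>C. q f)"
    \<comment> \<open>A lower bound independent of \<open>q\<close>, from
      \<open>q f >= - q (- f) >= - p (- f)\<close>; it keeps the infimum over the chain
      finite.\<close>
    have low: "- p (\<lambda>x. - f x) \<le> q f" if "q \<in> C" "f \<in> V" for q f
    proof -
      have q: "sublinear V q" and le: "q (\<lambda>x. - f x) \<le> p (\<lambda>x. - f x)"
        using that CA lin_space_uminus[OF V that(2)] by (auto simp: A_def)
      show ?thesis using sublinear_uminus[OF V q that(2)] le by linarith
    qed
    have bdd: "bdd_below ((\<lambda>q. q f) ` C)" if "f \<in> V" for f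
      using low[OF _ that] by (rule bdd_belowI2)
    have ule: "u f \<le> q f" if "q \<in> C" "f \<in> V" for q f
      using cINF_lower[OF bdd[OF that(2)] that(1)] that(2) by (simp add: u_def ext_def)
    have uge: "c \<le> u f" if "f \<in> V" "\<And>q. q \<in> C \<Longrightarrow> c \<le> q f" for c f
      using cINF_greatest[OF False, of c "\<lambda>q. q f"] that by (simp add: u_def ext_def)
    have "sublinear V u"
      unfolding sublinear_def
    proof (intro conjI ballI allI impI)
      fix f k assume fk: "f \<in> V" "k \<in> V"
      have 1: "u (\<lambda>x. f x + k x) \<le> q f + q' k" if qq: "q \<in> C" "q' \<in> C" for q q'
      proof -
        \<comment> \<open>The smaller of two members of the chain serves both summands; this is why
          an infimum of sublinear functionals is subadditive along a chain.\<close>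
        obtain r where r: "r \<in> C" "r \<le> q" "r \<le> q'" using tot[OF qq] qq by auto
        have "u (\<lambda>x. f x + k x) \<le> r (\<lambda>x. f x + k x)" using ule r lin_space_add[OF V fk] by blast
        also have "\<dots> \<le> r f + r k" using r(1) CA fk by (auto simp: A_def sublinear_def)
        finally show ?thesis using r(2,3) by (smt (verit) le_fun_def)
      qed
      have "u (\<lambda>x. f x + k x) - q f \<le> u k" if "q \<in> C" for q
        using 1[OF that] by (intro uge[OF fk(2)]) (simp add: algebra_simps)
      then have "u (\<lambda>x. f x + k x) - u k \<le> u f"
        by (intro uge[OF fk(1)]) (simp add: algebra_simps)
      then show "u (\<lambda>x. f x + k x) \<le> u f + u k" by simp
    next
      fix f and c :: real assume f: "f \<in> V" and c: "0 \<le> c"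
      have 1: "u (\<lambda>x. c * f x) \<le> c * q f" if "q \<in> C" for q
      proof -
        have "u (\<lambda>x. c * f x) \<le> q (\<lambda>x. c * f x)" using ule that lin_space_scale[OF V f] by blast
        also have "\<dots> \<le> c * q f" using that CA f c by (auto simp: A_def sublinear_def)
        finally show ?thesis .
      qed
      show "u (\<lambda>x. c * f x) \<le> c * u f"
      proof (cases "c = 0")
        case True
        then show ?thesis using 1 False by auto
      next
        case False
        have "u (\<lambda>x. c * f x) / c \<le> u f"
          using 1 False c by (intro uge[OF f]) (simp add: field_simps)
        then show ?thesis using False c by (simp add: field_simps)
      qed
    qed
    moreover have "u f \<le> p f" if f: "f \<in> V" for f
    proof -
      obtain q where "q \<in> C" using False by auto
      then show ?thesis using ule[OF _ f] CA f by (force simp: A_def)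
    qed
    moreover have "u (\<phi> f) = u f" if "\<phi> \<in> \<Phi>" "f \<in> V" for \<phi> f
    proof -
      have "(\<lambda>q. q (\<phi> f)) ` C = (\<lambda>q. q f) ` C" using CA that by (intro image_cong refl) (auto simp: A_def)
      then show ?thesis using that \<Phi> by (simp add: u_def ext_def)
    qed
    ultimately have "u \<in> A" by (auto simp: A_def u_def ext_def)
    moreover have "P a u" if "a \<in> C" for a
      using ule[OF that] that CA by (auto simp: P_def le_fun_def u_def ext_def A_def)
    ultimately show ?thesis by blast
  qed
  from predicate_Zorn[OF po ch] obtain m where m: "m \<in> A" and min: "\<And>a. a \<in> A \<Longrightarrow> P m a \<Longrightarrow> a = m" by blast
  have "\<forall>f\<in>V. q' f = m f" if q': "sublinear V q'" "\<forall>f\<in>V. q' f \<le> m f"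
    "\<forall>\<phi>\<in>\<Phi>. \<forall>f\<in>V. q' (\<phi> f) = q' f" for q'
  proof -
    have "q' f \<le> p f" if "f \<in> V" for f using q'(2) m that by (force simp: A_def)
    then have "ext q' \<in> A" unfolding A_def using q' \<Phi> ext by (auto simp: ext_def)
    moreover have "P m (ext q')" using q'(2) m by (auto simp: P_def le_fun_def ext_def A_def)
    ultimately have "ext q' = m" by (rule min)
    then show ?thesis by (auto simp: ext_def)
  qed
  then show ?thesis using m by (intro exI[of _ m]) (auto simp: A_def)
qed

text \<open>The infimal convolution of \<open>r\<close> with a cone of affine lower constraints.\<close>
lemma sublinear_constrain:
  assumes V: "lin_space V" and r: "sublinear V r"
    and AV: "\<And>k c. (k, c) \<in> A \<Longrightarrow> k \<in> V" and A0: "((\<lambda>_. 0), 0) \<in> A"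
    and Aadd: "\<And>k c k' c'. (k, c) \<in> A \<Longrightarrow> (k', c') \<in> A \<Longrightarrow> ((\<lambda>x. k x + k' x), c + c') \<in> A"
    and Ascale: "\<And>k c t. (k, c) \<in> A \<Longrightarrow> t \<ge> 0 \<Longrightarrow> ((\<lambda>x. t * k x), t * c) \<in> A"
    and Ar: "\<And>k c. (k, c) \<in> A \<Longrightarrow> c \<le> r k"
  obtains r' where "sublinear V r'" "\<And>f. f \<in> V \<Longrightarrow> r' f \<le> r f"
    "\<And>f k c. f \<in> V \<Longrightarrow> (k, c) \<in> A \<Longrightarrow> r' f \<le> r (\<lambda>x. f x + k x) - c"
proof -
  define r' where "r' = (\<lambda>f. INF (k, c)\<in>A. r (\<lambda>x. f x + k x) - c)"
  \<comment> \<open>Finiteness comes from compatibility: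
    \<open>c <= r k <= r (f + k) + r (- f)\<close>.\<close>
  have bdd: "bdd_below ((\<lambda>(k, c). r (\<lambda>x. f x + k x) - c) ` A)" if f: "f \<in> V" for f
  proof (rule bdd_belowI2[where m = "- r (\<lambda>x. - f x)"])
    fix kc assume "kc \<in> A"
    then obtain k c where kc: "kc = (k, c)" "(k, c) \<in> A" by (cases kc) auto
    have "r (\<lambda>x. (f x + k x) + - f x) \<le> r (\<lambda>x. f x + k x) + r (\<lambda>x. - f x)"
      by (intro sublinear_add[OF r] lin_space_add[OF V] lin_space_uminus[OF V] f AV[OF kc(2)])
    then show "- r (\<lambda>x. - f x) \<le> (case kc of (k, c) \<Rightarrow> r (\<lambda>x. f x + k x) - c)"
      using Ar[OF kc(2)] by (simp add: kc(1))
  qed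
  have le: "r' f \<le> r (\<lambda>x. f x + k x) - c" if "f \<in> V" "(k, c) \<in> A" for f k c
    unfolding r'_def using cINF_lower[OF bdd[OF that(1)] that(2)] by simp
  have ge: "d \<le> r' f" if "\<And>k c. (k, c) \<in> A \<Longrightarrow> d \<le> r (\<lambda>x. f x + k x) - c" for d f
    unfolding r'_def using A0 that by (intro cINF_greatest) auto
  have "sublinear V r'"
    unfolding sublinear_def
  proof (intro conjI ballI allI impI)
    fix f g assume fg: "f \<in> V" "g \<in> V"
    have 1: "r' (\<lambda>x. f x + g x) \<le> (r (\<lambda>x. f x + k x) - c) + (r (\<lambda>x. g x + k' x) - c')"
      if kc: "(k, c) \<in> A" "(k', c') \<in> A" for k c k' c'
    proof -
      have "r' (\<lambda>x. f x + g x) \<le> r (\<lambda>x. (f x + g x) + (k x + k' x)) - (c + c')"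
        using le[OF lin_space_add[OF V fg] Aadd[OF kc]] .
      moreover have "r (\<lambda>x. (f x + k x) + (g x + k' x)) \<le> r (\<lambda>x. f x + k x) + r (\<lambda>x. g x + k' x)"
        by (intro sublinear_add[OF r] lin_space_add[OF V] fg AV[OF kc(1)] AV[OF kc(2)])
      ultimately show ?thesis by (simp add: algebra_simps)
    qed
    have "r' (\<lambda>x. f x + g x) - (r (\<lambda>x. f x + k x) - c) \<le> r' g" if "(k, c) \<in> A" for k c
      using 1[OF that] by (intro ge) (simp add: algebra_simps)
    then have "r' (\<lambda>x. f x + g x) - r' g \<le> r' f"
      by (intro ge) (simp add: algebra_simps)
    then show "r' (\<lambda>x. f x + g x) \<le> r' f + r' g" by simp
  next
    fix f and t :: real assume f: "f \<in> V" and t: "0 \<le> t"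
    have 1: "r' (\<lambda>x. t * f x) \<le> t * (r (\<lambda>x. f x + k x) - c)" if kc: "(k, c) \<in> A" for k c
    proof -
      have "r' (\<lambda>x. t * f x) \<le> r (\<lambda>x. t * f x + t * k x) - t * c"
        using le[OF lin_space_scale[OF V f] Ascale[OF kc t]] .
      moreover have "r (\<lambda>x. t * (f x + k x)) \<le> t * r (\<lambda>x. f x + k x)"
        by (intro sublinear_scale[OF r] lin_space_add[OF V] f AV[OF kc] t)
      ultimately show ?thesis by (simp add: algebra_simps)
    qed
    show "r' (\<lambda>x. t * f x) \<le> t * r' f"
    proof (cases "t = 0")
      case True
      then show ?thesis using 1[OF A0] by simp
    next
      case False
      have "r' (\<lambda>x. t * f x) / t \<le> r' f" using 1 False t by (intro ge) (simp add: field_simps)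
      then show ?thesis using False t by (simp add: field_simps)
    qed
  qed
  moreover have "r' f \<le> r f" if "f \<in> V" for f using le[OF that A0] by simp
  ultimately show ?thesis using that le by blast
qed

text \<open>A minimal sublinear \<open>q\<close> is additive: constraining it along the ray through
  \<open>f\<close> by the values \<open>t * q f\<close> gives a sublinear functional below
  \<open>q\<close>, hence equal to \<open>q\<close>, and the constraint at \<open>t = 1\<close>
  reads \<open>q k <= q (k + f) - q f\<close>, the reverse of subadditivity.\<close>

lemma hahn_banach_linear:
  assumes V: "lin_space V" and p: "sublinear V p"
  obtains m where "linear_func V m" "\<And>f. f \<in> V \<Longrightarrow> m f \<le> p f"
proof -
  have "\<exists>q. sublinear V q \<and> (\<forall>f\<in>V. q f \<le> p f) \<and> (\<forall>\<phi>\<in>{}. \<forall>f\<in>V. q (\<phi> f) = q f)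
    \<and> (\<forall>q'. sublinear V q' \<longrightarrow> (\<forall>f\<in>V. q' f \<le> q f) \<longrightarrow> (\<forall>\<phi>\<in>{}. \<forall>f\<in>V. q' (\<phi> f) = q' f)
         \<longrightarrow> (\<forall>f\<in>V. q' f = q f))"
    by (rule minimal_sublinear_exists[OF V p]) (erule emptyE)+
  then obtain q where q: "sublinear V q" "\<forall>f\<in>V. q f \<le> p f"
    and min: "\<forall>q'. sublinear V q' \<longrightarrow> (\<forall>f\<in>V. q' f \<le> q f) \<longrightarrow> (\<forall>f\<in>V. q' f = q f)"
    unfolding ball_simps simp_thms by (elim exE conjE)
  have scale: "q (\<lambda>x. c * f x) = c * q f" if f: "f \<in> V" and c: "c \<ge> 0" for f c
  proof (cases "c = 0")
    case True then show ?thesis using sublinear_zero[OF V q(1)] by simp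
  next
    case False
    have "q (\<lambda>x. inverse c * (c * f x)) \<le> inverse c * q (\<lambda>x. c * f x)"
      using c by (intro sublinear_scale[OF q(1)] lin_space_scale[OF V f]) auto
    moreover have "(\<lambda>x. inverse c * (c * f x)) = f" using False by (auto simp: field_simps)
    ultimately have "q f \<le> inverse c * q (\<lambda>x. c * f x)" by simp
    then have "c * q f \<le> q (\<lambda>x. c * f x)" using False c by (simp add: field_simps)
    then show ?thesis using sublinear_scale[OF q(1) f c] by linarith
  qed
  have add: "q (\<lambda>x. f x + k x) = q f + q k" if f: "f \<in> V" and k: "k \<in> V" for f k
  proof -
    define A where "A = (\<lambda>t. ((\<lambda>x. t * f x), t * q f)) ` {0..}"
    obtain r where r: "sublinear V r" "\<And>f. f \<in> V \<Longrightarrow> r f \<le> q f"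
      "\<And>g k c. g \<in> V \<Longrightarrow> (k, c) \<in> A \<Longrightarrow> r g \<le> q (\<lambda>x. g x + k x) - c"
    proof (rule sublinear_constrain[OF V q(1), of A])
      show "((\<lambda>_. 0), 0) \<in> A" by (auto simp: A_def intro!: image_eqI[of _ _ 0])
    next
      fix k c k' c' assume "(k, c) \<in> A" "(k', c') \<in> A"
      then obtain t t' where "t \<ge> 0" "t' \<ge> 0" "k = (\<lambda>x. t * f x)" "k' = (\<lambda>x. t' * f x)"
        "c = t * q f" "c' = t' * q f" by (auto simp: A_def)
      then show "((\<lambda>x. k x + k' x), c + c') \<in> A"
        by (auto simp: A_def algebra_simps intro!: image_eqI[of _ _ "t + t'"])
    next
      fix k c and t :: real assume "(k, c) \<in> A" "t \<ge> 0"
      then obtain t' where "t' \<ge> 0" "k = (\<lambda>x. t' * f x)" "c = t' * q f" by (auto simp: A_def)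
      then show "((\<lambda>x. t * k x), t * c) \<in> A" using \<open>t \<ge> 0\<close>
        by (auto simp: A_def algebra_simps intro!: image_eqI[of _ _ "t * t'"])
    qed (auto simp: A_def scale[OF f] intro!: lin_space_scale[OF V f])
    have "((\<lambda>x. 1 * f x), 1 * q f) \<in> A" unfolding A_def by (rule image_eqI[of _ _ 1]) auto
    from r(3)[OF k this] min[THEN spec, of r] r(1,2) k have "q k \<le> q (\<lambda>x. k x + f x) - q f" by simp
    moreover have "(\<lambda>x. k x + f x) = (\<lambda>x. f x + k x)" by (simp add: add.commute)
    ultimately show ?thesis using sublinear_add[OF q(1) f k] by simp
  qed
  have neg: "q (\<lambda>x. - f x) = - q f" if f: "f \<in> V" for f
    using add[OF f lin_space_uminus[OF V f]] sublinear_zero[OF V q(1)] by simp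
  have "q (\<lambda>x. c * f x) = c * q f" if f: "f \<in> V" for f c
    using scale[OF f, of c] scale[OF f, of "-c"] neg[OF lin_space_scale[OF V f], of c] by (cases "c \<ge> 0") auto
  then have "linear_func V q" using add by (auto simp: linear_func_def)
  then show ?thesis using q(2) that by blast
qed

text \<open>A constraint \<open>(k, c)\<close> acts through evaluation at \<open>- k\<close>, where
  the constrained functional is at most \<open>r 0 - c = - c\<close>; linearity of \<open>m\<close>
  turns this into \<open>c <= m k\<close>.\<close>

lemma hahn_banach_constrained:
  assumes V: "lin_space V" and r: "sublinear V r"
    and AV: "\<And>k c. (k, c) \<in> A \<Longrightarrow> k \<in> V" and A0: "((\<lambda>_. 0), 0) \<in> A"
    and Aadd: "\<And>k c k' c'. (k, c) \<in> A \<Longrightarrow> (k', c') \<in> A \<Longrightarrow> ((\<lambda>x. k x + k' x), c + c') \<in> A"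
    and Ascale: "\<And>k c t. (k, c) \<in> A \<Longrightarrow> t \<ge> 0 \<Longrightarrow> ((\<lambda>x. t * k x), t * c) \<in> A"
    and Ar: "\<And>k c. (k, c) \<in> A \<Longrightarrow> c \<le> r k"
  obtains m where "linear_func V m" "\<And>f. f \<in> V \<Longrightarrow> m f \<le> r f" "\<And>k c. (k, c) \<in> A \<Longrightarrow> c \<le> m k"
proof -
  obtain r' where r': "sublinear V r'" "\<And>f. f \<in> V \<Longrightarrow> r' f \<le> r f"
    "\<And>f k c. f \<in> V \<Longrightarrow> (k, c) \<in> A \<Longrightarrow> r' f \<le> r (\<lambda>x. f x + k x) - c"
    by (rule sublinear_constrain[where A = A, OF V r AV A0 Aadd Ascale Ar]) blast+
  obtain m where m: "linear_func V m" "\<And>f. f \<in> V \<Longrightarrow> m f \<le> r' f" using hahn_banach_linear[OF V r'(1)] by blast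
  show ?thesis
  proof (rule that[OF m(1)])
    show "m f \<le> r f" if "f \<in> V" for f using m(2)[OF that] r'(2)[OF that] by linarith
    fix k c assume kc: "(k, c) \<in> A"
    have "m (\<lambda>x. -1 * k x) = -1 * m k" using m(1) AV[OF kc] unfolding linear_func_def by blast
    moreover have "m (\<lambda>x. - k x) \<le> - c"
      using m(2)[OF lin_space_uminus[OF V AV[OF kc]]] r'(3)[OF lin_space_uminus[OF V AV[OF kc]] kc]
        sublinear_zero[OF V r] by simp
    ultimately show "c \<le> m k" by simp
  qed
qed

section \<open>Irreducible affine flows of means\<close>

locale discrete_group = group G for G :: "'a monoid" (structure)

lemma linear_func_add: "linear_func V m \<Longrightarrow> f \<in> V \<Longrightarrow> k \<in> V \<Longrightarrow> m (\<lambda>x. f x + k x) = m f + m k"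
  and linear_func_scale: "linear_func V m \<Longrightarrow> f \<in> V \<Longrightarrow> m (\<lambda>x. c * f x) = c * m f"
  by (auto simp: linear_func_def)

lemma linear_func_uminus: "linear_func V m \<Longrightarrow> f \<in> V \<Longrightarrow> m (\<lambda>x. - f x) = - m f"
  using linear_func_scale[of V m f "-1"] by simp

lemma linear_func_diff:
  "lin_space V \<Longrightarrow> linear_func V m \<Longrightarrow> f \<in> V \<Longrightarrow> k \<in> V \<Longrightarrow> m (\<lambda>x. f x - k x) = m f - m k"
  using linear_func_add[of V m f "\<lambda>x. - k x"] by (simp add: linear_func_uminus lin_space_uminus)

lemma lin_space_diff: "lin_space V \<Longrightarrow> f \<in> V \<Longrightarrow> k \<in> V \<Longrightarrow> (\<lambda>x. f x - k x) \<in> V"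
  using lin_space_add[of V f "\<lambda>x. - k x"] by (simp add: lin_space_uminus)

lemma linfI: "(\<And>h. h \<in> H \<Longrightarrow> \<bar>f h\<bar> \<le> B) \<Longrightarrow> (\<And>x. x \<notin> H \<Longrightarrow> f x = 0) \<Longrightarrow> f \<in> linf H"
  by (auto simp: linf_def)

lemma linf_bound: "f \<in> linf H \<Longrightarrow> \<exists>B. \<forall>h\<in>H. \<bar>f h\<bar> \<le> B"
  by (auto simp: linf_def)

lemma linf_zero: "f \<in> linf H \<Longrightarrow> x \<notin> H \<Longrightarrow> f x = 0"
  by (auto simp: linf_def)

lemma linf_mult:
  assumes "f \<in> linf H" "k \<in> linf H" shows "(\<lambda>x. f x * k x) \<in> linf H"
proof -
  obtain B B' where "\<forall>h\<in>H. \<bar>f h\<bar> \<le> B" "\<forall>h\<in>H. \<bar>k h\<bar> \<le> B'" using assms linf_bound by metis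
  then show ?thesis using linf_zero[OF assms(1)]
    by (intro linfI[where B = "B * B'"]) (auto simp: abs_mult intro!: mult_mono)
qed

lemma lin_space_linf: "lin_space (linf H)"
  unfolding lin_space_def
proof (intro conjI ballI allI)
  show "(\<lambda>_. 0) \<in> linf H" by (rule linfI[where B = 0]) auto
  fix f assume f: "f \<in> linf H"
  then obtain B where B: "\<forall>h\<in>H. \<bar>f h\<bar> \<le> B" using linf_bound by metis
  show "(\<lambda>x. c * f x) \<in> linf H" for c
    using B linf_zero[OF f] by (intro linfI[where B = "\<bar>c\<bar> * B"]) (auto simp: abs_mult intro: mult_left_mono)
  fix k assume k: "k \<in> linf H"
  then obtain B' where B': "\<forall>h\<in>H. \<bar>k h\<bar> \<le> B'" using linf_bound by metis
  show "(\<lambda>x. f x + k x) \<in> linf H"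
    using B B' linf_zero[OF f] linf_zero[OF k]
    by (intro linfI[where B = "B + B'"]) (auto intro: order_trans[OF abs_triangle_ineq] add_mono)
qed

lemma linf_const: "(\<lambda>x. if x \<in> H then c else 0) \<in> linf H"
  by (rule linfI[where B = "\<bar>c\<bar>"]) auto

context discrete_group
begin

abbreviation V :: "('a \<Rightarrow> real) set" where "V \<equiv> linf (carrier G)"

lemmas V_add = lin_space_add[OF lin_space_linf[of "carrier G"]]
  and V_scale = lin_space_scale[OF lin_space_linf[of "carrier G"]]
  and V_uminus = lin_space_uminus[OF lin_space_linf[of "carrier G"]]
  and V_diff = lin_space_diff[OF lin_space_linf[of "carrier G"]]

definition ltrans :: "'a \<Rightarrow> ('a \<Rightarrow> real) \<Rightarrow> 'a \<Rightarrow> real" where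
  "ltrans t f = (\<lambda>g. if g \<in> carrier G then f (inv t \<otimes> g) else 0)"

lemma ltrans_closed: "t \<in> carrier G \<Longrightarrow> f \<in> V \<Longrightarrow> ltrans t f \<in> V"
proof -
  assume t: "t \<in> carrier G" and f: "f \<in> V"
  then obtain B where B: "\<forall>h\<in>carrier G. \<bar>f h\<bar> \<le> B" using linf_bound by metis
  show ?thesis using B t by (intro linfI[where B = B]) (auto simp: ltrans_def)
qed

lemma ltrans_ltrans:
  "s \<in> carrier G \<Longrightarrow> t \<in> carrier G \<Longrightarrow> ltrans s (ltrans t f) = ltrans (s \<otimes> t) f"
  by (auto simp: ltrans_def inv_mult_group m_assoc fun_eq_iff)

lemma ltrans_one: "f \<in> V \<Longrightarrow> ltrans \<one> f = f"
  using linf_zero[of f] by (auto simp: ltrans_def fun_eq_iff)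

lemma ltrans_add: "ltrans t (\<lambda>g. f g + k g) = (\<lambda>g. ltrans t f g + ltrans t k g)"
  and ltrans_scale: "ltrans t (\<lambda>g. c * f g) = (\<lambda>g. c * ltrans t f g)"
  by (auto simp: ltrans_def)

text \<open>The last clause says that \<open>r\<close> lies below the supremum over the group; it
  forces every linear functional below \<open>r\<close> to be a mean. Invariance may be one-sided
  since translations are invertible.\<close>

definition inv_sublinear :: "(('a \<Rightarrow> real) \<Rightarrow> real) \<Rightarrow> bool" where
  "inv_sublinear r \<longleftrightarrow> sublinear V r \<and> (\<forall>t\<in>carrier G. \<forall>f\<in>V. r (ltrans t f) \<le> r f)
     \<and> (\<forall>f\<in>V. \<forall>c. (\<forall>g\<in>carrier G. f g \<le> c) \<longrightarrow> r f \<le> c)"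

lemma inv_sublinear_ltrans:
  assumes "inv_sublinear r" "t \<in> carrier G" "f \<in> V" shows "r (ltrans t f) = r f"
proof (rule antisym)
  show "r (ltrans t f) \<le> r f" using assms by (auto simp: inv_sublinear_def)
  have "r (ltrans (inv t) (ltrans t f)) \<le> r (ltrans t f)"
    using assms ltrans_closed by (auto simp: inv_sublinear_def)
  then show "r f \<le> r (ltrans t f)" using assms by (simp add: ltrans_ltrans ltrans_one)
qed

lemma inv_sublinear_le: "inv_sublinear r \<Longrightarrow> f \<in> V \<Longrightarrow> (\<And>g. g \<in> carrier G \<Longrightarrow> f g \<le> c) \<Longrightarrow> r f \<le> c"
  by (auto simp: inv_sublinear_def)

text \<open>This is the support function of the set of all means, the starting point for the
  minimisation.\<close>

lemma sup_inv_sublinear: "inv_sublinear (\<lambda>f. SUP g\<in>carrier G. f g)"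
proof -
  have ne: "carrier G \<noteq> {}" by auto
  have bdd: "bdd_above (f ` carrier G)" if "f \<in> V" for f
  proof -
    obtain B where "\<forall>h\<in>carrier G. \<bar>f h\<bar> \<le> B" using linf_bound \<open>f \<in> V\<close> by metis
    then show ?thesis by (intro bdd_aboveI2[where M = B]) auto
  qed
  have up: "f g \<le> (SUP g\<in>carrier G. f g)" if "f \<in> V" "g \<in> carrier G" for f g
    using cSUP_upper[OF that(2) bdd[OF that(1)]] .
  show ?thesis
    unfolding inv_sublinear_def sublinear_def
  proof (intro conjI ballI allI impI)
    fix f k assume "f \<in> V" "k \<in> V"
    then show "(SUP g\<in>carrier G. f g + k g) \<le> (SUP g\<in>carrier G. f g) + (SUP g\<in>carrier G. k g)"
      using up by (intro cSUP_least[OF ne] add_mono) auto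
  next
    fix f and c :: real assume "f \<in> V" "0 \<le> c"
    then show "(SUP g\<in>carrier G. c * f g) \<le> c * (SUP g\<in>carrier G. f g)"
      using up by (intro cSUP_least[OF ne] mult_left_mono) auto
  next
    fix f t assume "f \<in> V" "t \<in> carrier G"
    then show "(SUP g\<in>carrier G. ltrans t f g) \<le> (SUP g\<in>carrier G. f g)"
      using up by (intro cSUP_least[OF ne]) (auto simp: ltrans_def)
  next
    fix f and c :: real assume "\<forall>g\<in>carrier G. f g \<le> c"
    then show "(SUP g\<in>carrier G. f g) \<le> c" by (intro cSUP_least[OF ne]) auto
  qed
qed

end

text \<open>A minimal invariant sublinear functional is the support function of an irreducible
  affine flow inside the space of means on \<open>G\<close>; the means in this flow are the
  linear functionals dominated by it.\<close>
locale minimal_flow = discrete_group +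
  fixes p :: "('a \<Rightarrow> real) \<Rightarrow> real"
  assumes p_inv: "inv_sublinear p"
    and p_min: "inv_sublinear q \<Longrightarrow> (\<And>f. f \<in> V \<Longrightarrow> q f \<le> p f) \<Longrightarrow> f \<in> V \<Longrightarrow> q f = p f"

lemma (in discrete_group) minimal_flow_exists: "\<exists>p. minimal_flow G p"
proof -
  define p0 where "p0 = (\<lambda>f :: 'a \<Rightarrow> real. SUP g\<in>carrier G. f g)"
  have p0: "inv_sublinear p0" unfolding p0_def by (rule sup_inv_sublinear)
  have p0s: "sublinear V p0" using p0 by (simp add: inv_sublinear_def)
  have "\<exists>q. sublinear V q \<and> (\<forall>f\<in>V. q f \<le> p0 f) \<and> (\<forall>\<phi>\<in>ltrans ` carrier G. \<forall>f\<in>V. q (\<phi> f) = q f)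
    \<and> (\<forall>q'. sublinear V q' \<longrightarrow> (\<forall>f\<in>V. q' f \<le> q f) \<longrightarrow>
         (\<forall>\<phi>\<in>ltrans ` carrier G. \<forall>f\<in>V. q' (\<phi> f) = q' f) \<longrightarrow> (\<forall>f\<in>V. q' f = q f))"
    by (rule minimal_sublinear_exists[OF lin_space_linf p0s])
      (auto simp: inv_sublinear_ltrans[OF p0] ltrans_closed)
  then obtain q where q: "sublinear V q" "\<forall>f\<in>V. q f \<le> p0 f" "\<forall>t\<in>carrier G. \<forall>f\<in>V. q (ltrans t f) = q f"
    and min: "\<forall>q'. sublinear V q' \<longrightarrow> (\<forall>f\<in>V. q' f \<le> q f) \<longrightarrow>
         (\<forall>t\<in>carrier G. \<forall>f\<in>V. q' (ltrans t f) = q' f) \<longrightarrow> (\<forall>f\<in>V. q' f = q f)"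
    unfolding ball_simps by (elim exE conjE)
  have "minimal_flow G q"
  proof (unfold_locales)
    show "inv_sublinear q"
      unfolding inv_sublinear_def
    proof (intro conjI ballI allI impI)
      fix f c assume f: "f \<in> V" and c: "\<forall>g\<in>carrier G. f g \<le> c"
      show "q f \<le> c" using q(2) f inv_sublinear_le[OF p0 f, of c] c by (meson order_trans)
    qed (use q in auto)
    fix q' f assume "inv_sublinear q'" "\<And>f. f \<in> V \<Longrightarrow> q' f \<le> q f" "f \<in> V"
    then show "q' f = q f"
      using inv_sublinear_ltrans[of q'] min[THEN spec, of q'] unfolding inv_sublinear_def by blast
  qed
  then show ?thesis by blast
qed

section \<open>Points of the flow, Poisson transforms, and the kernel of the action\<close>

context minimal_flow
begin

definition dominated :: "(('a \<Rightarrow> real) \<Rightarrow> real) \<Rightarrow> bool" where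
  "dominated x \<longleftrightarrow> linear_func V x \<and> (\<forall>f\<in>V. x f \<le> p f)"

lemma dominated_exists: "\<exists>x. dominated x"
proof -
  have "sublinear V p" using p_inv by (simp add: inv_sublinear_def)
  from hahn_banach_linear[OF lin_space_linf this] show ?thesis
    unfolding dominated_def by metis
qed

lemma dominated_le:
  assumes "dominated x" "f \<in> V" "\<And>g. g \<in> carrier G \<Longrightarrow> f g \<le> c" shows "x f \<le> c"
  using assms inv_sublinear_le[OF p_inv, of f c] unfolding dominated_def by force

lemma dominated_ge:
  assumes "dominated x" "f \<in> V" "\<And>g. g \<in> carrier G \<Longrightarrow> c \<le> f g" shows "c \<le> x f"
  using dominated_le[OF assms(1) V_uminus[OF assms(2)], of "-c"] assms(3)
    linear_func_uminus[OF _ assms(2), of x] assms(1,3) by (simp add: dominated_def)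

lemma dominated_ltrans:
  assumes "dominated x" "t \<in> carrier G" shows "dominated (\<lambda>f. x (ltrans t f))"
proof -
  have x: "linear_func V x" and le: "\<And>f. f \<in> V \<Longrightarrow> x f \<le> p f" using assms(1) by (auto simp: dominated_def)
  have "x (ltrans t f) \<le> p f" if "f \<in> V" for f
    using le[OF ltrans_closed[OF assms(2) that]] inv_sublinear_ltrans[OF p_inv assms(2) that] by simp
  moreover have "linear_func V (\<lambda>f. x (ltrans t f))"
    unfolding linear_func_def ltrans_add ltrans_scale
    by (intro conjI ballI allI linear_func_add[OF x] linear_func_scale[OF x] ltrans_closed[OF assms(2)])
  ultimately show ?thesis by (simp add: dominated_def)
qed

text \<open>Each \<open>f\<close> is an affine function on the flow; its Poisson transform reads
  that function along the orbit of \<open>x\<close>, the value at \<open>g\<close> being taken at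
  the point \<open>\<lambda>f. x (ltrans (inv g) f)\<close>.\<close>

definition poisson :: "(('a \<Rightarrow> real) \<Rightarrow> real) \<Rightarrow> ('a \<Rightarrow> real) \<Rightarrow> 'a \<Rightarrow> real" where
  "poisson x f = (\<lambda>g. if g \<in> carrier G then x (ltrans (inv g) f) else 0)"

lemma poisson_closed:
  assumes x: "dominated x" and f: "f \<in> V" shows "poisson x f \<in> V"
proof -
  obtain B where B: "\<forall>h\<in>carrier G. \<bar>f h\<bar> \<le> B" using linf_bound f by metis
  have "\<bar>x (ltrans (inv g) f)\<bar> \<le> B" if g: "g \<in> carrier G" for g
  proof -
    have "\<bar>ltrans (inv g) f h\<bar> \<le> B" if "h \<in> carrier G" for h using B g that by (auto simp: ltrans_def)
    then show ?thesis
      using dominated_le[OF x ltrans_closed[of "inv g" f], of B] dominated_ge[OF x ltrans_closed[of "inv g" f], of "-B"] f g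
      by (simp add: abs_le_iff) (smt (verit))
  qed
  then show ?thesis by (intro linfI[where B = B]) (auto simp: poisson_def)
qed

lemma poisson_add:
  "dominated x \<Longrightarrow> f \<in> V \<Longrightarrow> k \<in> V \<Longrightarrow> poisson x (\<lambda>g. f g + k g) = (\<lambda>g. poisson x f g + poisson x k g)"
  and poisson_scale: "dominated x \<Longrightarrow> f \<in> V \<Longrightarrow> poisson x (\<lambda>g. c * f g) = (\<lambda>g. c * poisson x f g)"
  by (auto simp: poisson_def ltrans_add ltrans_scale dominated_def linear_func_add linear_func_scale ltrans_closed)

lemma poisson_diff:
  "dominated x \<Longrightarrow> f \<in> V \<Longrightarrow> k \<in> V \<Longrightarrow> poisson x (\<lambda>g. f g - k g) = (\<lambda>g. poisson x f g - poisson x k g)"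
  using poisson_add[of x f "\<lambda>g. -1 * k g"] poisson_scale[of x k "-1"] V_uminus[of k] by simp

lemma poisson_ltrans:
  "t \<in> carrier G \<Longrightarrow> poisson x (ltrans t f) = ltrans t (poisson x f)"
  by (auto simp: poisson_def ltrans_ltrans inv_mult_group fun_eq_iff) (auto simp: ltrans_def inv_mult_group)

text \<open>By minimality every invariant sublinear functional becomes \<open>p\<close> after a Poisson transform.
  This replaces strong proximality of the Furstenberg boundary.\<close>
lemma inv_sublinear_poisson:
  assumes r: "inv_sublinear r" and x: "dominated x" and f: "f \<in> V"
  shows "r (poisson x f) = p f"
proof (rule p_min[OF _ _ f, where q = "\<lambda>f. r (poisson x f)"])
  have rs: "sublinear V r" using r by (simp add: inv_sublinear_def)
  show le: "r (poisson x f) \<le> p f" if f: "f \<in> V" for f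
  proof (rule inv_sublinear_le[OF r poisson_closed[OF x f]])
    fix g assume g: "g \<in> carrier G"
    then have "x (ltrans (inv g) f) \<le> p (ltrans (inv g) f)"
      using x ltrans_closed f by (auto simp: dominated_def)
    then show "poisson x f g \<le> p f" using g f inv_sublinear_ltrans[OF p_inv] by (simp add: poisson_def)
  qed
  show "inv_sublinear (\<lambda>f. r (poisson x f))"
    unfolding inv_sublinear_def sublinear_def
  proof (intro conjI ballI allI impI)
    fix f k assume fk: "f \<in> V" "k \<in> V"
    show "r (poisson x (\<lambda>g. f g + k g)) \<le> r (poisson x f) + r (poisson x k)"
      using fk x by (simp add: poisson_add sublinear_add[OF rs] poisson_closed)
  next
    fix f and c :: real assume "f \<in> V" "0 \<le> c"
    then show "r (poisson x (\<lambda>g. c * f g)) \<le> c * r (poisson x f)"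
      using x by (simp add: poisson_scale sublinear_scale[OF rs] poisson_closed)
  next
    fix f t assume "f \<in> V" "t \<in> carrier G"
    then show "r (poisson x (ltrans t f)) \<le> r (poisson x f)"
      using x by (simp add: poisson_ltrans inv_sublinear_ltrans[OF r] poisson_closed)
  next
    fix f and c :: real assume f: "f \<in> V" and c: "\<forall>g\<in>carrier G. f g \<le> c"
    then show "r (poisson x f) \<le> c" using le[OF f] inv_sublinear_le[OF p_inv f, of c] by fastforce
  qed
qed

definition kern :: "'a set" where
  "kern = {s \<in> carrier G. \<forall>x. dominated x \<longrightarrow> (\<forall>f\<in>V. x (ltrans s f) = x f)}"

text \<open>For normality, conjugation by \<open>t\<close> replaces the point \<open>x\<close> by
  its translate \<open>\<lambda>f. x (ltrans t f)\<close>, which is again in the flow and on which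
  \<open>s\<close> therefore acts trivially too.\<close>

lemma kern_normal: "kern \<lhd> G"
proof -
  have sub: "subgroup kern G"
  proof
    show "kern \<subseteq> carrier G" by (auto simp: kern_def)
    show "\<one> \<in> kern" by (auto simp: kern_def ltrans_one)
    show "s \<otimes> t \<in> kern" if "s \<in> kern" "t \<in> kern" for s t
      using that ltrans_closed by (auto simp: kern_def simp flip: ltrans_ltrans)
    show "inv s \<in> kern" if s: "s \<in> kern" for s
    proof -
      have "x (ltrans (inv s) f) = x f" if "dominated x" "f \<in> V" for x f
      proof -
        have "x (ltrans s (ltrans (inv s) f)) = x (ltrans (inv s) f)"
          using that s ltrans_closed by (auto simp: kern_def)
        then show ?thesis using that s by (auto simp: kern_def ltrans_ltrans ltrans_one)
      qed
      then show ?thesis using s by (auto simp: kern_def)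
    qed
  qed
  moreover have "t \<otimes> s \<otimes> inv t \<in> kern" if t: "t \<in> carrier G" and s: "s \<in> kern" for s t
  proof -
    have "x (ltrans (t \<otimes> s \<otimes> inv t) f) = x f" if x: "dominated x" and f: "f \<in> V" for x f
    proof -
      have sc: "s \<in> carrier G" using s by (simp add: kern_def)
      have "x (ltrans (t \<otimes> s \<otimes> inv t) f) = x (ltrans t (ltrans s (ltrans (inv t) f)))"
        using t sc by (simp add: ltrans_ltrans m_assoc)
      also have "\<dots> = x (ltrans t (ltrans (inv t) f))"
        using s dominated_ltrans[OF x t] ltrans_closed[of "inv t" f] t f by (auto simp: kern_def)
      also have "\<dots> = x f" using t f by (simp add: ltrans_ltrans ltrans_one)
      finally show ?thesis .
    qed
    then show ?thesis using t s by (auto simp: kern_def)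
  qed
  ultimately show ?thesis by (simp add: normal_inv_iff)
qed

text \<open>Functions on the kernel are lifted to \<open>G\<close> along a transversal of its cosets.\<close>
lemma kern_amenable: "amenable_subgroup G kern"
proof -
  have sub: "subgroup kern G" using kern_normal by (simp add: normal_inv_iff)
  have kc: "s \<in> kern \<Longrightarrow> s \<in> carrier G" for s by (simp add: kern_def)
  obtain x where x: "dominated x" using dominated_exists by blast
  then have xl: "linear_func V x" by (simp add: dominated_def)
  \<comment> \<open>The choice depends on the coset alone, so \<open>c\<close> is a transversal, and
    \<open>n g\<close> is the kernel component in \<open>g = n g \<otimes> c g\<close>.\<close>
  define c where "c = (\<lambda>g. SOME h. h \<in> kern #> g)"
  define n where "n = (\<lambda>g. g \<otimes> inv (c g))"
  have c: "c g \<in> kern #> g" if "g \<in> carrier G" for g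
    unfolding c_def using rcos_self[OF that sub] by (rule someI)
  have cc: "c g \<in> carrier G" if "g \<in> carrier G" for g
    using c[OF that] sub that r_coset_subset_G[OF subgroup.subset[OF sub] that] by blast
  have n: "n g \<in> kern" if g: "g \<in> carrier G" for g
  proof -
    obtain h where h: "h \<in> kern" "c g = h \<otimes> g" using c[OF g] by (auto simp: r_coset_def)
    then have "n g = inv h" using g kc[OF h(1)] by (simp add: n_def inv_mult_group m_assoc[symmetric])
    then show ?thesis using h(1) sub by (simp add: subgroup.m_inv_closed)
  qed
  \<comment> \<open>Left multiplication by a kernel element preserves the right coset, hence leaves
    the chosen representative unchanged.\<close>
  have nmult: "n (s \<otimes> g) = s \<otimes> n g" if s: "s \<in> kern" and g: "g \<in> carrier G" for s g
  proof -
    have "kern #> (s \<otimes> g) = kern #> s #> g"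
      using coset_mult_assoc[OF subgroup.subset[OF sub] kc[OF s] g] by simp
    then have "c (s \<otimes> g) = c g"
      unfolding c_def using coset_join2[OF kc[OF s] sub s] by simp
    then show ?thesis using kc[OF s] g cc[OF g] by (simp add: n_def m_assoc)
  qed
  define lift where "lift = (\<lambda>(a :: 'a \<Rightarrow> real) g. if g \<in> carrier G then a (n g) else 0)"
  have lift: "lift a \<in> V" if "a \<in> linf kern" for a
  proof -
    obtain B where "\<forall>h\<in>kern. \<bar>a h\<bar> \<le> B" using linf_bound \<open>a \<in> linf kern\<close> by metis
    then show ?thesis using n by (intro linfI[where B = B]) (auto simp: lift_def)
  qed
  show ?thesis
    unfolding amenable_subgroup_def
  proof (intro conjI sub exI[of _ "\<lambda>a. x (lift a)"] ballI allI impI)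
    fix f k and a b :: real assume fk: "f \<in> linf kern" "k \<in> linf kern"
    have "lift (\<lambda>h. a * f h + b * k h) = (\<lambda>g. a * lift f g + b * lift k g)" by (auto simp: lift_def)
    then show "x (lift (\<lambda>h. a * f h + b * k h)) = a * x (lift f) + b * x (lift k)"
      using linear_func_add[OF xl V_scale[OF lift[OF fk(1)], of a] V_scale[OF lift[OF fk(2)], of b]]
        linear_func_scale[OF xl lift[OF fk(1)], of a] linear_func_scale[OF xl lift[OF fk(2)], of b] by simp
  next
    fix f assume "f \<in> linf kern" "\<forall>h\<in>kern. 0 \<le> f h"
    then show "0 \<le> x (lift f)" using n by (intro dominated_ge[OF x lift]) (auto simp: lift_def)
  next
    have "lift (\<lambda>h. if h \<in> kern then 1 else 0) \<in> V" by (rule lift[OF linf_const])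
    then show "x (lift (\<lambda>h. if h \<in> kern then 1 else 0)) = 1"
      using dominated_le[OF x, of _ 1] dominated_ge[OF x, of _ 1] n by (intro antisym) (auto simp: lift_def)
  next
    fix f s assume f: "f \<in> linf kern" and s: "s \<in> kern"
    have "inv s \<in> kern" using s sub by (simp add: subgroup.m_inv_closed)
    \<comment> \<open>Translation on the kernel lifts to translation on the group by
      \<open>inv s\<close>, again a kernel element, to which every point of the flow is
      blind.\<close>
    moreover have "lift (\<lambda>h. if h \<in> kern then f (s \<otimes> h) else 0) = ltrans (inv s) (lift f)"
      using n nmult[OF s] kc[OF s] by (auto simp: lift_def ltrans_def fun_eq_iff)
    ultimately show "x (lift (\<lambda>h. if h \<in> kern then f (s \<otimes> h) else 0)) = x (lift f)"
      using x lift[OF f] by (simp add: kern_def)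
  qed
qed

text \<open>A mean on \<open>M\<close> yields an invariant sublinear functional \<open>r\<close> by
  averaging over translates of \<open>M\<close>. Normality makes \<open>r\<close> at most 0 on
  \<open>ltrans s k - k\<close> for \<open>s\<close> in \<open>M\<close>. Since \<open>r\<close>
  composed with a Poisson transform is \<open>p\<close>, every point of the flow satisfies
  \<open>x (ltrans s f) <= x f\<close>, and applying this to \<open>- f\<close> gives
  equality.\<close>

lemma amenable_normal_le_kern:
  assumes M: "M \<lhd> G" and am: "amenable_subgroup G M"
  shows "M \<subseteq> kern"
proof
  have sub: "subgroup M G" and conj: "\<And>t s. t \<in> carrier G \<Longrightarrow> s \<in> M \<Longrightarrow> t \<otimes> s \<otimes> inv t \<in> M"
    using M by (auto simp: normal_inv_iff)
  have Mc: "h \<in> carrier G" if "h \<in> M" for h using subgroup.subset[OF sub] that by auto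
  obtain \<mu> :: "('a \<Rightarrow> real) \<Rightarrow> real" where \<mu>:
    "(\<forall>f\<in>linf M. \<forall>k\<in>linf M. \<forall>a b. \<mu> (\<lambda>x. a * f x + b * k x) = a * \<mu> f + b * \<mu> k)
     \<and> (\<forall>f\<in>linf M. (\<forall>h\<in>M. f h \<ge> 0) \<longrightarrow> \<mu> f \<ge> 0)
     \<and> \<mu> (\<lambda>x. if x \<in> M then 1 else 0) = 1
     \<and> (\<forall>f\<in>linf M. \<forall>s\<in>M. \<mu> (\<lambda>x. if x \<in> M then f (s \<otimes> x) else 0) = \<mu> f)"
    using am[unfolded amenable_subgroup_def, THEN conjunct2] by (rule exE)
  have lin: "\<mu> (\<lambda>x. a * f x + b * k x) = a * \<mu> f + b * \<mu> k" if "f \<in> linf M" "k \<in> linf M" for f k a b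
    using \<mu>[THEN conjunct1] that by blast
  have pos: "\<mu> f \<ge> 0" if "f \<in> linf M" "\<forall>h\<in>M. f h \<ge> 0" for f
    using \<mu>[THEN conjunct2, THEN conjunct1] that by blast
  have one: "\<mu> (\<lambda>x. if x \<in> M then 1 else 0) = 1" using \<mu> by (elim conjE)
  have inva: "\<mu> (\<lambda>x. if x \<in> M then f (s \<otimes> x) else 0) = \<mu> f" if "f \<in> linf M" "s \<in> M" for f s
    using \<mu>[THEN conjunct2, THEN conjunct2, THEN conjunct2] that by blast
  have \<mu>le: "\<mu> f \<le> c" if f: "f \<in> linf M" and c: "\<And>h. h \<in> M \<Longrightarrow> f h \<le> c" for f c
  proof -
    have "0 \<le> \<mu> (\<lambda>h. c * (if h \<in> M then 1 else 0) + (-1) * f h)"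
      using c by (intro pos lin_space_add[OF lin_space_linf] lin_space_scale[OF lin_space_linf] linf_const f) auto
    also have "\<dots> = c - \<mu> f" using lin[OF linf_const[of M 1] f, of c "-1"] one by simp
    finally show ?thesis by simp
  qed
  define W where "W = (\<lambda>t g (f :: 'a \<Rightarrow> real) h. if h \<in> M then f (t \<otimes> h \<otimes> g) else 0)"
  have W: "W t g f \<in> linf M" if "f \<in> V" "t \<in> carrier G" "g \<in> carrier G" for t g f
  proof -
    obtain B where "\<forall>h\<in>carrier G. \<bar>f h\<bar> \<le> B" using linf_bound \<open>f \<in> V\<close> by metis
    then show ?thesis using that Mc by (intro linfI[where B = B]) (auto simp: W_def)
  qed
  \<comment> \<open>Taking the supremum over the left factor \<open>t\<close> makes \<open>r\<close>
    invariant: translating by \<open>s\<close> only replaces \<open>t\<close> by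
    \<open>inv s \<otimes> t\<close>.\<close>
  define r where "r = (\<lambda>f. SUP (t, g)\<in>carrier G \<times> carrier G. \<mu> (W t g f))"
  have ne: "carrier G \<times> carrier G \<noteq> {}" by auto
  have mterm: "\<mu> (W t g f) \<le> c" if "f \<in> V" "t \<in> carrier G" "g \<in> carrier G" "\<And>h. h \<in> carrier G \<Longrightarrow> f h \<le> c" for t g f c
    using that Mc by (intro \<mu>le W) (auto simp: W_def)
  have bdd: "bdd_above ((\<lambda>(t, g). \<mu> (W t g f)) ` (carrier G \<times> carrier G))" if f: "f \<in> V" for f
  proof -
    obtain B where "\<forall>h\<in>carrier G. \<bar>f h\<bar> \<le> B" using linf_bound f by metis
    then show ?thesis using mterm[OF f, of _ _ B] by (intro bdd_aboveI2[where M = B]) (auto simp: abs_le_iff)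
  qed
  have up: "\<mu> (W t g f) \<le> r f" if "f \<in> V" "t \<in> carrier G" "g \<in> carrier G" for f t g
    using cSUP_upper[OF _ bdd[OF that(1)], of "(t, g)"] that by (simp add: r_def)
  have least: "r f \<le> c" if "\<And>t g. t \<in> carrier G \<Longrightarrow> g \<in> carrier G \<Longrightarrow> \<mu> (W t g f) \<le> c" for f c
    unfolding r_def using that by (intro cSUP_least[OF ne]) auto
  have r: "inv_sublinear r"
    unfolding inv_sublinear_def sublinear_def
  proof (intro conjI ballI allI impI)
    fix f k assume fk: "f \<in> V" "k \<in> V"
    show "r (\<lambda>x. f x + k x) \<le> r f + r k"
    proof (rule least)
      fix t g assume tg: "t \<in> carrier G" "g \<in> carrier G"
      have "W t g (\<lambda>x. f x + k x) = (\<lambda>h. 1 * W t g f h + 1 * W t g k h)" by (auto simp: W_def)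
      then have "\<mu> (W t g (\<lambda>x. f x + k x)) = \<mu> (W t g f) + \<mu> (W t g k)"
        using lin[OF W[OF fk(1) tg] W[OF fk(2) tg], of 1 1] by simp
      then show "\<mu> (W t g (\<lambda>x. f x + k x)) \<le> r f + r k" using up[OF fk(1) tg] up[OF fk(2) tg] by simp
    qed
  next
    fix f and c :: real assume f: "f \<in> V" and c: "0 \<le> c"
    show "r (\<lambda>x. c * f x) \<le> c * r f"
    proof (rule least)
      fix t g assume tg: "t \<in> carrier G" "g \<in> carrier G"
      have "W t g (\<lambda>x. c * f x) = (\<lambda>h. c * W t g f h + 0 * W t g f h)" by (auto simp: W_def)
      then have "\<mu> (W t g (\<lambda>x. c * f x)) = c * \<mu> (W t g f)"
        using lin[OF W[OF f tg] W[OF f tg], of c 0] by simp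
      then show "\<mu> (W t g (\<lambda>x. c * f x)) \<le> c * r f" using up[OF f tg] c by (simp add: mult_left_mono)
    qed
  next
    fix s f assume s: "s \<in> carrier G" and f: "f \<in> V"
    show "r (ltrans s f) \<le> r f"
    proof (rule least)
      fix t g assume tg: "t \<in> carrier G" "g \<in> carrier G"
      have "W t g (ltrans s f) = W (inv s \<otimes> t) g f"
        using tg s Mc by (auto simp: W_def ltrans_def m_assoc fun_eq_iff)
      then show "\<mu> (W t g (ltrans s f)) \<le> r f" using up[OF f _ tg(2), of "inv s \<otimes> t"] s tg by simp
    qed
  next
    fix f c assume "f \<in> V" "\<forall>g\<in>carrier G. f g \<le> c"
    then show "r f \<le> c" using mterm by (intro least) auto
  qed
  fix s assume s: "s \<in> M"
  have le: "x (ltrans s f) \<le> x f" if x: "dominated x" and f: "f \<in> V" for x f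
  proof -
    have sf: "ltrans s f \<in> V" using ltrans_closed[OF Mc[OF s] f] .
    have "x (\<lambda>g. ltrans s f g - f g) \<le> p (\<lambda>g. ltrans s f g - f g)"
      using x V_diff[OF sf f] by (simp add: dominated_def)
    also have "\<dots> = r (poisson x (\<lambda>g. ltrans s f g - f g))"
      by (rule inv_sublinear_poisson[OF r x V_diff[OF sf f], symmetric])
    also have "poisson x (\<lambda>g. ltrans s f g - f g) = (\<lambda>g. ltrans s (poisson x f) g - poisson x f g)"
      using poisson_diff[OF x sf f] poisson_ltrans[OF Mc[OF s]] by simp
    also have "r \<dots> \<le> 0"
    proof (rule least)
      fix t g assume tg: "t \<in> carrier G" "g \<in> carrier G"
      define k where "k = poisson x f"
      have k: "k \<in> V" using poisson_closed[OF x f] by (simp add: k_def)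
      \<comment> \<open>Normality moves \<open>inv s\<close> past \<open>t\<close> at the price of
        conjugating it; the conjugate stays in \<open>M\<close> and is absorbed by the invariance of
        the mean.\<close>
      define s' where "s' = inv t \<otimes> inv s \<otimes> t"
      have s': "s' \<in> M" using conj[of "inv t" "inv s"] tg s sub by (simp add: s'_def subgroup.m_inv_closed)
      have "inv s \<otimes> (t \<otimes> h \<otimes> g) = t \<otimes> (s' \<otimes> h) \<otimes> g" if h: "h \<in> M" for h
      proof -
        have "t \<otimes> (inv t \<otimes> y) = y" if "y \<in> carrier G" for y
          using tg that by (simp flip: m_assoc)
        then show ?thesis using tg Mc[OF s] Mc[OF h] by (simp add: s'_def m_assoc)
      qed
      then have "W t g (ltrans s k) = (\<lambda>h. if h \<in> M then W t g k (s' \<otimes> h) else 0)"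
        using tg Mc s' sub by (auto simp: W_def ltrans_def subgroup.m_closed fun_eq_iff)
      then have eq: "\<mu> (W t g (ltrans s k)) = \<mu> (W t g k)" using inva[OF W[OF k tg] s'] by simp
      have "W t g (\<lambda>g. ltrans s k g - k g) = (\<lambda>h. 1 * W t g (ltrans s k) h + (-1) * W t g k h)"
        by (auto simp: W_def)
      then have "\<mu> (W t g (\<lambda>g. ltrans s k g - k g)) = 0"
        using lin[OF W[OF ltrans_closed[OF Mc[OF s] k] tg] W[OF k tg], of 1 "-1"] eq by simp
      then show "\<mu> (W t g (\<lambda>g. ltrans s (poisson x f) g - poisson x f g)) \<le> 0" by (simp add: k_def)
    qed
    finally show ?thesis
      using linear_func_diff[OF lin_space_linf _ sf f, of x] x by (simp add: dominated_def)
  qed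
  have "x (ltrans s f) = x f" if x: "dominated x" and f: "f \<in> V" for x f
  proof -
    have "x (\<lambda>g. - ltrans s f g) \<le> x (\<lambda>g. - f g)"
      using le[OF x V_uminus[OF f]] ltrans_scale[of s "-1" f] by simp
    then have "- x (ltrans s f) \<le> - x f"
      using linear_func_uminus[of V x f] linear_func_uminus[of V x "ltrans s f"] x f
        ltrans_closed[OF Mc[OF s] f] by (simp add: dominated_def)
    then show ?thesis using le[OF x f] by simp
  qed
  then show "s \<in> kern" using Mc[OF s] by (simp add: kern_def)
qed

lemma amenable_radical_eq_kern: "amenable_radical G = kern"
  using amenable_normal_le_kern kern_normal kern_amenable by (auto simp: amenable_radical_def)

end

section \<open>Bounded operators on square-summable functions\<close>

context discrete_group
begin

abbreviation "C \<equiv> carrier G"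
abbreviation "l2n \<equiv> l2norm G"
abbreviation "ip \<equiv> l2inner G"

section \<open>The Hilbert space of square-summable functions\<close>

lemma l2_summable: "f \<in> l2 G \<Longrightarrow> (\<lambda>g. (cmod (f g))\<^sup>2) summable_on C"
  and l2_zero: "f \<in> l2 G \<Longrightarrow> g \<notin> C \<Longrightarrow> f g = 0"
  by (auto simp: l2_def)

lemma l2norm_nonneg [simp]: "0 \<le> l2n f"
  by (auto simp: l2norm_def intro: infsum_nonneg)

lemma l2norm_power2: "(l2n f)\<^sup>2 = (\<Sum>\<^sub>\<infinity>g\<in>C. (cmod (f g))\<^sup>2)"
  by (auto simp: l2norm_def intro: infsum_nonneg)

text \<open>The sum of squares is the supremum of its finite partial sums, so one uniform bound
  settles both membership and norm; infinite estimates below are reduced to \<open>L2_set\<close> in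
  this way.\<close>

lemma l2I:
  assumes "\<And>g. g \<notin> C \<Longrightarrow> f g = 0" and "0 \<le> B"
    and "\<And>F. finite F \<Longrightarrow> F \<subseteq> C \<Longrightarrow> L2_set (\<lambda>g. cmod (f g)) F \<le> B"
  shows "f \<in> l2 G" "l2n f \<le> B"
proof -
  have *: "(\<Sum>g\<in>F. (cmod (f g))\<^sup>2) \<le> B\<^sup>2" if "finite F" "F \<subseteq> C" for F
    using assms(3)[OF that] by (simp add: L2_set_def real_sqrt_le_iff' sum_nonneg \<open>0 \<le> B\<close> real_le_lsqrt sqrt_le_D)
  have s: "(\<lambda>g. (cmod (f g))\<^sup>2) summable_on C"
    using * by (intro nonneg_bdd_above_summable_on bdd_aboveI2[where M = "B\<^sup>2"]) auto
  then show "f \<in> l2 G" using assms(1) by (auto simp: l2_def)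
  have "(\<Sum>\<^sub>\<infinity>g\<in>C. (cmod (f g))\<^sup>2) \<le> B\<^sup>2" using * by (intro infsum_le_finite_sums s) auto
  then show "l2n f \<le> B" using \<open>0 \<le> B\<close> by (simp add: l2norm_def real_le_lsqrt infsum_nonneg)
qed

lemma l2_finite_le:
  assumes "f \<in> l2 G" "finite F" "F \<subseteq> C"
  shows "L2_set (\<lambda>g. cmod (f g)) F \<le> l2n f"
  unfolding L2_set_def l2norm_def
  using finite_sum_le_infsum[OF l2_summable[OF assms(1)] assms(2,3)] by simp

lemma l2_point_le: "f \<in> l2 G \<Longrightarrow> cmod (f g) \<le> l2n f"
  using l2_finite_le[of f "{g}"] l2_zero[of f g] by (cases "g \<in> C") (auto simp: L2_set_def)

lemma l2_add:
  assumes f: "f \<in> l2 G" and h: "h \<in> l2 G"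
  shows "(\<lambda>g. f g + h g) \<in> l2 G" "l2n (\<lambda>g. f g + h g) \<le> l2n f + l2n h"
proof -
  have "L2_set (\<lambda>g. cmod (f g + h g)) F \<le> l2n f + l2n h" if F: "finite F" "F \<subseteq> C" for F
  proof -
    have "L2_set (\<lambda>g. cmod (f g + h g)) F \<le> L2_set (\<lambda>g. cmod (f g) + cmod (h g)) F"
      by (intro L2_set_mono norm_triangle_ineq) auto
    also have "\<dots> \<le> L2_set (\<lambda>g. cmod (f g)) F + L2_set (\<lambda>g. cmod (h g)) F" by (rule L2_set_triangle_ineq)
    finally show ?thesis using l2_finite_le[OF f F] l2_finite_le[OF h F] by linarith
  qed
  then show "(\<lambda>g. f g + h g) \<in> l2 G" "l2n (\<lambda>g. f g + h g) \<le> l2n f + l2n h"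
    using l2I[of "\<lambda>g. f g + h g" "l2n f + l2n h"] l2_zero[OF f] l2_zero[OF h] by auto
qed

lemma l2_scale:
  assumes "f \<in> l2 G" shows "(\<lambda>g. c * f g) \<in> l2 G" "l2n (\<lambda>g. c * f g) = cmod c * l2n f"
proof -
  show "(\<lambda>g. c * f g) \<in> l2 G"
    using assms by (auto simp: l2_def norm_mult power_mult_distrib intro: summable_on_cmult_right)
  show "l2n (\<lambda>g. c * f g) = cmod c * l2n f"
    using assms by (simp add: l2norm_def norm_mult power_mult_distrib infsum_cmult_right' real_sqrt_mult)
qed

lemma l2_zero_mem [simp]: "(\<lambda>_. 0) \<in> l2 G" and l2norm_zero [simp]: "l2n (\<lambda>_. 0) = 0"
  by (auto simp: l2_def l2norm_def)

lemma l2_uminus: "f \<in> l2 G \<Longrightarrow> (\<lambda>g. - f g) \<in> l2 G" "f \<in> l2 G \<Longrightarrow> l2n (\<lambda>g. - f g) = l2n f"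
  using l2_scale[of f "-1"] by auto

lemma l2_diff:
  assumes "f \<in> l2 G" "h \<in> l2 G"
  shows "(\<lambda>g. f g - h g) \<in> l2 G" "l2n (\<lambda>g. f g - h g) \<le> l2n f + l2n h"
  using l2_add[OF assms(1) l2_uminus(1)[OF assms(2)]] l2_uminus(2)[OF assms(2)] by auto

lemma l2norm_eq_0: "f \<in> l2 G \<Longrightarrow> l2n f = 0 \<Longrightarrow> f = (\<lambda>_. 0)"
  using l2_point_le[of f] by (intro ext) simp

lemma ip_summable:
  assumes "f \<in> l2 G" "h \<in> l2 G"
  shows "(\<lambda>g. norm (f g * cnj (h g))) summable_on C"
proof (rule Infinite_Sum.abs_summable_on_comparison_test')
  show "(\<lambda>g. ((cmod (f g))\<^sup>2 + (cmod (h g))\<^sup>2) / 2) summable_on C"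
    unfolding divide_inverse
    by (intro summable_on_cmult_left summable_on_add l2_summable assms)
  show "norm (f g * cnj (h g)) \<le> ((cmod (f g))\<^sup>2 + (cmod (h g))\<^sup>2) / 2" for g
    using sum_squares_bound[of "cmod (f g)" "cmod (h g)"] by (simp add: norm_mult)
qed

lemma ip_summable': "f \<in> l2 G \<Longrightarrow> h \<in> l2 G \<Longrightarrow> (\<lambda>g. f g * cnj (h g)) summable_on C"
  using ip_summable by (rule abs_summable_summable)

lemma ip_cauchy:
  assumes "f \<in> l2 G" "h \<in> l2 G"
  shows "cmod (ip f h) \<le> l2n f * l2n h"
proof -
  have "cmod (ip f h) \<le> (\<Sum>\<^sub>\<infinity>g\<in>C. cmod (f g * cnj (h g)))"
    unfolding l2inner_def by (rule norm_infsum_bound[OF ip_summable[OF assms]])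
  also have "\<dots> \<le> l2n f * l2n h"
  proof (rule infsum_le_finite_sums[OF ip_summable[OF assms]])
    fix F assume F: "finite F" "F \<subseteq> C"
    have "(\<Sum>g\<in>F. cmod (f g * cnj (h g))) \<le> L2_set (\<lambda>g. cmod (f g)) F * L2_set (\<lambda>g. cmod (h g)) F"
      using L2_set_mult_ineq[of "\<lambda>g. cmod (f g)" "\<lambda>g. cmod (h g)" F] by (simp add: norm_mult)
    also have "\<dots> \<le> l2n f * l2n h"
      by (intro mult_mono l2_finite_le assms F L2_set_nonneg) auto
    finally show "(\<Sum>g\<in>F. cmod (f g * cnj (h g))) \<le> l2n f * l2n h" .
  qed
  finally show ?thesis .
qed

lemma ip_add_left: "f \<in> l2 G \<Longrightarrow> f' \<in> l2 G \<Longrightarrow> h \<in> l2 G \<Longrightarrow> ip (\<lambda>g. f g + f' g) h = ip f h + ip f' h"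
  and ip_add_right: "h \<in> l2 G \<Longrightarrow> f \<in> l2 G \<Longrightarrow> f' \<in> l2 G \<Longrightarrow> ip h (\<lambda>g. f g + f' g) = ip h f + ip h f'"
  by (simp_all add: l2inner_def distrib_left distrib_right infsum_add ip_summable')

lemma ip_scale_left: "f \<in> l2 G \<Longrightarrow> h \<in> l2 G \<Longrightarrow> ip (\<lambda>g. c * f g) h = c * ip f h"
  and ip_scale_right: "f \<in> l2 G \<Longrightarrow> h \<in> l2 G \<Longrightarrow> ip h (\<lambda>g. c * f g) = cnj c * ip h f"
  by (simp_all add: l2inner_def mult.assoc infsum_cmult_right' mult.left_commute[of _ "cnj c"])

lemma ip_diff_left: "f \<in> l2 G \<Longrightarrow> f' \<in> l2 G \<Longrightarrow> h \<in> l2 G \<Longrightarrow> ip (\<lambda>g. f g - f' g) h = ip f h - ip f' h"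
  using ip_add_left[of f "\<lambda>g. -1 * f' g" h] ip_scale_left[of f' h "-1"] l2_scale(1)[of f' "-1"] by simp

lemma ip_diff_right: "h \<in> l2 G \<Longrightarrow> f \<in> l2 G \<Longrightarrow> f' \<in> l2 G \<Longrightarrow> ip h (\<lambda>g. f g - f' g) = ip h f - ip h f'"
  using ip_add_right[of h f "\<lambda>g. -1 * f' g"] ip_scale_right[of f' h "-1"] l2_scale(1)[of f' "-1"] by simp

lemma ip_commute: "ip f h = cnj (ip h f)"
  unfolding l2inner_def infsum_cnj[symmetric] by (simp add: mult.commute)

lemma ip_self: assumes "f \<in> l2 G" shows "ip f f = of_real ((l2n f)\<^sup>2)"
proof -
  have "ip f f = (\<Sum>\<^sub>\<infinity>g\<in>C. of_real ((cmod (f g))\<^sup>2))"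
    unfolding l2inner_def by (simp add: complex_norm_square del: of_real_power)
  also have "\<dots> = of_real (\<Sum>\<^sub>\<infinity>g\<in>C. (cmod (f g))\<^sup>2)"
    by (rule infsumI[OF has_sum_of_real[OF has_sum_infsum[OF l2_summable[OF assms]]]])
  finally show ?thesis unfolding l2norm_power2 .
qed

definition \<delta> :: "'a \<Rightarrow> 'a \<Rightarrow> complex" where "\<delta> s = (\<lambda>g. if g = s then 1 else 0)"

lemma \<delta>_l2: assumes "s \<in> C" shows "\<delta> s \<in> l2 G"
proof (rule l2I)
  show "L2_set (\<lambda>g. cmod (\<delta> s g)) F \<le> 1" if "finite F" for F
  proof -
    have "(\<Sum>g\<in>F. (cmod (\<delta> s g))\<^sup>2) = (\<Sum>g\<in>F. if g = s then 1 else 0)"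
      by (intro sum.cong) (auto simp: \<delta>_def)
    then show ?thesis using that by (simp add: L2_set_def)
  qed
qed (use assms in \<open>auto simp: \<delta>_def\<close>)

lemma ip_\<delta>: assumes "s \<in> C" shows "ip f (\<delta> s) = f s"
proof -
  have "ip f (\<delta> s) = (\<Sum>\<^sub>\<infinity>g\<in>{s}. f g * cnj (\<delta> s g))"
    unfolding l2inner_def using assms by (intro infsum_cong_neutral) (auto simp: \<delta>_def)
  then show ?thesis by (simp add: \<delta>_def)
qed

text \<open>\<open>bd T K\<close> bounds the operator norm without mentioning the supremum in \<open>opnorm\<close>.\<close>
definition bd :: "'a op \<Rightarrow> real \<Rightarrow> bool" where
  "bd T K \<longleftrightarrow> (\<forall>f\<in>l2 G. l2n (T f) \<le> K * l2n f)"

text \<open>A relation in place of \<open>op_adj\<close>, whose definite description denotes an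
  adjoint only after one has been exhibited in \<open>Bop G\<close>; \<open>op_adj_eq\<close> makes
  the link.\<close>

definition adjoints :: "'a op \<Rightarrow> 'a op \<Rightarrow> bool" where
  "adjoints T S \<longleftrightarrow> (\<forall>f\<in>l2 G. \<forall>h\<in>l2 G. ip (T f) h = ip f (S h))"

lemma bdD: "bd T K \<Longrightarrow> f \<in> l2 G \<Longrightarrow> l2n (T f) \<le> K * l2n f"
  by (simp add: bd_def)

lemma adjointsD: "adjoints T S \<Longrightarrow> f \<in> l2 G \<Longrightarrow> h \<in> l2 G \<Longrightarrow> ip (T f) h = ip f (S h)"
  by (simp add: adjoints_def)

lemma bd_mono: "bd T K \<Longrightarrow> K \<le> K' \<Longrightarrow> bd T K'"
  unfolding bd_def by (metis (no_types) l2norm_nonneg mult_right_mono order_trans)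

lemma BopI:
  assumes "\<And>f. f \<in> l2 G \<Longrightarrow> T f \<in> l2 G"
    "\<And>f h a b. f \<in> l2 G \<Longrightarrow> h \<in> l2 G \<Longrightarrow> T (\<lambda>g. a * f g + b * h g) = (\<lambda>g. a * T f g + b * T h g)"
    "bd T K" "\<And>f. f \<notin> l2 G \<Longrightarrow> T f = (\<lambda>_. 0)"
  shows "T \<in> Bop G"
  using assms by (auto simp: Bop_def bd_def)

lemma Bop_l2: "T \<in> Bop G \<Longrightarrow> f \<in> l2 G \<Longrightarrow> T f \<in> l2 G"
  and Bop_lin: "T \<in> Bop G \<Longrightarrow> f \<in> l2 G \<Longrightarrow> h \<in> l2 G \<Longrightarrow> T (\<lambda>g. a * f g + b * h g) = (\<lambda>g. a * T f g + b * T h g)"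
  and Bop_out: "T \<in> Bop G \<Longrightarrow> f \<notin> l2 G \<Longrightarrow> T f = (\<lambda>_. 0)"
  by (auto simp: Bop_def)

lemma Bop_add: "T \<in> Bop G \<Longrightarrow> f \<in> l2 G \<Longrightarrow> h \<in> l2 G \<Longrightarrow> T (\<lambda>g. f g + h g) = (\<lambda>g. T f g + T h g)"
  and Bop_diff: "T \<in> Bop G \<Longrightarrow> f \<in> l2 G \<Longrightarrow> h \<in> l2 G \<Longrightarrow> T (\<lambda>g. f g - h g) = (\<lambda>g. T f g - T h g)"
  and Bop_scale: "T \<in> Bop G \<Longrightarrow> f \<in> l2 G \<Longrightarrow> T (\<lambda>g. a * f g) = (\<lambda>g. a * T f g)"
  using Bop_lin[of T f h 1 1] Bop_lin[of T f h 1 "-1"] Bop_lin[of T f f a 0] by auto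

lemma Bop_zero: "T \<in> Bop G \<Longrightarrow> T (\<lambda>_. 0) = (\<lambda>_. 0)"
  using Bop_scale[of T "\<lambda>_. 0" 0] by simp

lemma Bop_bd: assumes "T \<in> Bop G" obtains K where "bd T K" "0 < K"
proof -
  obtain K where "bd T K" using assms by (auto simp: Bop_def bd_def)
  then have "bd T (max K 1)" by (rule bd_mono) simp
  then show ?thesis using that by fastforce
qed

lemma Bop_ext:
  assumes "T \<in> Bop G" "S \<in> Bop G" "\<And>f. f \<in> l2 G \<Longrightarrow> T f = S f" shows "T = S"
proof
  fix f show "T f = S f"
    using assms(3)[of f] Bop_out[OF assms(1), of f] Bop_out[OF assms(2), of f] by (cases "f \<in> l2 G") simp_all
qed

lemma Bop_comp: assumes "T \<in> Bop G" "S \<in> Bop G" shows "T \<circ> S \<in> Bop G"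
proof -
  obtain K L where K: "bd T K" "0 < K" and L: "bd S L" using Bop_bd assms by metis
  have "bd (T \<circ> S) (K * L)"
    unfolding bd_def
  proof
    fix f assume f: "f \<in> l2 G"
    have "l2n (T (S f)) \<le> K * l2n (S f)" by (rule bdD[OF K(1) Bop_l2[OF assms(2) f]])
    also have "\<dots> \<le> K * (L * l2n f)" using bdD[OF L f] K(2) by simp
    finally show "l2n ((T \<circ> S) f) \<le> K * L * l2n f" by (simp add: mult.assoc)
  qed
  then show ?thesis
    using assms by (intro BopI[of _ "K * L"]) (simp_all add: Bop_l2 Bop_lin Bop_out Bop_zero)
qed

lemma bd_comp:
  assumes "bd T K" "bd S L" "S \<in> Bop G" "0 \<le> K" shows "bd (T \<circ> S) (K * L)"
  unfolding bd_def
proof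
  fix f assume f: "f \<in> l2 G"
  have "l2n (T (S f)) \<le> K * l2n (S f)" by (rule bdD[OF assms(1) Bop_l2[OF assms(3) f]])
  also have "\<dots> \<le> K * (L * l2n f)" using bdD[OF assms(2) f] assms(4) by (simp add: mult_left_mono)
  finally show "l2n ((T \<circ> S) f) \<le> K * L * l2n f" by (simp add: mult.assoc)
qed

lemma bd_add:
  assumes "T \<in> Bop G" "S \<in> Bop G" "bd T K" "bd S L" shows "bd (op_add T S) (K + L)"
  unfolding bd_def op_add_def
proof
  fix f assume f: "f \<in> l2 G"
  show "l2n (\<lambda>g. T f g + S f g) \<le> (K + L) * l2n f"
    using l2_add(2)[OF Bop_l2[OF assms(1) f] Bop_l2[OF assms(2) f]] bdD[OF assms(3) f] bdD[OF assms(4) f]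
    by (simp add: distrib_right)
qed

lemma bd_scale:
  assumes "T \<in> Bop G" "bd T K" shows "bd (op_scale c T) (cmod c * K)"
  unfolding bd_def op_scale_def
proof
  fix f assume f: "f \<in> l2 G"
  show "l2n (\<lambda>g. c * T f g) \<le> cmod c * K * l2n f"
    using l2_scale(2)[OF Bop_l2[OF assms(1) f]] bdD[OF assms(2) f] by (simp add: mult_left_mono mult.assoc)
qed

lemma bd_diff:
  assumes "T \<in> Bop G" "S \<in> Bop G" "bd T K" "bd S L" shows "bd (op_diff T S) (K + L)"
  unfolding bd_def op_diff_def
proof
  fix f assume f: "f \<in> l2 G"
  show "l2n (\<lambda>g. T f g - S f g) \<le> (K + L) * l2n f"
    using l2_diff(2)[OF Bop_l2[OF assms(1) f] Bop_l2[OF assms(2) f]] bdD[OF assms(3) f] bdD[OF assms(4) f]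
    by (simp add: distrib_right)
qed

lemma Bop_op_add: assumes "T \<in> Bop G" "S \<in> Bop G" shows "op_add T S \<in> Bop G"
proof -
  obtain K L where K: "bd T K" and L: "bd S L" using Bop_bd assms by metis
  from bd_add[OF assms K L] show ?thesis
    by (rule BopI[rotated 2])
      (use assms in \<open>simp_all add: op_add_def l2_add Bop_l2 Bop_lin Bop_out fun_eq_iff algebra_simps\<close>)
qed

lemma Bop_op_diff: assumes "T \<in> Bop G" "S \<in> Bop G" shows "op_diff T S \<in> Bop G"
proof -
  obtain K L where K: "bd T K" and L: "bd S L" using Bop_bd assms by metis
  from bd_diff[OF assms K L] show ?thesis
    by (rule BopI[rotated 2])
      (use assms in \<open>simp_all add: op_diff_def l2_diff Bop_l2 Bop_lin Bop_out fun_eq_iff algebra_simps\<close>)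
qed

lemma Bop_op_scale: assumes "T \<in> Bop G" shows "op_scale c T \<in> Bop G"
proof -
  obtain K where K: "bd T K" using Bop_bd assms by metis
  from bd_scale[OF assms K, of c] show ?thesis
    by (rule BopI[rotated 2])
      (use assms in \<open>simp_all add: op_scale_def l2_scale Bop_l2 Bop_lin Bop_out fun_eq_iff algebra_simps\<close>)
qed

lemma bd_triangle:
  assumes "T \<in> Bop G" "S \<in> Bop G" "R \<in> Bop G" "bd (op_diff T S) K" "bd (op_diff S R) L"
  shows "bd (op_diff T R) (K + L)"
proof -
  have "op_diff T R = op_add (op_diff T S) (op_diff S R)" by (auto simp: op_diff_def op_add_def)
  then show ?thesis using bd_add[OF _ _ assms(4,5)] assms(1-3) by (simp add: Bop_op_diff)
qed

lemma bd_diff_commute: "T \<in> Bop G \<Longrightarrow> S \<in> Bop G \<Longrightarrow> bd (op_diff T S) K \<Longrightarrow> bd (op_diff S T) K"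
  using bd_scale[of "op_diff T S" K "-1"] by (simp add: Bop_op_diff) (simp add: op_scale_def op_diff_def)

lemma opnorm_le:
  assumes "bd T K" "0 \<le> K" shows "opnorm G T \<le> K"
  unfolding opnorm_def
proof (rule cSup_least)
  show "{l2n (T f) |f. f \<in> l2 G \<and> l2n f \<le> 1} \<noteq> {}" using l2_zero_mem by fastforce
  fix y assume "y \<in> {l2n (T f) |f. f \<in> l2 G \<and> l2n f \<le> 1}"
  then obtain f where f: "y = l2n (T f)" "f \<in> l2 G" "l2n f \<le> 1" by auto
  have "y \<le> K * l2n f" using bdD[OF assms(1) f(2)] f(1) by simp
  also have "\<dots> \<le> K * 1" using f(3) assms(2) by (rule mult_left_mono)
  finally show "y \<le> K" by simp
qed

lemma bd_opnorm:
  assumes T: "T \<in> Bop G" shows "bd T (opnorm G T)"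
  unfolding bd_def
proof
  fix f assume f: "f \<in> l2 G"
  obtain K where K: "bd T K" "0 < K" using Bop_bd T by metis
  have bdd: "bdd_above {l2n (T f) |f. f \<in> l2 G \<and> l2n f \<le> 1}"
  proof (rule bdd_aboveI)
    fix y assume "y \<in> {l2n (T f) |f. f \<in> l2 G \<and> l2n f \<le> 1}"
    then obtain f where f: "y = l2n (T f)" "f \<in> l2 G" "l2n f \<le> 1" by auto
    have "y \<le> K * l2n f" using bdD[OF K(1) f(2)] f(1) by simp
    also have "\<dots> \<le> K * 1" using f(3) K(2) by simp
    finally show "y \<le> K" by simp
  qed
  show "l2n (T f) \<le> opnorm G T * l2n f"
  proof (cases "l2n f = 0")
    case True
    then show ?thesis using l2norm_eq_0[OF f] Bop_zero[OF T] by simp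
  next
    case False
    define c where "c = complex_of_real (inverse (l2n f))"
    have cn: "cmod c = inverse (l2n f)" by (simp add: c_def norm_inverse)
    have "l2n (T (\<lambda>g. c * f g)) \<le> opnorm G T"
      unfolding opnorm_def using l2_scale[OF f, of c] False cn by (intro cSup_upper bdd) auto
    then have "inverse (l2n f) * l2n (T f) \<le> opnorm G T"
      using Bop_scale[OF T f] l2_scale(2)[OF Bop_l2[OF T f]] cn by simp
    then show ?thesis using False l2norm_nonneg[of f] by (simp add: field_simps order_less_le)
  qed
qed

lemma adjoints_sym: "adjoints T S \<Longrightarrow> adjoints S T"
  unfolding adjoints_def by (metis ip_commute)

lemma adjoints_add: "T \<in> Bop G \<Longrightarrow> T' \<in> Bop G \<Longrightarrow> S \<in> Bop G \<Longrightarrow> S' \<in> Bop G \<Longrightarrow> adjoints T S \<Longrightarrow> adjoints T' S'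
    \<Longrightarrow> adjoints (op_add T T') (op_add S S')"
  by (auto simp: adjoints_def op_add_def ip_add_left ip_add_right Bop_l2)

lemma adjoints_diff: "T \<in> Bop G \<Longrightarrow> T' \<in> Bop G \<Longrightarrow> S \<in> Bop G \<Longrightarrow> S' \<in> Bop G \<Longrightarrow> adjoints T S \<Longrightarrow> adjoints T' S'
    \<Longrightarrow> adjoints (op_diff T T') (op_diff S S')"
  by (auto simp: adjoints_def op_diff_def ip_diff_left ip_diff_right Bop_l2)

lemma adjoints_scale: "T \<in> Bop G \<Longrightarrow> S \<in> Bop G \<Longrightarrow> adjoints T S \<Longrightarrow> adjoints (op_scale c T) (op_scale (cnj c) S)"
  by (auto simp: adjoints_def op_scale_def ip_scale_left ip_scale_right Bop_l2)

lemma adjoints_comp: "T \<in> Bop G \<Longrightarrow> T' \<in> Bop G \<Longrightarrow> S \<in> Bop G \<Longrightarrow> S' \<in> Bop G \<Longrightarrow> adjoints T S \<Longrightarrow> adjoints T' S'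
    \<Longrightarrow> adjoints (T \<circ> T') (S' \<circ> S)"
  by (auto simp: adjoints_def Bop_l2)

text \<open>The square of the norm of \<open>S h\<close> equals \<open>ip (T (S h)) h\<close>, at
  most \<open>K\<close> times the norms of \<open>S h\<close> and \<open>h\<close>; one factor
  cancels.\<close>

lemma adjoints_bd:
  assumes "adjoints T S" "T \<in> Bop G" "S \<in> Bop G" "bd T K" shows "bd S K"
  unfolding bd_def
proof
  fix h assume h: "h \<in> l2 G"
  have Sh: "S h \<in> l2 G" by (rule Bop_l2[OF assms(3) h])
  have "ip (T (S h)) h = of_real ((l2n (S h))\<^sup>2)" using adjointsD[OF assms(1) Sh h] ip_self[OF Sh] by simp
  then have "(l2n (S h))\<^sup>2 = cmod (ip (T (S h)) h)" by (simp add: norm_power)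
  also have "\<dots> \<le> l2n (T (S h)) * l2n h" by (rule ip_cauchy[OF Bop_l2[OF assms(2) Sh] h])
  also have "\<dots> \<le> K * l2n (S h) * l2n h" by (intro mult_right_mono bdD[OF assms(4) Sh]) simp
  finally have "l2n (S h) * l2n (S h) \<le> l2n (S h) * (K * l2n h)" by (simp add: power2_eq_square mult_ac)
  moreover have "0 \<le> K * l2n h" using bdD[OF assms(4) h] l2norm_nonneg order_trans by blast
  ultimately show "l2n (S h) \<le> K * l2n h"
    using l2norm_nonneg[of "S h"] by (cases "l2n (S h) = 0") (auto simp: order_less_le)
qed

lemma adjoints_unique:
  assumes "adjoints T S" "adjoints T S'" "S \<in> Bop G" "S' \<in> Bop G" shows "S = S'"
proof (rule Bop_ext[OF assms(3,4)])
  fix h assume h: "h \<in> l2 G"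
  show "S h = S' h"
  proof
    fix g show "S h g = S' h g"
    proof (cases "g \<in> C")
      case True
      have "ip (\<delta> g) (S h) = ip (\<delta> g) (S' h)"
        using adjointsD[OF assms(1) \<delta>_l2[OF True] h] adjointsD[OF assms(2) \<delta>_l2[OF True] h] by simp
      then show ?thesis using ip_\<delta>[OF True] ip_commute by (metis complex_cnj_cnj)
    qed (use l2_zero Bop_l2 h assms in metis)
  qed
qed

lemma op_adj_eq: "adjoints T S \<Longrightarrow> S \<in> Bop G \<Longrightarrow> op_adj G T = S"
  unfolding op_adj_def using adjoints_unique
  by (intro the_equality) (auto simp: adjoints_def)

text \<open>The limit is taken coordinatewise. On a finite set of coordinates the bound
  \<open>e n\<close> survives letting \<open>m\<close> tend to infinity, and \<open>l2I\<close> then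
  gives convergence in norm at the same rate.\<close>

lemma Bop_complete:
  assumes T: "\<And>n. T n \<in> Bop G" and e: "e \<longlonglongrightarrow> 0"
    and cau: "\<And>m n. n \<le> m \<Longrightarrow> bd (op_diff (T m) (T n)) (e n)"
  shows "\<exists>S\<in>Bop G. \<forall>n. bd (op_diff S (T n)) (e n)"
proof -
  define S where "S = (\<lambda>f g. lim (\<lambda>n. T n f g))"
  have dl: "op_diff (T m) (T n) f \<in> l2 G" if "f \<in> l2 G" for m n f
    using Bop_l2[OF Bop_op_diff[OF T T] that] .
  have lim: "(\<lambda>n. T n f g) \<longlonglongrightarrow> S f g" if f: "f \<in> l2 G" for f g
  proof -
    have "Cauchy (\<lambda>n. T n f g)"
    proof (rule metric_CauchyI)
      fix \<epsilon> :: real assume \<epsilon>: "\<epsilon> > 0"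
      have "(\<lambda>n. e n * l2n f) \<longlonglongrightarrow> 0 * l2n f" by (intro tendsto_intros e)
      then have "eventually (\<lambda>n. e n * l2n f < \<epsilon> / 2) sequentially" using \<epsilon> by (intro order_tendstoD(2)) auto
      then obtain N where N: "e N * l2n f < \<epsilon> / 2" by (auto simp: eventually_sequentially)
      have "dist (T m f g) (T N f g) < \<epsilon> / 2" if "m \<ge> N" for m
      proof -
        have "dist (T m f g) (T N f g) = cmod (op_diff (T m) (T N) f g)" by (simp add: dist_norm op_diff_def)
        also have "\<dots> \<le> l2n (op_diff (T m) (T N) f)" by (rule l2_point_le[OF dl[OF f]])
        also have "\<dots> \<le> e N * l2n f" by (rule bdD[OF cau[OF that] f])
        finally show ?thesis using N by simp
      qed
      then show "\<exists>M. \<forall>m\<ge>M. \<forall>n\<ge>M. dist (T m f g) (T n f g) < \<epsilon>" by (meson dist_triangle_half_l)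
    qed
    then show ?thesis unfolding S_def by (simp add: convergent_LIMSEQ_iff[symmetric] Cauchy_convergent)
  qed
  have diff: "(\<lambda>g. S f g - T n f g) \<in> l2 G" "l2n (\<lambda>g. S f g - T n f g) \<le> e n * l2n f" if f: "f \<in> l2 G" for f n
  proof -
    \<comment> \<open>The diagonal case of \<open>cau\<close> supplies the nonnegativity of the
      bound, which is not among the assumptions on \<open>e\<close>.\<close>
    have "l2n (op_diff (T n) (T n) f) \<le> e n * l2n f" by (rule bdD[OF cau[OF order_refl] f])
    then have pos: "0 \<le> e n * l2n f" using l2norm_nonneg order_trans by blast
    have zero: "S f g - T n f g = 0" if g: "g \<notin> C" for g
    proof -
      have "(\<lambda>n. T n f g) \<longlonglongrightarrow> 0" using l2_zero[OF Bop_l2[OF T f] g] by simp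
      then have "S f g = 0" using LIMSEQ_unique lim[OF f] by blast
      then show ?thesis using l2_zero[OF Bop_l2[OF T f] g] by simp
    qed
    have "L2_set (\<lambda>g. cmod (S f g - T n f g)) F \<le> e n * l2n f" if F: "finite F" "F \<subseteq> C" for F
    proof (rule LIMSEQ_le_const2)
      show "(\<lambda>m. L2_set (\<lambda>g. cmod (T m f g - T n f g)) F) \<longlonglongrightarrow> L2_set (\<lambda>g. cmod (S f g - T n f g)) F"
        unfolding L2_set_def by (intro tendsto_intros lim f)
      have "L2_set (\<lambda>g. cmod (T m f g - T n f g)) F \<le> e n * l2n f" if "n \<le> m" for m
        using order_trans[OF l2_finite_le[OF dl[OF f] F] bdD[OF cau[OF that] f]] by (simp add: op_diff_def)
      then show "\<exists>N. \<forall>m\<ge>N. L2_set (\<lambda>g. cmod (T m f g - T n f g)) F \<le> e n * l2n f" by blast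
    qed
    then show "(\<lambda>g. S f g - T n f g) \<in> l2 G" "l2n (\<lambda>g. S f g - T n f g) \<le> e n * l2n f"
      using l2I[OF zero pos] by auto
  qed
  have bdS: "bd (op_diff S (T n)) (e n)" for n using diff by (simp add: bd_def op_diff_def)
  have Sl2: "S f \<in> l2 G" if f: "f \<in> l2 G" for f
    using l2_add(1)[OF diff(1)[OF f, of 0] Bop_l2[OF T[of 0] f]] by simp
  obtain K where K: "bd (T 0) K" using Bop_bd T by metis
  have "bd S (e 0 + K)"
    unfolding bd_def
  proof
    fix f assume f: "f \<in> l2 G"
    have "l2n (S f) \<le> l2n (\<lambda>g. S f g - T 0 f g) + l2n (T 0 f)"
      using l2_add(2)[OF diff(1)[OF f, of 0] Bop_l2[OF T[of 0] f]] by simp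
    then show "l2n (S f) \<le> (e 0 + K) * l2n f"
      using diff(2)[OF f, of 0] bdD[OF K f] by (simp add: distrib_right)
  qed
  moreover have "S (\<lambda>g. a * f g + b * h g) = (\<lambda>g. a * S f g + b * S h g)" if fh: "f \<in> l2 G" "h \<in> l2 G" for f h a b
  proof
    fix g
    have "(\<lambda>n. T n (\<lambda>g. a * f g + b * h g) g) \<longlonglongrightarrow> S (\<lambda>g. a * f g + b * h g) g"
      by (intro lim l2_add l2_scale fh)
    moreover have "(\<lambda>n. T n (\<lambda>g. a * f g + b * h g) g) \<longlonglongrightarrow> a * S f g + b * S h g"
      unfolding Bop_lin[OF T fh] by (intro tendsto_intros lim fh)
    ultimately show "S (\<lambda>g. a * f g + b * h g) g = a * S f g + b * S h g" by (rule LIMSEQ_unique)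
  qed
  moreover have "S f = (\<lambda>_. 0)" if "f \<notin> l2 G" for f
    using Bop_out[OF T that] by (simp add: S_def)
  ultimately have "S \<in> Bop G" using Sl2 by (intro BopI)
  then show ?thesis using bdS by blast
qed

lemma adjoints_limit:
  assumes T: "\<And>n. T n \<in> Bop G" "T' \<in> Bop G" and S: "\<And>n. S n \<in> Bop G" "S' \<in> Bop G" and e: "e \<longlonglongrightarrow> 0"
    and bT: "\<And>n. bd (op_diff T' (T n)) (e n)" and bS: "\<And>n. bd (op_diff S' (S n)) (e n)"
    and adj: "\<And>n. adjoints (T n) (S n)"
  shows "adjoints T' S'"
  unfolding adjoints_def
proof (intro ballI)
  fix f h assume f: "f \<in> l2 G" and h: "h \<in> l2 G"
  have "cmod (ip (T' f) h - ip f (S' h)) \<le> 2 * e n * l2n f * l2n h" for n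
  proof -
    have l2: "op_diff T' (T n) f \<in> l2 G" "op_diff S' (S n) h \<in> l2 G"
      by (rule Bop_l2[OF Bop_op_diff[OF T(2,1)] f] Bop_l2[OF Bop_op_diff[OF S(2,1)] h])+
    have eq: "ip (T' f) h - ip f (S' h) = ip (op_diff T' (T n) f) h - ip f (op_diff S' (S n) h)"
      using ip_diff_left[OF Bop_l2[OF T(2) f] Bop_l2[OF T(1) f, of n] h]
        ip_diff_right[OF f Bop_l2[OF S(2) h] Bop_l2[OF S(1) h, of n]] adjointsD[OF adj f h, of n]
      by (simp add: op_diff_def)
    have "cmod (ip (T' f) h - ip f (S' h)) \<le> cmod (ip (op_diff T' (T n) f) h) + cmod (ip f (op_diff S' (S n) h))"
      unfolding eq by (rule norm_triangle_ineq4)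
    also have "\<dots> \<le> l2n (op_diff T' (T n) f) * l2n h + l2n f * l2n (op_diff S' (S n) h)"
      by (rule add_mono[OF ip_cauchy[OF l2(1) h] ip_cauchy[OF f l2(2)]])
    also have "\<dots> \<le> (e n * l2n f) * l2n h + l2n f * (e n * l2n h)"
      by (rule add_mono[OF mult_right_mono[OF bdD[OF bT f] l2norm_nonneg] mult_left_mono[OF bdD[OF bS h] l2norm_nonneg]])
    finally show ?thesis by (simp add: algebra_simps)
  qed
  moreover have "(\<lambda>n. 2 * e n * l2n f * l2n h) \<longlonglongrightarrow> 2 * 0 * l2n f * l2n h" by (intro tendsto_intros e)
  ultimately have "cmod (ip (T' f) h - ip f (S' h)) \<le> 0"
    by (intro LIMSEQ_le_const[of "\<lambda>n. 2 * e n * l2n f * l2n h"]) simp_all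
  then show "ip (T' f) h = ip f (S' h)" by simp
qed

end

section \<open>The reduced algebra\<close>

context discrete_group
begin

lemma Bop_eqI:
  assumes "T \<in> Bop G" "S \<in> Bop G" "e \<longlonglongrightarrow> 0" "\<And>n. bd (op_diff T S) (e n)"
  shows "T = S"
proof (rule Bop_ext[OF assms(1,2)])
  fix f assume f: "f \<in> l2 G"
  have "(\<lambda>n. e n * l2n f) \<longlonglongrightarrow> 0 * l2n f" by (intro tendsto_intros assms)
  then have "l2n (op_diff T S f) \<le> 0"
    using bdD[OF assms(4) f] by (intro LIMSEQ_le_const[of "\<lambda>n. e n * l2n f"]) simp_all
  then have "op_diff T S f = (\<lambda>_. 0)"
    using l2norm_eq_0[OF Bop_l2[OF Bop_op_diff[OF assms(1,2)] f]] l2norm_nonneg[of "op_diff T S f"] by linarith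
  then show "T f = S f" by (simp add: op_diff_def fun_eq_iff)
qed

text \<open>From \<open>XY - X'Y' = X(Y - Y') + (X - X')Y'\<close>.\<close>

lemma bd_comp_diff:
  assumes Bop: "X \<in> Bop G" "X' \<in> Bop G" "Y \<in> Bop G" "Y' \<in> Bop G"
    and bd: "bd X K" "bd (op_diff Y Y') d" "bd (op_diff X X') d'" "bd Y' L" "0 \<le> K" "0 \<le> d'"
  shows "bd (op_diff (X \<circ> Y) (X' \<circ> Y')) (K * d + d' * L)"
proof -
  have "bd (op_add (X \<circ> op_diff Y Y') (op_diff X X' \<circ> Y')) (K * d + d' * L)"
    using bd by (intro bd_add bd_comp Bop_comp Bop_op_diff Bop)
  moreover have "l2n (op_diff (X \<circ> Y) (X' \<circ> Y') f) = l2n (op_add (X \<circ> op_diff Y Y') (op_diff X X' \<circ> Y') f)"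
    if f: "f \<in> l2 G" for f
    using Bop_diff[OF Bop(1) Bop_l2[OF Bop(3) f] Bop_l2[OF Bop(4) f]]
    by (simp add: op_diff_def op_add_def)
  ultimately show ?thesis by (simp add: bd_def)
qed

section \<open>The left regular representation and its finite combinations\<close>

lemma lmult_bij: "s \<in> C \<Longrightarrow> bij_betw (\<lambda>g. inv s \<otimes> g) C C"
  by (rule bij_betw_byWitness[where f' = "\<lambda>g. s \<otimes> g"]) (auto simp: m_assoc[symmetric])

lemma lreg_l2:
  assumes s: "s \<in> C" and f: "f \<in> l2 G"
  shows "lreg G s f \<in> l2 G" "l2n (lreg G s f) = l2n f"
proof -
  have eq: "(cmod (lreg G s f g))\<^sup>2 = (cmod (f (inv s \<otimes> g)))\<^sup>2" if "g \<in> C" for g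
    using that f by (simp add: lreg_def)
  have "(\<lambda>g. (cmod (f (inv s \<otimes> g)))\<^sup>2) summable_on C"
    using summable_on_reindex_bij_betw[OF lmult_bij[OF s], of "\<lambda>g. (cmod (f g))\<^sup>2"] l2_summable[OF f] by simp
  then show "lreg G s f \<in> l2 G"
    using eq unfolding l2_def by (auto simp: lreg_def cong: summable_on_cong)
  have "(\<Sum>\<^sub>\<infinity>g\<in>C. (cmod (lreg G s f g))\<^sup>2) = (\<Sum>\<^sub>\<infinity>g\<in>C. (cmod (f (inv s \<otimes> g)))\<^sup>2)"
    by (rule infsum_cong) (rule eq)
  also have "\<dots> = (\<Sum>\<^sub>\<infinity>g\<in>C. (cmod (f g))\<^sup>2)"
    by (rule infsum_reindex_bij_betw[OF lmult_bij[OF s], of "\<lambda>g. (cmod (f g))\<^sup>2"])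
  finally show "l2n (lreg G s f) = l2n f" by (simp add: l2norm_def)
qed

lemma lreg_bd: "s \<in> C \<Longrightarrow> bd (lreg G s) 1"
  by (simp add: bd_def lreg_l2)

lemma lreg_Bop: assumes s: "s \<in> C" shows "lreg G s \<in> Bop G"
proof (rule BopI[OF _ _ lreg_bd[OF s]])
  fix f h a b assume fh: "f \<in> l2 G" "h \<in> l2 G"
  have "(\<lambda>g. a * f g + b * h g) \<in> l2 G" by (intro l2_add l2_scale fh)
  then show "lreg G s (\<lambda>g. a * f g + b * h g) = (\<lambda>g. a * lreg G s f g + b * lreg G s h g)"
    using fh by (auto simp: lreg_def)
next
  show "lreg G s f = (\<lambda>_. 0)" if "f \<notin> l2 G" for f using that by (simp add: lreg_def)
qed (rule lreg_l2[OF s])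

lemma lreg_mult: assumes "s \<in> C" "t \<in> C" shows "lreg G s \<circ> lreg G t = lreg G (s \<otimes> t)"
proof (rule Bop_ext[OF Bop_comp[OF lreg_Bop lreg_Bop] lreg_Bop])
  fix f assume "f \<in> l2 G"
  then show "(lreg G s \<circ> lreg G t) f = lreg G (s \<otimes> t) f"
    using assms lreg_l2(1)[of t f] by (auto simp: lreg_def inv_mult_group m_assoc fun_eq_iff)
qed (use assms in auto)

lemma lreg_one: "f \<in> l2 G \<Longrightarrow> lreg G \<one> f = f"
  using l2_zero[of f] by (auto simp: lreg_def fun_eq_iff)

lemma lreg_one_comp: "T \<in> Bop G \<Longrightarrow> lreg G \<one> \<circ> T = T" "T \<in> Bop G \<Longrightarrow> T \<circ> lreg G \<one> = T"
  by (rule Bop_ext; simp add: Bop_comp lreg_Bop lreg_one Bop_l2)+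

lemma lreg_adjoints: assumes s: "s \<in> C" shows "adjoints (lreg G s) (lreg G (inv s))"
  unfolding adjoints_def
proof (intro ballI)
  fix f h assume f: "f \<in> l2 G" and h: "h \<in> l2 G"
  have "ip (lreg G s f) h = (\<Sum>\<^sub>\<infinity>g\<in>C. f (inv s \<otimes> g) * cnj (h (s \<otimes> (inv s \<otimes> g))))"
    unfolding l2inner_def using f s by (intro infsum_cong) (simp add: lreg_def m_assoc[symmetric])
  also have "\<dots> = (\<Sum>\<^sub>\<infinity>g\<in>C. f g * cnj (h (s \<otimes> g)))"
    by (rule infsum_reindex_bij_betw[OF lmult_bij[OF s], of "\<lambda>g. f g * cnj (h (s \<otimes> g))"])
  also have "\<dots> = ip f (lreg G (inv s) h)"
    unfolding l2inner_def using h s by (intro infsum_cong) (simp add: lreg_def)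
  finally show "ip (lreg G s f) h = ip f (lreg G (inv s) h)" .
qed

text \<open>Unlike \<open>lreg_comb\<close>, the index set is explicit and may contain zero
  coefficients, which permits induction on \<open>S\<close> and padding to a common index
  set.\<close>

definition comb :: "'a set \<Rightarrow> ('a \<Rightarrow> complex) \<Rightarrow> 'a op" where
  "comb S c = (\<lambda>f g. \<Sum>s\<in>S. c s * lreg G s f g)"

lemma comb_empty: "comb {} c = op_scale 0 (lreg G \<one>)"
  by (simp add: comb_def op_scale_def)

lemma comb_insert: "finite S \<Longrightarrow> s \<notin> S \<Longrightarrow> comb (insert s S) c = op_add (op_scale (c s) (lreg G s)) (comb S c)"
  by (simp add: comb_def op_scale_def op_add_def)

lemma comb_Bop: "finite S \<Longrightarrow> S \<subseteq> C \<Longrightarrow> comb S c \<in> Bop G"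
  by (induction S rule: finite_induct) (simp_all add: comb_empty comb_insert Bop_op_add Bop_op_scale lreg_Bop)

lemma lreg_comb_eq:
  assumes "finite S" "S \<subseteq> C" "\<And>s. s \<in> C \<Longrightarrow> s \<notin> S \<Longrightarrow> c s = 0"
  shows "lreg_comb G c = comb S c"
  unfolding lreg_comb_def comb_def
  using assms by (intro ext sum.mono_neutral_left) auto

lemma comb_eq_lreg_comb:
  assumes "finite S" "S \<subseteq> C"
  shows "comb S c = lreg_comb G (\<lambda>s. if s \<in> S then c s else 0)"
  using lreg_comb_eq[OF assms, of "\<lambda>s. if s \<in> S then c s else 0"] by (simp add: comb_def)

lemma Cred_Bop: "T \<in> Cred G \<Longrightarrow> T \<in> Bop G"
  by (simp add: Cred_def)

lemma Cred_iff:
  "T \<in> Cred G \<longleftrightarrow> T \<in> Bop G \<and> (\<forall>\<epsilon>>0. \<exists>S c. finite S \<and> S \<subseteq> C \<and> bd (op_diff T (comb S c)) \<epsilon>)"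
proof (intro iffI conjI allI impI)
  fix \<epsilon> :: real assume T: "T \<in> Cred G" and \<epsilon>: "\<epsilon> > 0"
  then obtain c where c: "finite {s\<in>C. c s \<noteq> 0}" "opnorm G (op_diff T (lreg_comb G c)) < \<epsilon>"
    by (auto simp: Cred_def)
  have eq: "lreg_comb G c = comb {s\<in>C. c s \<noteq> 0} c" by (simp add: lreg_comb_def comb_def)
  have "op_diff T (lreg_comb G c) \<in> Bop G"
    unfolding eq using T c(1) by (intro Bop_op_diff comb_Bop) (auto simp: Cred_def)
  from bd_mono[OF bd_opnorm[OF this], of \<epsilon>] c
  show "\<exists>S c. finite S \<and> S \<subseteq> C \<and> bd (op_diff T (comb S c)) \<epsilon>"
    unfolding eq by (intro exI[of _ "{s\<in>C. c s \<noteq> 0}"] exI[of _ c]) auto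
next
  assume T: "T \<in> Bop G \<and> (\<forall>\<epsilon>>0. \<exists>S c. finite S \<and> S \<subseteq> C \<and> bd (op_diff T (comb S c)) \<epsilon>)"
  have "\<exists>c. finite {s\<in>C. c s \<noteq> 0} \<and> opnorm G (op_diff T (lreg_comb G c)) < \<epsilon>" if \<epsilon>: "\<epsilon> > 0" for \<epsilon>
  proof -
    \<comment> \<open>Half of \<epsilon>, because \<open>Cred\<close> asks for a strict inequality
      of norms whereas \<open>bd\<close> is not strict.\<close>
    obtain S c where S: "finite S" "S \<subseteq> C" "bd (op_diff T (comb S c)) (\<epsilon> / 2)" using T \<epsilon> half_gt_zero by blast
    define d where "d = (\<lambda>s. if s \<in> S then c s else 0)"
    have "{s\<in>C. d s \<noteq> 0} \<subseteq> S" by (auto simp: d_def)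
    then have "finite {s\<in>C. d s \<noteq> 0}" using S(1) finite_subset by blast
    moreover have "opnorm G (op_diff T (lreg_comb G d)) \<le> \<epsilon> / 2"
      using opnorm_le[OF S(3)] \<epsilon> comb_eq_lreg_comb[OF S(1,2), of c] by (simp add: d_def)
    ultimately show ?thesis using \<epsilon> by (intro exI[of _ d]) auto
  qed
  then show "T \<in> Cred G" using T by (auto simp: Cred_def)
qed (auto simp: Cred_def)

lemma Cred_closed:
  assumes T: "T \<in> Bop G" and "\<And>\<epsilon>. \<epsilon> > 0 \<Longrightarrow> \<exists>S\<in>Cred G. bd (op_diff T S) \<epsilon>"
  shows "T \<in> Cred G"
  unfolding Cred_iff
proof (intro conjI T allI impI)
  fix \<epsilon> :: real assume "\<epsilon> > 0"
  then obtain R where R: "R \<in> Cred G" "bd (op_diff T R) (\<epsilon> / 2)" using assms(2)[of "\<epsilon> / 2"] by auto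
  obtain S c where S: "finite S" "S \<subseteq> C" "bd (op_diff R (comb S c)) (\<epsilon> / 2)"
    using R(1) \<open>\<epsilon> > 0\<close> half_gt_zero unfolding Cred_iff by blast
  have "bd (op_diff T (comb S c)) (\<epsilon> / 2 + \<epsilon> / 2)"
    by (rule bd_triangle[OF T Cred_Bop[OF R(1)] comb_Bop[OF S(1,2)] R(2) S(3)])
  then show "\<exists>S c. finite S \<and> S \<subseteq> C \<and> bd (op_diff T (comb S c)) \<epsilon>" using S by auto
qed

lemma bd_zero: "T \<in> Bop G \<Longrightarrow> 0 \<le> \<epsilon> \<Longrightarrow> bd (op_diff T T) \<epsilon>"
  by (simp add: bd_def op_diff_def)

lemma comb_Cred: "finite S \<Longrightarrow> S \<subseteq> C \<Longrightarrow> comb S c \<in> Cred G"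
  unfolding Cred_iff by (intro conjI allI impI exI[of _ S] exI[of _ c] bd_zero comb_Bop) auto

lemma lreg_Cred: assumes "s \<in> C" shows "lreg G s \<in> Cred G"
proof -
  have "comb {s} (\<lambda>_. 1) = lreg G s" by (simp add: comb_def)
  then show ?thesis using comb_Cred[of "{s}" "\<lambda>_. 1"] assms by simp
qed

lemma Cred_op_scale: assumes T: "T \<in> Cred G" shows "op_scale a T \<in> Cred G"
  unfolding Cred_iff
proof (intro conjI allI impI)
  show "op_scale a T \<in> Bop G" using T Cred_Bop Bop_op_scale by blast
  fix \<epsilon> :: real assume \<epsilon>: "\<epsilon> > 0"
  \<comment> \<open>The summand 1 keeps the denominator positive when \<open>a = 0\<close>.\<close>
  define \<epsilon>' where "\<epsilon>' = \<epsilon> / (cmod a + 1)"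
  have e': "\<epsilon>' > 0" "cmod a * \<epsilon>' \<le> \<epsilon>" using \<epsilon> by (auto simp: \<epsilon>'_def field_simps add_pos_nonneg)
  then obtain S c where S: "finite S" "S \<subseteq> C" "bd (op_diff T (comb S c)) \<epsilon>'"
    using T unfolding Cred_iff by blast
  have "bd (op_scale a (op_diff T (comb S c))) (cmod a * \<epsilon>')"
    by (rule bd_scale[OF Bop_op_diff[OF Cred_Bop[OF T] comb_Bop[OF S(1,2)]] S(3)])
  moreover have "op_scale a (op_diff T (comb S c)) = op_diff (op_scale a T) (comb S (\<lambda>s. a * c s))"
    by (simp add: op_scale_def op_diff_def comb_def sum_distrib_left algebra_simps)
  ultimately show "\<exists>S c. finite S \<and> S \<subseteq> C \<and> bd (op_diff (op_scale a T) (comb S c)) \<epsilon>"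
    using S e'(2) bd_mono by fastforce
qed

lemma comb_mono:
  assumes "finite S'" "S \<subseteq> S'" shows "comb S c = comb S' (\<lambda>s. if s \<in> S then c s else 0)"
proof (intro ext)
  fix f g
  show "comb S c f g = comb S' (\<lambda>s. if s \<in> S then c s else 0) f g"
    unfolding comb_def using assms by (intro sum.mono_neutral_cong_left) auto
qed

lemma Cred_op_add: assumes T: "T \<in> Cred G" and R: "R \<in> Cred G" shows "op_add T R \<in> Cred G"
  unfolding Cred_iff
proof (intro conjI allI impI)
  show "op_add T R \<in> Bop G" using T R Cred_Bop Bop_op_add by blast
  fix \<epsilon> :: real assume \<epsilon>: "\<epsilon> > 0"
  obtain S c where S: "finite S" "S \<subseteq> C" "bd (op_diff T (comb S c)) (\<epsilon> / 2)"
    using T \<epsilon> half_gt_zero unfolding Cred_iff by blast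
  obtain S' c' where S': "finite S'" "S' \<subseteq> C" "bd (op_diff R (comb S' c')) (\<epsilon> / 2)"
    using R \<epsilon> half_gt_zero unfolding Cred_iff by blast
  define d where "d = (\<lambda>s. (if s \<in> S then c s else 0) + (if s \<in> S' then c' s else 0))"
  have "bd (op_add (op_diff T (comb S c)) (op_diff R (comb S' c'))) (\<epsilon> / 2 + \<epsilon> / 2)"
    using S S' T R by (intro bd_add Bop_op_diff comb_Bop Cred_Bop)
  moreover have "comb (S \<union> S') d = op_add (comb S c) (comb S' c')"
    unfolding comb_mono[of "S \<union> S'" S c, OF finite_UnI[OF S(1) S'(1)] Un_upper1]
      comb_mono[of "S \<union> S'" S' c', OF finite_UnI[OF S(1) S'(1)] Un_upper2]
    by (simp add: comb_def op_add_def d_def sum.distrib distrib_right)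
  then have "op_add (op_diff T (comb S c)) (op_diff R (comb S' c')) = op_diff (op_add T R) (comb (S \<union> S') d)"
    by (simp add: op_add_def op_diff_def fun_eq_iff)
  ultimately show "\<exists>S c. finite S \<and> S \<subseteq> C \<and> bd (op_diff (op_add T R) (comb S c)) \<epsilon>"
    using S(1,2) S'(1,2) by (intro exI[of _ "S \<union> S'"] exI[of _ d]) simp
qed

lemma op_diff_eq: "op_diff T R = op_add T (op_scale (-1) R)"
  by (simp add: op_diff_def op_add_def op_scale_def)

lemma Cred_op_diff: "T \<in> Cred G \<Longrightarrow> R \<in> Cred G \<Longrightarrow> op_diff T R \<in> Cred G"
  by (simp add: op_diff_eq Cred_op_add Cred_op_scale)

lemma Cred_approx:
  assumes "T \<in> Cred G"
  obtains S c where "\<And>n. finite (S n)" "\<And>n. S n \<subseteq> C" "\<And>n. bd (op_diff T (comb (S n) (c n))) (1 / real (Suc n))"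
proof -
  have "\<exists>S c. finite S \<and> S \<subseteq> C \<and> bd (op_diff T (comb S c)) (1 / real (Suc n))" for n
    using assms unfolding Cred_iff by simp
  then show ?thesis using that by metis
qed

text \<open>Products of group elements stay in the group; this is extended in turn to finite sums on
  the right, limits on the right, finite sums on the left and limits on the left, using that
  composition is continuous in each factor.\<close>

lemma Cred_comp: assumes X: "X \<in> Cred G" and Y: "Y \<in> Cred G" shows "X \<circ> Y \<in> Cred G"
proof -
  have 1: "lreg G s \<circ> comb S c \<in> Cred G" if s: "s \<in> C" and S: "finite S" "S \<subseteq> C" for s S c
    using S
  proof (induction S rule: finite_induct)
    case empty
    have "lreg G s \<circ> comb {} c = op_scale 0 (lreg G \<one>)"
      using Bop_zero[OF lreg_Bop[OF s]] by (intro ext) (simp add: comb_empty op_scale_def)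
    then show ?case by (simp add: Cred_op_scale lreg_Cred)
  next
    case (insert t S)
    have IH: "lreg G s \<circ> comb S c \<in> Cred G" and tC: "t \<in> C" using insert.IH insert.prems by blast+
    have eq: "lreg G s \<circ> comb (insert t S) c = op_add (op_scale (c t) (lreg G s \<circ> lreg G t)) (lreg G s \<circ> comb S c)"
    proof (rule Bop_ext)
      fix f assume f: "f \<in> l2 G"
      have "lreg G t f \<in> l2 G" "comb S c f \<in> l2 G"
        using f insert.hyps(1) insert.prems by (simp_all add: Bop_l2 lreg_Bop comb_Bop)
      then show "(lreg G s \<circ> comb (insert t S) c) f = op_add (op_scale (c t) (lreg G s \<circ> lreg G t)) (lreg G s \<circ> comb S c) f"
        using insert.hyps Bop_lin[OF lreg_Bop[OF s], of "lreg G t f" "comb S c f" "c t" 1]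
        by (simp add: comb_insert op_add_def op_scale_def)
    qed (use insert.hyps(1) insert.prems s in
        \<open>simp_all add: Bop_comp Bop_op_add Bop_op_scale lreg_Bop comb_Bop\<close>)
    show ?case
      unfolding eq lreg_mult[OF s tC] by (intro Cred_op_add Cred_op_scale lreg_Cred IH m_closed s tC)
  qed
  have 2: "lreg G s \<circ> Y \<in> Cred G" if s: "s \<in> C" for s
  proof (rule Cred_closed)
    show "lreg G s \<circ> Y \<in> Bop G" using s Y by (intro Bop_comp lreg_Bop Cred_Bop)
    fix \<epsilon> :: real assume "\<epsilon> > 0"
    then obtain S c where S: "finite S" "S \<subseteq> C" "bd (op_diff Y (comb S c)) \<epsilon>" using Y unfolding Cred_iff by blast
    obtain L where L: "bd (comb S c) L" using Bop_bd comb_Bop[OF S(1,2)] by metis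
    have "bd (op_diff (lreg G s \<circ> Y) (lreg G s \<circ> comb S c)) (1 * \<epsilon> + 0 * L)"
      by (rule bd_comp_diff[OF lreg_Bop[OF s] lreg_Bop[OF s] Cred_Bop[OF Y] comb_Bop[OF S(1,2)] lreg_bd[OF s] S(3)
            bd_zero[OF lreg_Bop[OF s]] L]) auto
    then show "\<exists>R\<in>Cred G. bd (op_diff (lreg G s \<circ> Y) R) \<epsilon>" using 1[OF s S(1,2), of c] by auto
  qed
  have 3: "comb S c \<circ> Y \<in> Cred G" if S: "finite S" "S \<subseteq> C" for S c
    using S
  proof (induction S rule: finite_induct)
    case empty
    have "comb {} c \<circ> Y = op_scale 0 (lreg G \<one>)" by (intro ext) (simp add: comb_empty op_scale_def)
    then show ?case by (simp add: Cred_op_scale lreg_Cred)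
  next
    case (insert t S)
    have IH: "comb S c \<circ> Y \<in> Cred G" and tC: "t \<in> C" using insert.IH insert.prems by blast+
    have eq: "comb (insert t S) c \<circ> Y = op_add (op_scale (c t) (lreg G t \<circ> Y)) (comb S c \<circ> Y)"
      using insert.hyps by (intro ext) (simp add: comb_insert op_add_def op_scale_def)
    show ?case unfolding eq by (intro Cred_op_add Cred_op_scale 2 tC IH)
  qed
  show ?thesis
  proof (rule Cred_closed)
    show "X \<circ> Y \<in> Bop G" using X Y by (intro Bop_comp Cred_Bop)
    fix \<epsilon> :: real assume \<epsilon>: "\<epsilon> > 0"
    obtain L where L: "bd Y L" "0 < L" using Bop_bd Cred_Bop[OF Y] by metis
    have "\<epsilon> / L > 0" using \<epsilon> L by simp
    then obtain S c where S: "finite S" "S \<subseteq> C" "bd (op_diff X (comb S c)) (\<epsilon> / L)" using X unfolding Cred_iff by blast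
    obtain K where K: "bd X K" "0 < K" using Bop_bd Cred_Bop[OF X] by metis
    have "bd (op_diff (X \<circ> Y) (comb S c \<circ> Y)) (K * 0 + (\<epsilon> / L) * L)"
      using \<epsilon> L K by (intro bd_comp_diff Cred_Bop X Y comb_Bop S bd_zero) auto
    then show "\<exists>R\<in>Cred G. bd (op_diff (X \<circ> Y) R) \<epsilon>" using 3[OF S(1,2), of c] L by auto
  qed
qed

text \<open>Finite combinations have explicit adjoints, and \<open>adjoints_bd\<close> carries norm
  bounds over to them. The adjoints of an approximating sequence thus converge inside the reduced
  algebra, and the limit is the adjoint sought.\<close>

lemma Cred_adjoint: assumes X: "X \<in> Cred G" shows "\<exists>Y\<in>Cred G. adjoints X Y"
proof -
  have 1: "\<exists>Y\<in>Cred G. adjoints (comb S c) Y" if "finite S" "S \<subseteq> C" for S c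
    using that
  proof (induction S rule: finite_induct)
    case empty
    have "adjoints (lreg G \<one>) (lreg G \<one>)" using lreg_adjoints[of \<one>] by simp
    from adjoints_scale[OF lreg_Bop lreg_Bop this, of 0] have "adjoints (comb {} c) (op_scale 0 (lreg G \<one>))"
      by (simp add: comb_empty)
    then show ?case using Cred_op_scale[OF lreg_Cred] by blast
  next
    case (insert s S)
    then obtain Y where Y: "Y \<in> Cred G" "adjoints (comb S c) Y" by auto
    have s: "s \<in> C" using insert by auto
    have "adjoints (comb (insert s S) c) (op_add (op_scale (cnj (c s)) (lreg G (inv s))) Y)"
      unfolding comb_insert[OF insert(1,2)]
      using s insert Y by (intro adjoints_add adjoints_scale lreg_adjoints Bop_op_scale lreg_Bop comb_Bop Cred_Bop) auto
    moreover have "op_add (op_scale (cnj (c s)) (lreg G (inv s))) Y \<in> Cred G"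
      using Y(1) s by (intro Cred_op_add Cred_op_scale lreg_Cred) auto
    ultimately show ?case by blast
  qed
  obtain S c where S: "\<And>n. finite (S n)" "\<And>n. S n \<subseteq> C" "\<And>n. bd (op_diff X (comb (S n) (c n))) (1 / real (Suc n))"
    using Cred_approx[OF X] by metis
  define T where "T = (\<lambda>n. comb (S n) (c n))"
  have T: "T n \<in> Bop G" for n unfolding T_def by (rule comb_Bop[OF S(1,2)])
  have "\<forall>n. \<exists>Y. Y \<in> Cred G \<and> adjoints (T n) Y" using 1[OF S(1,2)] unfolding T_def by blast
  then obtain Y where Y: "\<And>n. Y n \<in> Cred G" "\<And>n. adjoints (T n) (Y n)" by metis
  \<comment> \<open>The factor 2 pays for the errors of \<open>T m\<close> and \<open>T n\<close>,
    the former being the smaller when \<open>n \<le> m\<close>.\<close>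
  define e where "e = (\<lambda>n. 2 / real (Suc n))"
  have e: "e \<longlonglongrightarrow> 0"
    using tendsto_mult[OF tendsto_const[of "2::real"] LIMSEQ_inverse_real_of_nat] by (simp add: e_def divide_inverse)
  have bX: "bd (op_diff X (T n)) (1 / real (Suc n))" for n using S(3) by (simp add: T_def)
  have cau: "bd (op_diff (Y m) (Y n)) (e n)" if "n \<le> m" for m n
  proof -
    have "bd (op_diff (T m) (T n)) (1 / real (Suc m) + 1 / real (Suc n))"
      by (rule bd_triangle[OF T Cred_Bop[OF X] T bd_diff_commute[OF Cred_Bop[OF X] T bX] bX])
    moreover have "1 / real (Suc m) \<le> 1 / real (Suc n)" using that by (intro divide_left_mono) auto
    then have "1 / real (Suc m) + 1 / real (Suc n) \<le> e n" by (simp add: e_def)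
    ultimately have b: "bd (op_diff (T m) (T n)) (e n)" by (rule bd_mono)
    have "adjoints (op_diff (T m) (T n)) (op_diff (Y m) (Y n))"
      by (intro adjoints_diff T Cred_Bop Y)
    then show ?thesis
      by (rule adjoints_bd[OF _ Bop_op_diff[OF T T] Bop_op_diff[OF Cred_Bop[OF Y(1)] Cred_Bop[OF Y(1)]] b])
  qed
  obtain Z where Z: "Z \<in> Bop G" "\<And>n. bd (op_diff Z (Y n)) (e n)"
    using Bop_complete[OF Cred_Bop[OF Y(1)] e cau] by blast
  have "bd (op_diff X (T n)) (e n)" for n
    by (rule bd_mono[OF bX]) (simp add: e_def divide_right_mono)
  then have "adjoints X Z"
    by (rule adjoints_limit[OF T Cred_Bop[OF X] Cred_Bop[OF Y(1)] Z(1) e _ Z(2) Y(2)])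
  moreover have "Z \<in> Cred G"
  proof (rule Cred_closed[OF Z(1)])
    fix \<epsilon> :: real assume "\<epsilon> > 0"
    then obtain n where "e n < \<epsilon>" using order_tendstoD(2)[OF e, of \<epsilon>] by (auto simp: eventually_sequentially)
    then show "\<exists>R\<in>Cred G. bd (op_diff Z R) \<epsilon>" using bd_mono[OF Z(2)[of n], of \<epsilon>] Y(1)[of n] by auto
  qed
  ultimately show ?thesis by blast
qed

text \<open>Polarization, then the parallelogram law.\<close>
lemma numerical_radius_bd:
  assumes T: "T \<in> Bop G" "adjoints T T"
    and num: "\<And>f. f \<in> l2 G \<Longrightarrow> \<bar>Re (ip (T f) f)\<bar> \<le> \<rho> * (l2n f)\<^sup>2"
  shows "bd T \<rho>"
  unfolding bd_def
proof
  fix f assume f: "f \<in> l2 G"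
  have Tf: "T f \<in> l2 G" by (rule Bop_l2[OF T(1) f])
  have norm2: "(l2n k)\<^sup>2 = Re (ip k k)" if "k \<in> l2 G" for k using ip_self[OF that] by simp
  have polar: "4 * Re (ip (T f) h) \<le> 2 * \<rho> * ((l2n f)\<^sup>2 + (l2n h)\<^sup>2)" if h: "h \<in> l2 G" for h
  proof -
    have Th: "T h \<in> l2 G" by (rule Bop_l2[OF T(1) h])
    have sum: "(\<lambda>g. f g + h g) \<in> l2 G" and dif: "(\<lambda>g. f g - h g) \<in> l2 G" by (intro l2_add l2_diff f h)+
    have sym: "Re (ip (T h) f) = Re (ip (T f) h)"
      using adjointsD[OF T(2) h f] ip_commute[of h "T f"] by simp
    have exp: "ip (\<lambda>g. a g + b g) (\<lambda>g. f g + h g) = ip a f + ip a h + ip b f + ip b h"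
      "ip (\<lambda>g. a g - b g) (\<lambda>g. f g - h g) = ip a f - ip a h - ip b f + ip b h"
      if "a \<in> l2 G" "b \<in> l2 G" for a b
      using ip_add_left[OF that sum] ip_diff_left[OF that dif] ip_add_right[OF that(1) f h]
        ip_add_right[OF that(2) f h] ip_diff_right[OF that(1) f h] ip_diff_right[OF that(2) f h] by simp_all
    have "Re (ip (T (\<lambda>g. f g + h g)) (\<lambda>g. f g + h g)) - Re (ip (T (\<lambda>g. f g - h g)) (\<lambda>g. f g - h g)) = 4 * Re (ip (T f) h)"
      unfolding Bop_add[OF T(1) f h] Bop_diff[OF T(1) f h] exp[OF Tf Th] using sym by simp
    moreover have "(l2n (\<lambda>g. f g + h g))\<^sup>2 + (l2n (\<lambda>g. f g - h g))\<^sup>2 = 2 * ((l2n f)\<^sup>2 + (l2n h)\<^sup>2)"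
      unfolding norm2[OF f] norm2[OF h] norm2[OF sum] norm2[OF dif] exp[OF f h] by simp
    moreover have "Re (ip (T (\<lambda>g. f g + h g)) (\<lambda>g. f g + h g)) - Re (ip (T (\<lambda>g. f g - h g)) (\<lambda>g. f g - h g))
        \<le> \<rho> * ((l2n (\<lambda>g. f g + h g))\<^sup>2 + (l2n (\<lambda>g. f g - h g))\<^sup>2)"
      unfolding distrib_left using num[OF sum] num[OF dif] by linarith
    ultimately show ?thesis by (metis mult.assoc mult.left_commute)
  qed
  show "l2n (T f) \<le> \<rho> * l2n f"
  proof (cases "l2n (T f) = 0 \<or> l2n f = 0")
    case True
    have "0 \<le> \<rho> * l2n f" if "l2n f \<noteq> 0"
    proof -
      have "0 \<le> \<rho> * (l2n f)\<^sup>2" using num[OF f] by linarith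
      then show ?thesis using that l2norm_nonneg[of f] by (simp add: zero_le_mult_iff)
    qed
    moreover have "l2n (T f) = 0" if "l2n f = 0"
      using l2norm_eq_0[OF f that] Bop_zero[OF T(1)] by simp
    ultimately show ?thesis using True by (cases "l2n f = 0") auto
  next
    case False
    \<comment> \<open>The second vector is \<open>T f\<close> rescaled to the norm of
      \<open>f\<close>. The polarized inequality then reads \<open>4ab <= 4 \<rho> a^2\<close>,
      which is the claim after cancelling \<open>4a\<close>.\<close>
    define a b c where "a = l2n f" "b = l2n (T f)" "c = complex_of_real (a / b)"
    have ab: "a > 0" "b > 0" using False l2norm_nonneg[of f] l2norm_nonneg[of "T f"] by (auto simp: a_b_c_def order_less_le)
    have h: "(\<lambda>g. c * T f g) \<in> l2 G" "l2n (\<lambda>g. c * T f g) = a"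
      using l2_scale[OF Tf, of c] ab by (auto simp: a_b_c_def norm_divide norm_mult)
    have "ip (T f) (\<lambda>g. c * T f g) = of_real (a / b * b\<^sup>2)"
      using ip_scale_right[OF Tf Tf, of c] ip_self[OF Tf] by (simp add: a_b_c_def)
    then have "Re (ip (T f) (\<lambda>g. c * T f g)) = a * b" using ab by (simp add: power2_eq_square)
    then have "4 * (a * b) \<le> 2 * \<rho> * (a\<^sup>2 + a\<^sup>2)" using polar[OF h(1)] h(2) by (simp add: a_b_c_def)
    then have "a * b \<le> a * (\<rho> * a)" by (simp add: power2_eq_square algebra_simps)
    then show ?thesis using ab by (simp add: a_b_c_def)
  qed
qed

text \<open>The square root of \<open>1 - t\<close> is \<open>1 - w\<close>, where \<open>w\<close> is the fixed point
  of the contraction \<open>w \<mapsto> (t + w\<^sup>2) / 2\<close> on the ball of radius \<open>\<rho>\<close>.\<close>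
lemma sqrt_exists:
  assumes t: "t \<in> Cred G" "adjoints t t" "bd t \<rho>" and \<rho>: "0 \<le> \<rho>" "\<rho> < 1"
  shows "\<exists>y\<in>Cred G. adjoints y y \<and> y \<circ> y = op_diff (lreg G \<one>) t"
proof -
  define \<Phi> where "\<Phi> = (\<lambda>w. op_scale (1/2) (op_add t (w \<circ> w)))"
  define W where "W = (\<lambda>n. (\<Phi> ^^ n) (op_scale 0 (lreg G \<one>)))"
  have tB: "t \<in> Bop G" by (rule Cred_Bop[OF t(1)])
  have W0: "W 0 = op_scale 0 (lreg G \<one>)" and WS: "W (Suc n) = \<Phi> (W n)" for n by (simp_all add: W_def)
  have WC: "W n \<in> Cred G" for n
    by (induction n) (simp_all add: W0 WS \<Phi>_def Cred_op_scale lreg_Cred Cred_op_add Cred_comp t)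
  note WB = Cred_Bop[OF WC]
  have Wsa: "adjoints (W n) (W n)" for n
  proof (induction n)
    case 0
    show ?case using adjoints_scale[OF lreg_Bop lreg_Bop, of \<one> \<one> 0] lreg_adjoints[of \<one>] by (simp add: W0)
  next
    case (Suc n)
    have "adjoints (op_add t (W n \<circ> W n)) (op_add t (W n \<circ> W n))"
      by (intro adjoints_add adjoints_comp tB WB Bop_comp t Suc)
    from adjoints_scale[OF _ _ this, of "1/2"] show ?case
      by (simp add: WS \<Phi>_def Bop_op_add Bop_comp tB WB)
  qed
  have Wbd: "bd (W n) \<rho>" for n
  proof (induction n)
    case 0
    show ?case using bd_scale[OF lreg_Bop lreg_bd, of \<one> 0] bd_mono[of _ 0 \<rho>] \<rho> by (simp add: W0)
  next
    case (Suc n)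
    have "bd (\<Phi> (W n)) (cmod (1/2) * (\<rho> + \<rho> * \<rho>))"
      unfolding \<Phi>_def by (intro bd_scale bd_add bd_comp Bop_op_add Bop_comp tB WB t Suc \<rho>)
    moreover have "\<rho> * \<rho> \<le> \<rho>" using \<rho> by (simp add: mult_left_le)
    then have "cmod (1/2) * (\<rho> + \<rho> * \<rho>) \<le> \<rho>" by simp
    ultimately show ?case using bd_mono by (simp add: WS)
  qed
  have \<Phi>diff: "op_diff (\<Phi> x) (\<Phi> y) = op_scale (1/2) (op_diff (x \<circ> x) (y \<circ> y))" for x y
    by (simp add: \<Phi>_def op_diff_def op_add_def op_scale_def algebra_simps)
  \<comment> \<open>On the ball of radius \<rho> squaring has Lipschitz constant
    \<open>2 \<rho>\<close>; the factor 1/2 in \<Phi> turns this into the contraction ratio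
    \<rho>.\<close>
  have step: "bd (op_diff (W (Suc n)) (W n)) (\<rho> ^ Suc n)" for n
  proof (induction n)
    case 0
    have "op_diff (W (Suc 0)) (W 0) = W (Suc 0)" by (simp add: op_diff_def W0 op_scale_def)
    then show ?case using Wbd[of "Suc 0"] by simp
  next
    case (Suc n)
    have "bd (op_diff (W (Suc n) \<circ> W (Suc n)) (W n \<circ> W n)) (\<rho> * \<rho> ^ Suc n + \<rho> ^ Suc n * \<rho>)"
      using \<rho> by (intro bd_comp_diff WB Wbd Suc) auto
    from bd_scale[OF _ this, of "1/2"]
    have "bd (op_diff (\<Phi> (W (Suc n))) (\<Phi> (W n))) (cmod (1/2) * (\<rho> * \<rho> ^ Suc n + \<rho> ^ Suc n * \<rho>))"
      unfolding \<Phi>diff by (simp add: Bop_op_diff Bop_comp WB)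
    then show ?case by (simp add: WS mult_ac)
  qed
  \<comment> \<open>A bound for the tail of the geometric series of step lengths.\<close>
  define e where "e = (\<lambda>n. \<rho> ^ n / (1 - \<rho>))"
  have e0: "0 \<le> e n" for n using \<rho> by (simp add: e_def)
  have e: "e \<longlonglongrightarrow> 0"
    using tendsto_divide[OF LIMSEQ_realpow_zero[OF \<rho>] tendsto_const[of "1 - \<rho>"]] \<rho> by (simp add: e_def)
  have cau: "bd (op_diff (W m) (W n)) (e n)" if "n \<le> m" for m n
  proof -
    have "bd (op_diff (W (n + k)) (W n)) (\<rho> * (\<rho> ^ n - \<rho> ^ (n + k)) / (1 - \<rho>))" for k
    proof (induction k)
      case 0
      then show ?case using bd_zero[OF WB] by simp
    next
      case (Suc k)
      have "bd (op_diff (W (Suc (n + k))) (W n)) (\<rho> ^ Suc (n + k) + \<rho> * (\<rho> ^ n - \<rho> ^ (n + k)) / (1 - \<rho>))"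
        by (rule bd_triangle[OF WB WB WB step Suc])
      moreover have "\<rho> ^ Suc (n + k) + \<rho> * (\<rho> ^ n - \<rho> ^ (n + k)) / (1 - \<rho>) = \<rho> * (\<rho> ^ n - \<rho> ^ (n + Suc k)) / (1 - \<rho>)"
        using \<rho> by (simp add: field_simps)
      ultimately show ?case by simp
    qed
    from this[of "m - n"] have "bd (op_diff (W m) (W n)) (\<rho> * (\<rho> ^ n - \<rho> ^ m) / (1 - \<rho>))" using that by simp
    moreover have "\<rho> * (\<rho> ^ n - \<rho> ^ m) / (1 - \<rho>) \<le> e n"
    proof -
      have "\<rho> * (\<rho> ^ n - \<rho> ^ m) \<le> \<rho> * \<rho> ^ n" using \<rho> by (intro mult_left_mono) auto
      also have "\<dots> \<le> 1 * \<rho> ^ n" using \<rho> by (intro mult_right_mono) auto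
      finally show ?thesis using \<rho> by (simp add: e_def divide_right_mono)
    qed
    ultimately show ?thesis by (rule bd_mono)
  qed
  obtain w where w: "w \<in> Bop G" "\<And>n. bd (op_diff w (W n)) (e n)"
    using Bop_complete[OF WB e cau] by blast
  have wC: "w \<in> Cred G"
  proof (rule Cred_closed[OF w(1)])
    fix \<epsilon> :: real assume "\<epsilon> > 0"
    then obtain n where "e n < \<epsilon>" using order_tendstoD(2)[OF e, of \<epsilon>] by (auto simp: eventually_sequentially)
    then show "\<exists>R\<in>Cred G. bd (op_diff w R) \<epsilon>" using bd_mono[OF w(2)[of n], of \<epsilon>] WC[of n] by auto
  qed
  have wsa: "adjoints w w" by (rule adjoints_limit[OF WB w(1) WB w(1) e w(2) w(2) Wsa])
  obtain L where L: "bd w L" using Bop_bd w(1) by metis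
  have \<Phi>B: "x \<in> Bop G \<Longrightarrow> \<Phi> x \<in> Bop G" for x unfolding \<Phi>_def by (intro Bop_op_scale Bop_op_add Bop_comp tB)
  have fp: "w = \<Phi> w"
  proof (rule Bop_eqI[OF w(1) \<Phi>B[OF w(1)]])
    have "bd (op_diff w (\<Phi> w)) (e (Suc n) + cmod (1/2) * (\<rho> * e n + e n * L))" for n
    proof (rule bd_triangle[OF w(1) WB \<Phi>B[OF w(1)] w(2)])
      have "bd (op_diff (W n \<circ> W n) (w \<circ> w)) (\<rho> * e n + e n * L)"
        using \<rho> e0 by (intro bd_comp_diff WB Wbd w L bd_diff_commute) auto
      then show "bd (op_diff (W (Suc n)) (\<Phi> w)) (cmod (1/2) * (\<rho> * e n + e n * L))"
        unfolding WS \<Phi>diff by (intro bd_scale Bop_op_diff Bop_comp WB w)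
    qed
    then show "\<And>n. bd (op_diff w (\<Phi> w)) (e (Suc n) + cmod (1/2) * (\<rho> * e n + e n * L))" .
    have "(\<lambda>n. e (Suc n) + cmod (1/2) * (\<rho> * e n + e n * L)) \<longlonglongrightarrow> 0 + cmod (1/2) * (\<rho> * 0 + 0 * L)"
      by (intro tendsto_intros e LIMSEQ_Suc)
    then show "(\<lambda>n. e (Suc n) + cmod (1/2) * (\<rho> * e n + e n * L)) \<longlonglongrightarrow> 0" by simp
  qed
  define y where "y = op_diff (lreg G \<one>) w"
  have yB: "y \<in> Bop G" unfolding y_def by (intro Bop_op_diff lreg_Bop w) auto
  have "y \<circ> y = op_diff (lreg G \<one>) t"
  proof (rule Bop_ext)
    fix f assume f: "f \<in> l2 G"
    have wf: "w f \<in> l2 G" by (rule Bop_l2[OF w(1) f])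
    have 1: "w f g = \<Phi> w f g" for g using fp by (rule arg_cong)
    have 2: "\<Phi> w f g = (t f g + w (w f) g) / 2" for g by (simp add: \<Phi>_def op_scale_def op_add_def)
    \<comment> \<open>The fixed point equation gives \<open>w^2 = 2w - t\<close>, hence
      \<open>(1 - w)^2 = 1 - 2w + w^2 = 1 - t\<close>.\<close>
    have "w (w f) g = 2 * w f g - t f g" for g unfolding 1[of g] 2[of g] by (simp add: field_simps)
    then show "(y \<circ> y) f = op_diff (lreg G \<one>) t f"
      using Bop_diff[OF w(1) f wf] l2_diff(1)[OF f wf]
      by (simp add: y_def op_diff_def lreg_one[OF f] lreg_one[OF l2_diff(1)[OF f wf]])
  qed (intro Bop_comp yB Bop_op_diff lreg_Bop tB one_closed)+
  moreover have "y \<in> Cred G" unfolding y_def by (intro Cred_op_diff lreg_Cred wC) auto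
  moreover have "adjoints y y"
    unfolding y_def using lreg_adjoints[of \<one>] by (intro adjoints_diff lreg_Bop w wsa) auto
  ultimately show ?thesis by blast
qed

end

section \<open>Truncation to a subgroup\<close>

lemma infsum_finite_sum:
  fixes \<phi> :: "'i \<Rightarrow> 'a \<Rightarrow> real"
  assumes "finite I" "\<And>i. i \<in> I \<Longrightarrow> \<phi> i summable_on A"
  shows "(\<lambda>g. \<Sum>i\<in>I. \<phi> i g) summable_on A \<and> (\<Sum>\<^sub>\<infinity>g\<in>A. \<Sum>i\<in>I. \<phi> i g) = (\<Sum>i\<in>I. infsum (\<phi> i) A)"
  using assms by (induction I rule: finite_induct) (auto simp: infsum_add intro!: summable_on_add)

context discrete_group
begin

definition cut :: "'a set \<Rightarrow> ('a \<Rightarrow> complex) \<Rightarrow> 'a \<Rightarrow> complex" where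
  "cut D f = (\<lambda>g. if g \<in> D then f g else 0)"

lemma cut_l2: assumes f: "f \<in> l2 G" shows "cut D f \<in> l2 G"
proof (rule l2I[where B = "l2n f"])
  show "L2_set (\<lambda>g. cmod (cut D f g)) F \<le> l2n f" if F: "finite F" "F \<subseteq> C" for F
    using order_trans[OF L2_set_mono l2_finite_le[OF f F]] by (simp add: cut_def)
qed (auto simp: cut_def l2_zero[OF f])

text \<open>Bessel's inequality for the block decomposition: distinct right cosets are disjoint, so
  each coordinate of \<open>f\<close> is counted at most once.\<close>

lemma cut_cosets_norm:
  assumes H: "subgroup H G" and f: "f \<in> l2 G" and \<D>: "finite \<D>" "\<D> \<subseteq> rcosets H"
  shows "(\<Sum>D\<in>\<D>. (l2n (cut D f))\<^sup>2) \<le> (l2n f)\<^sup>2"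
proof -
  have sm: "(\<lambda>g. (cmod (cut D f g))\<^sup>2) summable_on C" for D by (rule l2_summable[OF cut_l2[OF f]])
  note sums = infsum_finite_sum[where \<phi> = "\<lambda>D g. (cmod (cut D f g))\<^sup>2", OF \<D>(1) sm]
  have "(\<Sum>D\<in>\<D>. (l2n (cut D f))\<^sup>2) = (\<Sum>\<^sub>\<infinity>g\<in>C. \<Sum>D\<in>\<D>. (cmod (cut D f g))\<^sup>2)"
    using sums by (simp add: l2norm_power2)
  also have "\<dots> \<le> (\<Sum>\<^sub>\<infinity>g\<in>C. (cmod (f g))\<^sup>2)"
  proof (rule infsum_mono)
    show "(\<lambda>g. \<Sum>D\<in>\<D>. (cmod (cut D f g))\<^sup>2) summable_on C" by (rule sums[THEN conjunct1])
    show "(\<lambda>g. (cmod (f g))\<^sup>2) summable_on C" by (rule l2_summable[OF f])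
    fix g assume g: "g \<in> C"
    have "D = H #> g" if "D \<in> \<D>" "g \<in> D" for D
      using that \<D>(2) repr_independence[OF _ _ H] by (auto simp: RCOSETS_def)
    then have "(\<Sum>D\<in>\<D>. (cmod (cut D f g))\<^sup>2) \<le> (\<Sum>D\<in>\<D>. if D = H #> g then (cmod (f g))\<^sup>2 else 0)"
      by (intro sum_mono) (auto simp: cut_def)
    also have "\<dots> \<le> (cmod (f g))\<^sup>2" using \<D>(1) by simp
    finally show "(\<Sum>D\<in>\<D>. (cmod (cut D f g))\<^sup>2) \<le> (cmod (f g))\<^sup>2" .
  qed
  finally show ?thesis by (simp add: l2norm_power2)
qed

text \<open>The left translations by \<open>H\<close> are the ones preserving the cosets \<open>H #> g\<close>,
  so truncating coefficients to \<open>H\<close> is the compression to the block diagonal.\<close>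
lemma comb_subgroup_cut:
  assumes H: "subgroup H G" and S: "finite S" "S \<subseteq> C" and f: "f \<in> l2 G" and g: "g \<in> C"
  shows "comb (S \<inter> H) c f g = comb S c (cut (H #> g) f) g"
proof -
  have mem: "inv s \<otimes> g \<in> H #> g \<longleftrightarrow> s \<in> H" if s: "s \<in> C" for s
  proof
    assume "inv s \<otimes> g \<in> H #> g"
    then obtain h where h: "h \<in> H" "inv s \<otimes> g = h \<otimes> g" by (auto simp: r_coset_def)
    then have "inv s = h" using s g subgroup.subset[OF H] by auto
    then show "s \<in> H" using h(1) s subgroup.m_inv_closed[OF H, of h] by auto
  next
    assume "s \<in> H"
    then show "inv s \<otimes> g \<in> H #> g" using subgroup.m_inv_closed[OF H] by (auto simp: r_coset_def)
  qed
  have "comb S c (cut (H #> g) f) g = (\<Sum>s\<in>S. if s \<in> H then c s * lreg G s f g else 0)"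
    unfolding comb_def using S(2) f g mem cut_l2[OF f]
    by (intro sum.cong) (auto simp: lreg_def cut_def subset_eq)
  also have "\<dots> = comb (S \<inter> H) c f g" unfolding comb_def using S(1) by (simp add: sum.inter_restrict)
  finally show ?thesis by simp
qed

text \<open>On a single coset the truncated operator agrees with the full one applied to the block
  of \<open>f\<close> on that coset. Summing the squared bounds over the cosets met by a finite set
  and applying Bessel's inequality loses nothing in the constant \<open>K\<close>.\<close>

lemma bd_comb_subgroup:
  assumes H: "subgroup H G" and S: "finite S" "S \<subseteq> C" and K: "bd (comb S c) K" "0 \<le> K"
  shows "bd (comb (S \<inter> H) c) K"
  unfolding bd_def
proof
  fix f assume f: "f \<in> l2 G"
  let ?R = "comb (S \<inter> H) c" and ?T = "comb S c"
  have T: "?T \<in> Bop G" by (rule comb_Bop[OF S])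
  have R: "?R \<in> Bop G" using S by (intro comb_Bop) auto
  show "l2n (?R f) \<le> K * l2n f"
  proof (rule l2I(2)[OF l2_zero[OF Bop_l2[OF R f]]])
    show "0 \<le> K * l2n f" using K(2) by simp
    fix F assume F: "finite F" "F \<subseteq> C"
    define \<D> where "\<D> = (\<lambda>g. H #> g) ` F"
    have \<D>: "finite \<D>" "\<D> \<subseteq> rcosets H" using F by (auto simp: \<D>_def RCOSETS_def)
    have "(\<Sum>g\<in>F. (cmod (?R f g))\<^sup>2) = (\<Sum>D\<in>\<D>. \<Sum>g\<in>{g\<in>F. H #> g = D}. (cmod (?R f g))\<^sup>2)"
      unfolding \<D>_def by (rule sum.image_gen[OF F(1)])
    also have "\<dots> \<le> (\<Sum>D\<in>\<D>. K\<^sup>2 * (l2n (cut D f))\<^sup>2)"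
    proof (rule sum_mono)
      fix D assume "D \<in> \<D>"
      define F' where "F' = {g\<in>F. H #> g = D}"
      have F': "finite F'" "F' \<subseteq> C" using F by (auto simp: F'_def)
      have "(\<Sum>g\<in>F'. (cmod (?R f g))\<^sup>2) = (\<Sum>g\<in>F'. (cmod (?T (cut D f) g))\<^sup>2)"
        using comb_subgroup_cut[OF H S f] F by (intro sum.cong) (auto simp: F'_def)
      also have "\<dots> = (L2_set (\<lambda>g. cmod (?T (cut D f) g)) F')\<^sup>2" by (simp add: L2_set_def sum_nonneg)
      also have "\<dots> \<le> (K * l2n (cut D f))\<^sup>2"
        by (intro power_mono order_trans[OF l2_finite_le[OF Bop_l2[OF T cut_l2[OF f]] F'] bdD[OF K(1) cut_l2[OF f]]] L2_set_nonneg)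
      finally show "(\<Sum>g\<in>{g\<in>F. H #> g = D}. (cmod (?R f g))\<^sup>2) \<le> K\<^sup>2 * (l2n (cut D f))\<^sup>2"
        by (simp add: F'_def power_mult_distrib)
    qed
    also have "\<dots> \<le> K\<^sup>2 * (l2n f)\<^sup>2"
      unfolding sum_distrib_left[symmetric] by (intro mult_left_mono cut_cosets_norm[OF H f \<D>]) simp
    also have "\<dots> = (K * l2n f)\<^sup>2" by (simp add: power_mult_distrib)
    finally show "L2_set (\<lambda>g. cmod (?R f g)) F \<le> K * l2n f"
      unfolding L2_set_def using K(2) by (intro real_le_lsqrt) auto
  qed
qed

text \<open>Padding to a common index set makes the difference a single combination, so truncation
  is contractive on differences and sends Cauchy sequences to Cauchy sequences.\<close>

lemma bd_comb_diff_subgroup: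
  assumes H: "subgroup H G" and S: "finite S" "S \<subseteq> C" "finite S'" "S' \<subseteq> C"
    and K: "bd (op_diff (comb S c) (comb S' c')) K" "0 \<le> K"
  shows "bd (op_diff (comb (S \<inter> H) c) (comb (S' \<inter> H) c')) K"
proof -
  define d where "d = (\<lambda>s. (if s \<in> S then c s else 0) - (if s \<in> S' then c' s else 0))"
  have fin: "finite (S \<union> S')" "finite ((S \<union> S') \<inter> H)" using S by auto
  have diff: "op_diff (comb U a) (comb U b) = comb U (\<lambda>s. a s - b s)" for U a b
    by (simp add: op_diff_def comb_def sum_subtractf left_diff_distrib)
  have "op_diff (comb S c) (comb S' c') = comb (S \<union> S') d"
    unfolding comb_mono[OF fin(1) Un_upper1] comb_mono[OF fin(1) Un_upper2] diff by (simp add: d_def)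
  then have "bd (comb ((S \<union> S') \<inter> H) d) K" using K S by (intro bd_comb_subgroup[OF H fin(1)]) auto
  moreover have "op_diff (comb (S \<inter> H) c) (comb (S' \<inter> H) c') = comb ((S \<union> S') \<inter> H) d"
  proof -
    have sub: "S \<inter> H \<subseteq> (S \<union> S') \<inter> H" "S' \<inter> H \<subseteq> (S \<union> S') \<inter> H" by auto
    have "comb U (\<lambda>s. (if s \<in> S \<inter> H then c s else 0) - (if s \<in> S' \<inter> H then c' s else 0)) = comb U d"
      if "U \<subseteq> H" for U
      unfolding comb_def using that by (intro ext sum.cong) (auto simp: d_def)
    then show ?thesis unfolding comb_mono[OF fin(2) sub(1)] comb_mono[OF fin(2) sub(2)] diff by simp
  qed
  ultimately show ?thesis by simp
qed

lemma fcoef_eq: "fcoef G x s = x (\<delta> \<one>) s"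
  by (simp add: fcoef_def \<delta>_def)

lemma comb_\<delta>:
  assumes "finite S" "S \<subseteq> C" "t \<in> C" "g \<in> C"
  shows "comb S c (\<delta> t) g = (if g \<otimes> inv t \<in> S then c (g \<otimes> inv t) else 0)"
proof -
  have "inv s \<otimes> g = t \<longleftrightarrow> s = g \<otimes> inv t" if "s \<in> S" for s
    using that assms(2-4) by (metis inv_closed inv_solve_left inv_solve_right subsetD)
  then have "comb S c (\<delta> t) g = (\<Sum>s\<in>S. if s = g \<otimes> inv t then c s else 0)"
    unfolding comb_def using assms \<delta>_l2[of t] by (intro sum.cong) (auto simp: lreg_def \<delta>_def)
  then show ?thesis using assms(1) by simp
qed

lemma bd_tendsto:
  assumes X: "X \<in> Bop G" and T: "\<And>n. T n \<in> Bop G" and e: "e \<longlonglongrightarrow> 0" and bd: "\<And>n. bd (op_diff X (T n)) (e n)"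
    and f: "f \<in> l2 G"
  shows "(\<lambda>n. T n f g) \<longlonglongrightarrow> X f g"
proof -
  have "(\<lambda>n. X f g - T n f g) \<longlonglongrightarrow> 0"
  proof (rule Lim_null_comparison)
    have "cmod (X f g - T n f g) \<le> e n * l2n f" for n
      using order_trans[OF l2_point_le[OF Bop_l2[OF Bop_op_diff[OF X T] f]] bdD[OF bd f]] by (simp add: op_diff_def)
    then show "\<forall>\<^sub>F n in sequentially. cmod (X f g - T n f g) \<le> e n * l2n f" by simp
    have "(\<lambda>n. e n * l2n f) \<longlonglongrightarrow> 0 * l2n f" by (intro tendsto_intros e)
    then show "(\<lambda>n. e n * l2n f) \<longlonglongrightarrow> 0" by simp
  qed
  from tendsto_diff[OF tendsto_const[of "X f g"] this] show ?thesis by simp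
qed

lemma inverse_Suc_tendsto: "(\<lambda>n. 1 / real (Suc n)) \<longlonglongrightarrow> 0"
  using LIMSEQ_inverse_real_of_nat by (simp add: inverse_eq_divide)

text \<open>The entry of a finite combination at \<open>(g, t)\<close> depends only on
  \<open>g \<otimes> inv t\<close>, a property inherited by norm limits. A difference
  \<open>d\<close> with vanishing coefficients therefore kills every point mass.\<close>

lemma Cred_fcoef_unique:
  assumes X: "X \<in> Cred G" and Y: "Y \<in> Cred G" and eq: "\<And>s. s \<in> C \<Longrightarrow> fcoef G X s = fcoef G Y s"
  shows "X = Y"
proof -
  define d where "d = op_diff X Y"
  have d: "d \<in> Cred G" unfolding d_def by (rule Cred_op_diff[OF X Y])
  note dB = Cred_Bop[OF d]
  obtain S c where S: "\<And>n. finite (S n)" "\<And>n. S n \<subseteq> C" "\<And>n. bd (op_diff d (comb (S n) (c n))) (1 / real (Suc n))"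
    using Cred_approx[OF d] by metis
  note lim = bd_tendsto[OF dB comb_Bop[OF S(1,2)] inverse_Suc_tendsto S(3)]
  have d\<delta>: "d (\<delta> t) g = 0" if t: "t \<in> C" for t g
  proof (cases "g \<in> C")
    case g: True
    have "(\<lambda>n. comb (S n) (c n) (\<delta> t) g) \<longlonglongrightarrow> d (\<delta> t) g" by (rule lim[OF \<delta>_l2[OF t]])
    moreover have "comb (S n) (c n) (\<delta> t) g = comb (S n) (c n) (\<delta> \<one>) (g \<otimes> inv t)" for n
      using comb_\<delta>[OF S(1,2) t g] comb_\<delta>[OF S(1,2) one_closed, of "g \<otimes> inv t"] t g by simp
    moreover have "(\<lambda>n. comb (S n) (c n) (\<delta> \<one>) (g \<otimes> inv t)) \<longlonglongrightarrow> d (\<delta> \<one>) (g \<otimes> inv t)"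
      by (rule lim[OF \<delta>_l2[OF one_closed]])
    moreover have "d (\<delta> \<one>) (g \<otimes> inv t) = 0" using eq[of "g \<otimes> inv t"] t g by (simp add: d_def op_diff_def fcoef_eq)
    ultimately show ?thesis using LIMSEQ_unique by simp
  qed (use l2_zero[OF Bop_l2[OF dB \<delta>_l2[OF t]]] in blast)
  \<comment> \<open>The adjoint stands in for density of finitely supported vectors: its matrix
    entries vanish as well, so \<open>Z\<close> kills point masses and
    \<open>d f g = ip f (Z (\<delta> g)) = 0\<close>.\<close>
  obtain Z where Z: "Z \<in> Cred G" "adjoints d Z" using Cred_adjoint[OF d] by blast
  have Zl: "Z (\<delta> g) \<in> l2 G" if "g \<in> C" for g by (rule Bop_l2[OF Cred_Bop[OF Z(1)] \<delta>_l2[OF that]])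
  have Z\<delta>: "Z (\<delta> g) = (\<lambda>_. 0)" if g: "g \<in> C" for g
  proof
    fix h show "Z (\<delta> g) h = 0"
    proof (cases "h \<in> C")
      case True
      have "Z (\<delta> g) h = ip (Z (\<delta> g)) (\<delta> h)" by (rule ip_\<delta>[OF True, symmetric])
      also have "\<dots> = ip (\<delta> g) (d (\<delta> h))" by (rule adjointsD[OF adjoints_sym[OF Z(2)] \<delta>_l2[OF g] \<delta>_l2[OF True]])
      also have "\<dots> = 0" by (simp add: l2inner_def d\<delta>[OF True])
      finally show ?thesis .
    qed (use l2_zero[OF Zl[OF g]] in blast)
  qed
  show ?thesis
  proof (rule Bop_ext[OF Cred_Bop[OF X] Cred_Bop[OF Y]])
    fix f assume f: "f \<in> l2 G"
    have "d f g = 0" for g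
    proof (cases "g \<in> C")
      case True
      have "d f g = ip (d f) (\<delta> g)" by (rule ip_\<delta>[OF True, symmetric])
      also have "\<dots> = ip f (Z (\<delta> g))" by (rule adjointsD[OF Z(2) f \<delta>_l2[OF True]])
      also have "\<dots> = 0" by (simp add: l2inner_def Z\<delta>[OF True])
      finally show ?thesis .
    qed (use l2_zero[OF Bop_l2[OF dB f]] in blast)
    then show "X f = Y f" by (simp add: d_def op_diff_def fun_eq_iff)
  qed
qed

text \<open>The expectation is the limit of the truncations of combinations approximating
  \<open>X\<close>; coefficient uniqueness identifies it with the definite description. The same
  sequence is returned for both approximations so that the traces can be compared term by
  term.\<close>

lemma cond_exp_approx:
  assumes H: "subgroup H G" and X: "X \<in> Cred G"
  obtains S c where "\<And>n. finite (S n)" "\<And>n. S n \<subseteq> C" "\<And>n. bd (op_diff X (comb (S n) (c n))) (1 / real (Suc n))"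
    "cond_exp G H X \<in> Cred G" "\<And>n. bd (op_diff (cond_exp G H X) (comb (S n \<inter> H) (c n))) (2 / real (Suc n))"
proof -
  obtain S c where S: "\<And>n. finite (S n)" "\<And>n. S n \<subseteq> C" "\<And>n. bd (op_diff X (comb (S n) (c n))) (1 / real (Suc n))"
    using Cred_approx[OF X] by metis
  note XB = Cred_Bop[OF X]
  define R where "R = (\<lambda>n. comb (S n \<inter> H) (c n))"
  have RC: "R n \<in> Cred G" for n unfolding R_def using S(1,2) by (intro comb_Cred) auto
  define e where "e = (\<lambda>n. 2 / real (Suc n))"
  have e: "e \<longlonglongrightarrow> 0"
    using tendsto_mult[OF tendsto_const[of "2::real"] inverse_Suc_tendsto] by (simp add: e_def)
  have cau: "bd (op_diff (R m) (R n)) (e n)" if "n \<le> m" for m n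
    unfolding R_def
  proof (rule bd_comb_diff_subgroup[OF H S(1,2) S(1,2)])
    have "bd (op_diff (comb (S m) (c m)) (comb (S n) (c n))) (1 / real (Suc m) + 1 / real (Suc n))"
      by (rule bd_triangle[OF comb_Bop[OF S(1,2)] XB comb_Bop[OF S(1,2)]
            bd_diff_commute[OF XB comb_Bop[OF S(1,2)] S(3)] S(3)])
    moreover have "1 / real (Suc m) \<le> 1 / real (Suc n)" using that by (intro divide_left_mono) auto
    then have "1 / real (Suc m) + 1 / real (Suc n) \<le> e n" by (simp add: e_def)
    ultimately show "bd (op_diff (comb (S m) (c m)) (comb (S n) (c n))) (e n)" by (rule bd_mono)
  qed (simp add: e_def)
  obtain Y where Y: "Y \<in> Bop G" "\<And>n. bd (op_diff Y (R n)) (e n)"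
    using Bop_complete[OF Cred_Bop[OF RC] e cau] by blast
  have YC: "Y \<in> Cred G"
  proof (rule Cred_closed[OF Y(1)])
    fix \<epsilon> :: real assume "\<epsilon> > 0"
    then obtain n where "e n < \<epsilon>" using order_tendstoD(2)[OF e, of \<epsilon>] by (auto simp: eventually_sequentially)
    then show "\<exists>R\<in>Cred G. bd (op_diff Y R) \<epsilon>" using bd_mono[OF Y(2)[of n], of \<epsilon>] RC[of n] by auto
  qed
  have coef: "fcoef G Y s = (if s \<in> H then fcoef G X s else 0)" for s
  proof (cases "s \<in> C")
    case s: True
    have "(\<lambda>n. R n (\<delta> \<one>) s) \<longlonglongrightarrow> Y (\<delta> \<one>) s"
      by (rule bd_tendsto[OF Y(1) Cred_Bop[OF RC] e Y(2) \<delta>_l2[OF one_closed]])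
    moreover have "R n (\<delta> \<one>) s = (if s \<in> H then comb (S n) (c n) (\<delta> \<one>) s else 0)" for n
    proof -
      have "finite (S n \<inter> H)" "S n \<inter> H \<subseteq> C" using S(1,2) by auto
      from comb_\<delta>[OF this one_closed s] comb_\<delta>[OF S(1,2) one_closed s] show ?thesis
        using s by (simp add: R_def)
    qed
    moreover have "(\<lambda>n. if s \<in> H then comb (S n) (c n) (\<delta> \<one>) s else 0) \<longlonglongrightarrow> (if s \<in> H then X (\<delta> \<one>) s else 0)"
      using bd_tendsto[OF XB comb_Bop[OF S(1,2)] inverse_Suc_tendsto S(3) \<delta>_l2[OF one_closed]] by simp
    ultimately have "Y (\<delta> \<one>) s = (if s \<in> H then X (\<delta> \<one>) s else 0)"
      by (simp only:) (rule LIMSEQ_unique)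
    then show ?thesis by (simp add: fcoef_eq)
  next
    case False
    then show ?thesis
      using l2_zero[OF Bop_l2[OF Y(1) \<delta>_l2[OF one_closed]]] l2_zero[OF Bop_l2[OF XB \<delta>_l2[OF one_closed]]]
      by (simp add: fcoef_eq)
  qed
  have "cond_exp G H X = Y"
    unfolding cond_exp_def
  proof (rule the_equality)
    show "Y \<in> Cred G \<and> (\<forall>s. fcoef G Y s = (if s \<in> H then fcoef G X s else 0))" using YC coef by blast
    fix y assume "y \<in> Cred G \<and> (\<forall>s. fcoef G y s = (if s \<in> H then fcoef G X s else 0))"
    then show "y = Y" using coef by (intro Cred_fcoef_unique YC) auto
  qed
  then show ?thesis using that[OF S] YC Y(2) by (simp add: R_def e_def)
qed

end

section \<open>Traces\<close>

locale traced = discrete_group +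
  fixes \<tau> :: "'a op \<Rightarrow> complex"
  assumes tracial: "tracial_state G \<tau>"
begin

lemma \<tau>_add: "x \<in> Cred G \<Longrightarrow> y \<in> Cred G \<Longrightarrow> \<tau> (op_add x y) = \<tau> x + \<tau> y"
  and \<tau>_scale: "x \<in> Cred G \<Longrightarrow> \<tau> (op_scale c x) = c * \<tau> x"
  and \<tau>_one: "\<tau> (lreg G \<one>) = 1"
  and \<tau>_commute: "x \<in> Cred G \<Longrightarrow> y \<in> Cred G \<Longrightarrow> \<tau> (x \<circ> y) = \<tau> (y \<circ> x)"
  using tracial unfolding tracial_state_def by blast+

lemma \<tau>_diff: "x \<in> Cred G \<Longrightarrow> y \<in> Cred G \<Longrightarrow> \<tau> (op_diff x y) = \<tau> x - \<tau> y"
  by (simp add: op_diff_eq \<tau>_add \<tau>_scale Cred_op_scale)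

lemma \<tau>_square:
  assumes "y \<in> Cred G" "adjoints y y" shows "Im (\<tau> (y \<circ> y)) = 0 \<and> 0 \<le> Re (\<tau> (y \<circ> y))"
  using tracial assms op_adj_eq[OF assms(2) Cred_Bop[OF assms(1)]] unfolding tracial_state_def by metis

text \<open>The unit of the algebra is \<open>lreg G \<one>\<close> and not \<open>id\<close>,
  because operators are required to vanish on functions outside \<open>l2 G\<close>.\<close>

lemma J_Cred: "lreg G \<one> \<in> Cred G" and J_Bop: "lreg G \<one> \<in> Bop G" and J_adjoints: "adjoints (lreg G \<one>) (lreg G \<one>)"
  using lreg_Cred lreg_Bop lreg_adjoints[of \<one>] by simp_all

lemma scale_J_adjoints: "adjoints (op_scale (of_real c) (lreg G \<one>)) (op_scale (of_real c) (lreg G \<one>))"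
  using adjoints_scale[OF J_Bop J_Bop J_adjoints, of "of_real c"] by simp

lemma Re_ip_le:
  assumes "x \<in> Bop G" "bd x K" "f \<in> l2 G" shows "\<bar>Re (ip (x f) f)\<bar> \<le> K * (l2n f)\<^sup>2"
proof -
  have "\<bar>Re (ip (x f) f)\<bar> \<le> cmod (ip (x f) f)" by (rule abs_Re_le_cmod)
  also have "\<dots> \<le> l2n (x f) * l2n f" by (rule ip_cauchy[OF Bop_l2[OF assms(1,3)] assms(3)])
  also have "\<dots> \<le> K * l2n f * l2n f" by (rule mult_right_mono[OF bdD[OF assms(2,3)] l2norm_nonneg])
  finally show ?thesis by (simp add: power2_eq_square mult.assoc)
qed

text \<open>A tracial state is known to be nonnegative only on products \<open>x* x\<close>. For
  each \<epsilon> a rescaling of \<open>x + \<epsilon>\<close> has the form \<open>1 - t\<close>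
  with \<open>t\<close> a strict contraction, hence is the square of a self-adjoint element; then
  \<epsilon> tends to 0.\<close>

lemma \<tau>_positive:
  assumes x: "x \<in> Cred G" "adjoints x x" and pos: "\<And>f. f \<in> l2 G \<Longrightarrow> 0 \<le> Re (ip (x f) f)"
  shows "Im (\<tau> x) = 0" "0 \<le> Re (\<tau> x)"
proof -
  have xB: "x \<in> Bop G" by (rule Cred_Bop[OF x(1)])
  obtain K where K: "bd x K" "0 < K" using Bop_bd[OF xB] by metis
  have key: "Im (\<tau> x) = 0 \<and> 0 \<le> Re (\<tau> x) + \<epsilon>" if \<epsilon>: "\<epsilon> > 0" for \<epsilon> :: real
  proof -
    \<comment> \<open>The form of \<open>x'\<close> then lies between \<open>\<epsilon> / a\<close>
      and \<open>(K + \<epsilon>) / a < 1\<close>, so that of \<open>t = 1 - x'\<close> lies between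
      0 and \<rho>.\<close>
    define a where "a = K + 2 * \<epsilon>"
    have a: "a > 0" using K \<epsilon> by (simp add: a_def)
    define x' where "x' = op_scale (of_real (1 / a)) (op_add x (op_scale (of_real \<epsilon>) (lreg G \<one>)))"
    define t where "t = op_diff (lreg G \<one>) x'"
    define \<rho> where "\<rho> = 1 - \<epsilon> / a"
    have \<rho>: "0 \<le> \<rho>" "\<rho> < 1" using a K \<epsilon> by (auto simp: \<rho>_def a_def field_simps)
    have x'C: "x' \<in> Cred G" unfolding x'_def by (intro Cred_op_scale Cred_op_add x J_Cred)
    have x'B: "x' \<in> Bop G" by (rule Cred_Bop[OF x'C])
    have "adjoints (op_add x (op_scale (of_real \<epsilon>) (lreg G \<one>))) (op_add x (op_scale (of_real \<epsilon>) (lreg G \<one>)))"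
      by (intro adjoints_add xB x Bop_op_scale J_Bop scale_J_adjoints)
    from adjoints_scale[OF _ _ this, of "of_real (1 / a)"] have x'a: "adjoints x' x'"
      unfolding x'_def by (simp add: Bop_op_add Bop_op_scale xB J_Bop)
    have tC: "t \<in> Cred G" unfolding t_def by (intro Cred_op_diff J_Cred x'C)
    have ta: "adjoints t t" unfolding t_def by (intro adjoints_diff J_Bop x'B J_adjoints x'a)
    have "bd t \<rho>"
    proof (rule numerical_radius_bd[OF Cred_Bop[OF tC] ta])
      fix f assume f: "f \<in> l2 G"
      have xf: "x f \<in> l2 G" by (rule Bop_l2[OF xB f])
      have x'f: "x' f = (\<lambda>g. of_real (1 / a) * (x f g + of_real \<epsilon> * f g))"
        using lreg_one[OF f] by (simp add: x'_def op_scale_def op_add_def)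
      have x'l: "x' f \<in> l2 G" by (rule Bop_l2[OF x'B f])
      have "ip (x' f) f = of_real (1 / a) * (ip (x f) f + of_real \<epsilon> * ip f f)"
        unfolding x'f using ip_scale_left[OF l2_add(1)[OF xf l2_scale(1)[OF f, of "of_real \<epsilon>"]] f, of "of_real (1 / a)"]
          ip_add_left[OF xf l2_scale(1)[OF f, of "of_real \<epsilon>"] f] ip_scale_left[OF f f, of "of_real \<epsilon>"] by simp
      then have r: "Re (ip (x' f) f) = (Re (ip (x f) f) + \<epsilon> * (l2n f)\<^sup>2) / a"
        by (simp add: ip_self[OF f])
      have "ip (t f) f = ip f f - ip (x' f) f"
        unfolding t_def op_diff_def lreg_one[OF f] by (rule ip_diff_left[OF f x'l f])
      then have "Re (ip (t f) f) = (l2n f)\<^sup>2 - (Re (ip (x f) f) + \<epsilon> * (l2n f)\<^sup>2) / a"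
        by (simp add: r ip_self[OF f])
      also have "\<dots> = (a * (l2n f)\<^sup>2 - (Re (ip (x f) f) + \<epsilon> * (l2n f)\<^sup>2)) / a" using a by (simp add: field_simps)
      finally have e1: "Re (ip (t f) f) = (a * (l2n f)\<^sup>2 - (Re (ip (x f) f) + \<epsilon> * (l2n f)\<^sup>2)) / a" .
      have up: "Re (ip (x f) f) \<le> K * (l2n f)\<^sup>2" using Re_ip_le[OF xB K(1) f] by linarith
      have "0 \<le> a * (l2n f)\<^sup>2 - (Re (ip (x f) f) + \<epsilon> * (l2n f)\<^sup>2)"
        using up \<epsilon> by (simp add: a_def algebra_simps add_increasing2)
      then have "0 \<le> Re (ip (t f) f)" using a by (simp add: e1)
      moreover have "Re (ip (t f) f) \<le> (a * (l2n f)\<^sup>2 - \<epsilon> * (l2n f)\<^sup>2) / a"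
        unfolding e1 using pos[OF f] a by (intro divide_right_mono) auto
      moreover have "(a * (l2n f)\<^sup>2 - \<epsilon> * (l2n f)\<^sup>2) / a = \<rho> * (l2n f)\<^sup>2"
        using a by (simp add: \<rho>_def field_simps)
      ultimately show "\<bar>Re (ip (t f) f)\<bar> \<le> \<rho> * (l2n f)\<^sup>2" by linarith
    qed
    then obtain y where y: "y \<in> Cred G" "adjoints y y" "y \<circ> y = op_diff (lreg G \<one>) t"
      using sqrt_exists[OF tC ta _ \<rho>] by blast
    have "op_diff (lreg G \<one>) t = x'" by (simp add: t_def op_diff_def)
    then have "Im (\<tau> x') = 0 \<and> 0 \<le> Re (\<tau> x')" using \<tau>_square[OF y(1,2)] y(3) by simp
    moreover have "\<tau> x' = of_real (1 / a) * (\<tau> x + of_real \<epsilon>)"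
      unfolding x'_def by (simp add: \<tau>_scale \<tau>_add \<tau>_one x J_Cred Cred_op_add Cred_op_scale)
    ultimately show ?thesis using a by (simp add: zero_le_divide_iff)
  qed
  show "Im (\<tau> x) = 0" using key[of 1] by simp
  show "0 \<le> Re (\<tau> x)"
    by (rule field_le_epsilon) (use key in auto)
qed

text \<open>Both \<open>K + x\<close> and \<open>K - x\<close> have nonnegative quadratic
  forms.\<close>

lemma \<tau>_selfadjoint_bound:
  assumes x: "x \<in> Cred G" "adjoints x x" and K: "bd x K"
  shows "Im (\<tau> x) = 0" "\<bar>Re (\<tau> x)\<bar> \<le> K"
proof -
  have xB: "x \<in> Bop G" by (rule Cred_Bop[OF x(1)])
  define J where "J = op_scale (of_real K) (lreg G \<one>)"
  have J: "J \<in> Cred G" "J \<in> Bop G" "adjoints J J"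
    unfolding J_def by (intro Cred_op_scale J_Cred Bop_op_scale J_Bop scale_J_adjoints)+
  have \<tau>J: "\<tau> J = of_real K" by (simp add: J_def \<tau>_scale J_Cred \<tau>_one)
  have ipJ: "Re (ip (J f) f) = K * (l2n f)\<^sup>2" if f: "f \<in> l2 G" for f
    unfolding J_def op_scale_def lreg_one[OF f] ip_scale_left[OF f f] ip_self[OF f] by simp
  have "0 \<le> Re (ip (op_add J x f) f)" if f: "f \<in> l2 G" for f
    unfolding op_add_def ip_add_left[OF Bop_l2[OF J(2) f] Bop_l2[OF xB f] f]
    using Re_ip_le[OF xB K f] ipJ[OF f] by simp
  then have p: "Im (\<tau> (op_add J x)) = 0" "0 \<le> Re (\<tau> (op_add J x))"
    using \<tau>_positive[OF Cred_op_add[OF J(1) x(1)] adjoints_add[OF J(2) xB J(2) xB J(3) x(2)]] by blast+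
  have "0 \<le> Re (ip (op_diff J x f) f)" if f: "f \<in> l2 G" for f
    unfolding op_diff_def ip_diff_left[OF Bop_l2[OF J(2) f] Bop_l2[OF xB f] f]
    using Re_ip_le[OF xB K f] ipJ[OF f] by simp
  then have m: "0 \<le> Re (\<tau> (op_diff J x))"
    using \<tau>_positive[OF Cred_op_diff[OF J(1) x(1)] adjoints_diff[OF J(2) xB J(2) xB J(3) x(2)]] by blast
  show "Im (\<tau> x) = 0" using p(1) by (simp add: \<tau>_add J x \<tau>J)
  show "\<bar>Re (\<tau> x)\<bar> \<le> K" using p(2) m by (simp add: \<tau>_add \<tau>_diff J x \<tau>J abs_le_iff)
qed

text \<open>Split into real and imaginary parts, each bounded by \<open>K\<close>. The constant 2 is
  crude but gives continuity.\<close>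

lemma \<tau>_bound:
  assumes x: "x \<in> Cred G" and K: "bd x K" shows "cmod (\<tau> x) \<le> 2 * K"
proof -
  obtain y where y: "y \<in> Cred G" "adjoints x y" using Cred_adjoint[OF x] by blast
  have xB: "x \<in> Bop G" and yB: "y \<in> Bop G" using x y Cred_Bop by auto
  have yx: "adjoints y x" by (rule adjoints_sym[OF y(2)])
  have Ky: "bd y K" by (rule adjoints_bd[OF y(2) xB yB K])
  have swap: "op_add y x = op_add x y" by (simp add: op_add_def add.commute)
  define h where "h = op_scale (1 / 2) (op_add x y)"
  define k where "k = op_scale (- \<i> / 2) (op_diff x y)"
  have hC: "h \<in> Cred G" and kC: "k \<in> Cred G"
    unfolding h_def k_def by (intro Cred_op_scale Cred_op_add Cred_op_diff x y)+
  have ha: "adjoints h h"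
    using adjoints_scale[OF Bop_op_add[OF xB yB] Bop_op_add[OF yB xB] adjoints_add[OF xB yB yB xB y(2) yx], of "1/2"]
    unfolding h_def swap by simp
  have "op_scale (cnj (- \<i> / 2)) (op_diff y x) = k"
    by (simp add: k_def op_scale_def op_diff_def algebra_simps)
  then have ka: "adjoints k k"
    using adjoints_scale[OF Bop_op_diff[OF xB yB] Bop_op_diff[OF yB xB] adjoints_diff[OF xB yB yB xB y(2) yx], of "- \<i> / 2"]
    unfolding k_def by simp
  have hb: "bd h K" using bd_scale[OF Bop_op_add[OF xB yB] bd_add[OF xB yB K Ky], of "1/2"] by (simp add: h_def)
  have kb: "bd k K"
    using bd_scale[OF Bop_op_diff[OF xB yB] bd_diff[OF xB yB K Ky], of "- \<i> / 2"] by (simp add: k_def norm_divide)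
  have "x = op_add h (op_scale \<i> k)"
    by (simp add: h_def k_def op_scale_def op_add_def op_diff_def fun_eq_iff algebra_simps flip: add_divide_distrib)
  then have "\<tau> x = \<tau> h + \<i> * \<tau> k" using hC kC by (metis \<tau>_add \<tau>_scale Cred_op_scale)
  then have "cmod (\<tau> x) \<le> cmod (\<tau> h) + cmod (\<tau> k)" by (metis norm_triangle_ineq norm_mult norm_ii mult_1)
  also have "\<dots> \<le> K + K"
    using \<tau>_selfadjoint_bound[OF hC ha hb] \<tau>_selfadjoint_bound[OF kC ka kb] by (intro add_mono) (simp_all add: cmod_eq_Re)
  finally show ?thesis by simp
qed

text \<open>The quadratic form of multiplication by \<open>f\<close>. Domination by an operator is a
  statement about forms, so the multiplication operator itself is not introduced.\<close>

definition quad :: "('a \<Rightarrow> real) \<Rightarrow> ('a \<Rightarrow> complex) \<Rightarrow> real" where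
  "quad f \<xi> = (\<Sum>\<^sub>\<infinity>g\<in>C. f g * (cmod (\<xi> g))\<^sup>2)"

lemma quad_summable:
  assumes f: "f \<in> V" and \<xi>: "\<xi> \<in> l2 G" shows "(\<lambda>g. f g * (cmod (\<xi> g))\<^sup>2) summable_on C"
proof -
  obtain B where B: "\<forall>h\<in>C. \<bar>f h\<bar> \<le> B" using linf_bound[OF f] by blast
  have "(\<lambda>g. norm (f g * (cmod (\<xi> g))\<^sup>2)) summable_on C"
  proof (rule Infinite_Sum.abs_summable_on_comparison_test')
    show "(\<lambda>g. B * (cmod (\<xi> g))\<^sup>2) summable_on C" by (intro summable_on_cmult_right l2_summable \<xi>)
    show "norm (f g * (cmod (\<xi> g))\<^sup>2) \<le> B * (cmod (\<xi> g))\<^sup>2" if "g \<in> C" for g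
      using B that by (simp add: abs_mult mult_right_mono)
  qed
  then show ?thesis by (rule abs_summable_summable)
qed

lemma quad_add: "f \<in> V \<Longrightarrow> k \<in> V \<Longrightarrow> \<xi> \<in> l2 G \<Longrightarrow> quad (\<lambda>g. f g + k g) \<xi> = quad f \<xi> + quad k \<xi>"
  by (simp add: quad_def distrib_right infsum_add quad_summable)

lemma quad_scale: "quad (\<lambda>g. c * f g) \<xi> = c * quad f \<xi>"
  by (simp add: quad_def mult.assoc infsum_cmult_right')

lemma quad_le:
  assumes f: "f \<in> V" and \<xi>: "\<xi> \<in> l2 G" and c: "\<And>g. g \<in> C \<Longrightarrow> f g \<le> c" shows "quad f \<xi> \<le> c * (l2n \<xi>)\<^sup>2"
proof -
  have "quad f \<xi> \<le> (\<Sum>\<^sub>\<infinity>g\<in>C. c * (cmod (\<xi> g))\<^sup>2)"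
    unfolding quad_def using c
    by (intro infsum_mono quad_summable f \<xi> summable_on_cmult_right l2_summable) (simp add: mult_right_mono)
  then show ?thesis by (simp add: infsum_cmult_right' l2norm_power2)
qed

text \<open>Covariance: multiplication by a translate is multiplication by \<open>f\<close>
  conjugated with the regular representation.\<close>

lemma quad_ltrans:
  assumes t: "t \<in> C" and \<xi>: "\<xi> \<in> l2 G" shows "quad (ltrans t f) \<xi> = quad f (lreg G (inv t) \<xi>)"
proof -
  have "quad (ltrans t f) \<xi> = (\<Sum>\<^sub>\<infinity>g\<in>C. f (inv t \<otimes> g) * (cmod (\<xi> (t \<otimes> (inv t \<otimes> g))))\<^sup>2)"
    unfolding quad_def using t by (intro infsum_cong) (simp add: ltrans_def m_assoc[symmetric])
  also have "\<dots> = (\<Sum>\<^sub>\<infinity>g\<in>C. f g * (cmod (\<xi> (t \<otimes> g)))\<^sup>2)"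
    by (rule infsum_reindex_bij_betw[OF lmult_bij[OF t], of "\<lambda>g. f g * (cmod (\<xi> (t \<otimes> g)))\<^sup>2"])
  also have "\<dots> = quad f (lreg G (inv t) \<xi>)"
    unfolding quad_def using t \<xi> by (intro infsum_cong) (simp add: lreg_def)
  finally show ?thesis .
qed

text \<open>\<open>majorizes f x\<close> says that \<open>x\<close> dominates, as an operator, multiplication by \<open>f\<close>;
  \<open>upper f\<close> is then the largest value that a state extending \<open>\<tau>\<close> can take at \<open>f\<close>.\<close>
definition majorizes :: "('a \<Rightarrow> real) \<Rightarrow> 'a op \<Rightarrow> bool" where
  "majorizes f x \<longleftrightarrow> x \<in> Cred G \<and> adjoints x x \<and> (\<forall>\<xi>\<in>l2 G. quad f \<xi> \<le> Re (ip (x \<xi>) \<xi>))"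

definition upper :: "('a \<Rightarrow> real) \<Rightarrow> real" where
  "upper f = (INF x\<in>{x. majorizes f x}. Re (\<tau> x))"

lemma majorizes_const:
  assumes f: "f \<in> V" and c: "\<And>g. g \<in> C \<Longrightarrow> f g \<le> c"
  shows "majorizes f (op_scale (of_real c) (lreg G \<one>))"
  unfolding majorizes_def
proof (intro conjI ballI)
  fix \<xi> assume \<xi>: "\<xi> \<in> l2 G"
  have "Re (ip (op_scale (of_real c) (lreg G \<one>) \<xi>) \<xi>) = c * (l2n \<xi>)\<^sup>2"
    unfolding op_scale_def lreg_one[OF \<xi>] ip_scale_left[OF \<xi> \<xi>] ip_self[OF \<xi>] by simp
  then show "quad f \<xi> \<le> Re (ip (op_scale (of_real c) (lreg G \<one>) \<xi>) \<xi>)" using quad_le[OF f \<xi> c] by simp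
qed (intro Cred_op_scale J_Cred scale_J_adjoints)+

lemma majorizes_add:
  assumes f: "f \<in> V" "k \<in> V" and x: "majorizes f x" "majorizes k y"
  shows "majorizes (\<lambda>g. f g + k g) (op_add x y)"
proof -
  have C: "x \<in> Cred G" "y \<in> Cred G" using x by (auto simp: majorizes_def)
  note B = C[THEN Cred_Bop]
  show ?thesis
    unfolding majorizes_def
  proof (intro conjI ballI)
    show "op_add x y \<in> Cred G" by (rule Cred_op_add[OF C])
    show "adjoints (op_add x y) (op_add x y)" using x by (intro adjoints_add B) (auto simp: majorizes_def)
    fix \<xi> assume \<xi>: "\<xi> \<in> l2 G"
    show "quad (\<lambda>g. f g + k g) \<xi> \<le> Re (ip (op_add x y \<xi>) \<xi>)"
      unfolding quad_add[OF f \<xi>] op_add_def ip_add_left[OF Bop_l2[OF B(1) \<xi>] Bop_l2[OF B(2) \<xi>] \<xi>]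
      using x \<xi> by (simp add: majorizes_def add_mono)
  qed
qed

lemma majorizes_scale:
  assumes x: "majorizes f x" and c: "0 \<le> c"
  shows "majorizes (\<lambda>g. c * f g) (op_scale (of_real c) x)"
proof -
  have C: "x \<in> Cred G" and a: "adjoints x x" using x by (auto simp: majorizes_def)
  note B = Cred_Bop[OF C]
  show ?thesis
    unfolding majorizes_def
  proof (intro conjI ballI)
    show "op_scale (of_real c) x \<in> Cred G" by (rule Cred_op_scale[OF C])
    show "adjoints (op_scale (of_real c) x) (op_scale (of_real c) x)"
      using adjoints_scale[OF B B a, of "of_real c"] by simp
    fix \<xi> assume \<xi>: "\<xi> \<in> l2 G"
    show "quad (\<lambda>g. c * f g) \<xi> \<le> Re (ip (op_scale (of_real c) x \<xi>) \<xi>)"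
      unfolding quad_scale op_scale_def ip_scale_left[OF Bop_l2[OF B \<xi>] \<xi>]
      using x \<xi> c by (simp add: majorizes_def mult_left_mono)
  qed
qed

text \<open>The trace property enters here: conjugation by a group unitary carries majorants of
  \<open>f\<close> to majorants of its translate without changing their trace, which makes
  \<open>upper\<close> invariant.\<close>

lemma majorizes_ltrans:
  assumes x: "majorizes f x" and t: "t \<in> C"
  shows "majorizes (ltrans t f) (lreg G t \<circ> (x \<circ> lreg G (inv t)))"
    "\<tau> (lreg G t \<circ> (x \<circ> lreg G (inv t))) = \<tau> x"
proof -
  have C: "x \<in> Cred G" and a: "adjoints x x" using x by (auto simp: majorizes_def)
  note B = Cred_Bop[OF C]
  have ti: "inv t \<in> C" using t by simp
  have tt: "adjoints (lreg G (inv t)) (lreg G t)" "adjoints (lreg G t) (lreg G (inv t))"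
    using lreg_adjoints[OF t] adjoints_sym by blast+
  show "majorizes (ltrans t f) (lreg G t \<circ> (x \<circ> lreg G (inv t)))"
    unfolding majorizes_def
  proof (intro conjI ballI)
    show "lreg G t \<circ> (x \<circ> lreg G (inv t)) \<in> Cred G" by (intro Cred_comp lreg_Cred C t ti)
    have "adjoints (lreg G t \<circ> (x \<circ> lreg G (inv t))) ((lreg G t \<circ> x) \<circ> lreg G (inv t))"
      by (intro adjoints_comp lreg_Bop Bop_comp B t ti tt a)
    then show "adjoints (lreg G t \<circ> (x \<circ> lreg G (inv t))) (lreg G t \<circ> (x \<circ> lreg G (inv t)))"
      by (simp only: comp_assoc)
    fix \<xi> assume \<xi>: "\<xi> \<in> l2 G"
    define \<eta> where "\<eta> = lreg G (inv t) \<xi>"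
    have \<eta>: "\<eta> \<in> l2 G" unfolding \<eta>_def by (rule lreg_l2(1)[OF ti \<xi>])
    have "ip ((lreg G t \<circ> (x \<circ> lreg G (inv t))) \<xi>) \<xi> = ip (lreg G t (x \<eta>)) \<xi>" by (simp add: \<eta>_def)
    also have "\<dots> = ip (x \<eta>) \<eta>" unfolding \<eta>_def[symmetric]
      using adjointsD[OF tt(2) Bop_l2[OF B \<eta>] \<xi>] by (simp add: \<eta>_def)
    finally have eq: "ip ((lreg G t \<circ> (x \<circ> lreg G (inv t))) \<xi>) \<xi> = ip (x \<eta>) \<eta>" .
    show "quad (ltrans t f) \<xi> \<le> Re (ip ((lreg G t \<circ> (x \<circ> lreg G (inv t))) \<xi>) \<xi>)"
      unfolding eq quad_ltrans[OF t \<xi>] \<eta>_def[symmetric] using x \<eta> by (simp add: majorizes_def)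
  qed
  have "\<tau> (lreg G t \<circ> (x \<circ> lreg G (inv t))) = \<tau> ((x \<circ> lreg G (inv t)) \<circ> lreg G t)"
    by (intro \<tau>_commute Cred_comp lreg_Cred C t ti)
  also have "(x \<circ> lreg G (inv t)) \<circ> lreg G t = x"
    unfolding comp_assoc lreg_mult[OF ti t] using t B by (simp add: lreg_one_comp)
  finally show "\<tau> (lreg G t \<circ> (x \<circ> lreg G (inv t))) = \<tau> x" .
qed

text \<open>Since \<open>- c\<close> majorizes \<open>- f\<close>, the operator \<open>x - c\<close>
  majorizes 0 and has nonnegative trace. This keeps the infimum defining \<open>upper\<close>
  finite.\<close>

lemma majorizes_ge:
  assumes f: "f \<in> V" and x: "majorizes f x" and c: "\<And>g. g \<in> C \<Longrightarrow> c \<le> f g" shows "c \<le> Re (\<tau> x)"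
proof -
  have "majorizes (\<lambda>g. - f g) (op_scale (of_real (- c)) (lreg G \<one>))"
    using c by (intro majorizes_const V_uminus f) auto
  from majorizes_add[OF f V_uminus[OF f] x this]
  have "majorizes (\<lambda>g. 0) (op_add x (op_scale (of_real (- c)) (lreg G \<one>)))" by simp
  then have "0 \<le> Re (\<tau> (op_add x (op_scale (of_real (- c)) (lreg G \<one>))))"
    by (intro \<tau>_positive) (auto simp: majorizes_def quad_def)
  then show ?thesis using x by (simp add: majorizes_def \<tau>_add \<tau>_scale \<tau>_one J_Cred Cred_op_scale)
qed

lemma upper_le: "f \<in> V \<Longrightarrow> majorizes f x \<Longrightarrow> upper f \<le> Re (\<tau> x)"
proof -
  assume f: "f \<in> V" and x: "majorizes f x"
  obtain B where B: "\<forall>h\<in>C. \<bar>f h\<bar> \<le> B" using linf_bound[OF f] by blast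
  have "bdd_below ((\<lambda>x. Re (\<tau> x)) ` {x. majorizes f x})"
    using majorizes_ge[OF f, of _ "-B"] B by (intro bdd_belowI2[where m = "-B"]) (force simp: abs_le_iff)
  then show ?thesis unfolding upper_def using x by (intro cINF_lower) auto
qed

lemma upper_ge:
  assumes f: "f \<in> V" and "\<And>x. majorizes f x \<Longrightarrow> c \<le> Re (\<tau> x)" shows "c \<le> upper f"
proof -
  obtain B where B: "\<forall>h\<in>C. \<bar>f h\<bar> \<le> B" using linf_bound[OF f] by blast
  have "majorizes f (op_scale (of_real B) (lreg G \<one>))" using B by (intro majorizes_const f) (auto simp: abs_le_iff)
  then have "{x. majorizes f x} \<noteq> {}" by blast
  then show ?thesis unfolding upper_def using assms(2) by (intro cINF_greatest) auto
qed

lemma upper_inv_sublinear: "inv_sublinear upper"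
  unfolding inv_sublinear_def sublinear_def
proof (intro conjI ballI allI impI)
  fix f k assume f: "f \<in> V" and k: "k \<in> V"
  have 1: "upper (\<lambda>x. f x + k x) \<le> Re (\<tau> x) + Re (\<tau> y)" if x: "majorizes f x" and y: "majorizes k y" for x y
    using upper_le[OF V_add[OF f k] majorizes_add[OF f k x y]] x y by (simp add: majorizes_def \<tau>_add)
  have "upper (\<lambda>x. f x + k x) - Re (\<tau> x) \<le> upper k" if x: "majorizes f x" for x
    using 1[OF x] by (intro upper_ge[OF k]) (simp add: algebra_simps)
  then have "upper (\<lambda>x. f x + k x) - upper k \<le> upper f" by (intro upper_ge[OF f]) (simp add: algebra_simps)
  then show "upper (\<lambda>x. f x + k x) \<le> upper f + upper k" by simp
next
  fix f and c :: real assume f: "f \<in> V" and c: "0 \<le> c"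
  have 1: "upper (\<lambda>x. c * f x) \<le> c * Re (\<tau> x)" if x: "majorizes f x" for x
    using upper_le[OF V_scale[OF f] majorizes_scale[OF x c]] x by (simp add: majorizes_def \<tau>_scale)
  show "upper (\<lambda>x. c * f x) \<le> c * upper f"
  proof (cases "c = 0")
    case True
    have "majorizes (\<lambda>_. 0) (op_scale (of_real 0) (lreg G \<one>))"
      by (rule majorizes_const[OF lin_space_zero[OF lin_space_linf]]) simp
    from upper_le[OF lin_space_zero[OF lin_space_linf] this] show ?thesis
      using True by (simp add: \<tau>_scale J_Cred)
  next
    case False
    have "upper (\<lambda>x. c * f x) / c \<le> upper f" using 1 False c by (intro upper_ge[OF f]) (simp add: field_simps)
    then show ?thesis using False c by (simp add: field_simps)
  qed
next
  fix t f assume t: "t \<in> C" and f: "f \<in> V"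
  show "upper (ltrans t f) \<le> upper f"
  proof (rule upper_ge[OF f])
    fix x assume "majorizes f x"
    from upper_le[OF ltrans_closed[OF t f] majorizes_ltrans(1)[OF this t]] majorizes_ltrans(2)[OF this t]
    show "upper (ltrans t f) \<le> Re (\<tau> x)" by simp
  qed
next
  fix f c assume f: "f \<in> V" and "\<forall>g\<in>C. f g \<le> c"
  then have "majorizes f (op_scale (of_real c) (lreg G \<one>))" by (intro majorizes_const) auto
  from upper_le[OF f this] show "upper f \<le> c" by (simp add: \<tau>_scale J_Cred \<tau>_one)
qed

text \<open>The trace is real on the self-adjoint elements
  \<open>z \<lambda>\<^sub>s + cnj z \<lambda>\<^sub>s\<^sup>*\<close>; the cases
  \<open>z = 1\<close> and \<open>z = \<i>\<close> determine both parts.\<close>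

lemma \<tau>_lreg_inv:
  assumes s: "s \<in> C" shows "\<tau> (lreg G (inv s)) = cnj (\<tau> (lreg G s))"
proof -
  have B: "lreg G s \<in> Bop G" "lreg G (inv s) \<in> Bop G" and Cr: "lreg G s \<in> Cred G" "lreg G (inv s) \<in> Cred G"
    using s lreg_Bop lreg_Cred by auto
  have "Im (z * \<tau> (lreg G s) + cnj z * \<tau> (lreg G (inv s))) = 0" for z
  proof -
    define x where "x = op_add (op_scale z (lreg G s)) (op_scale (cnj z) (lreg G (inv s)))"
    have xC: "x \<in> Cred G" unfolding x_def by (intro Cred_op_add Cred_op_scale Cr)
    have "adjoints x (op_add (op_scale (cnj z) (lreg G (inv s))) (op_scale (cnj (cnj z)) (lreg G s)))"
      unfolding x_def using lreg_adjoints[OF s] adjoints_sym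
      by (intro adjoints_add adjoints_scale Bop_op_scale B) blast+
    also have "op_add (op_scale (cnj z) (lreg G (inv s))) (op_scale (cnj (cnj z)) (lreg G s)) = x"
      by (simp add: x_def op_add_def add.commute)
    finally have xa: "adjoints x x" .
    obtain K where "bd x K" using Bop_bd Cred_Bop[OF xC] by metis
    from \<tau>_selfadjoint_bound(1)[OF xC xa this] show ?thesis
      by (simp add: x_def \<tau>_add \<tau>_scale Cr Cred_op_scale)
  qed
  from this[of 1] this[of \<i>] show ?thesis by (simp add: complex_eq_iff)
qed

text \<open>The relation \<open>e g + k (inv s \<otimes> g) = 1\<close> splits the form of
  \<open>lreg G s\<close> into two parts, in which \<open>e\<close> or \<open>k\<close> weights one
  of the two vectors. The inequality between arithmetic and geometric means bounds their sum by the
  form of \<open>F + \<epsilon>\<close>, so \<open>\<epsilon> - Re (z \<lambda>\<^sub>s)\<close>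
  majorizes \<open>- F\<close>. It is applied with \<open>e\<close> and \<open>k\<close> both small
  in mean square for an extension of \<tau>, which is possible when \<open>s\<close> moves the point
  of concentration.\<close>

lemma lreg_trace_estimate:
  fixes e k :: "'a \<Rightarrow> real"
  assumes s: "s \<in> C" and \<epsilon>: "\<epsilon> > 0" and z: "cmod z \<le> 1"
    and ek: "\<And>g. g \<in> C \<Longrightarrow> e g + k (inv s \<otimes> g) = 1"
    and F: "F \<in> V" "\<And>g. g \<in> C \<Longrightarrow> F g = ((e g)\<^sup>2 + (k g)\<^sup>2) / (2 * \<epsilon>)"
  shows "Re (z * \<tau> (lreg G s)) \<le> \<epsilon> - upper (\<lambda>g. - F g)"
proof -
  have B: "lreg G s \<in> Bop G" "lreg G (inv s) \<in> Bop G" and Cr: "lreg G s \<in> Cred G" "lreg G (inv s) \<in> Cred G"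
    using s lreg_Bop lreg_Cred by auto
  define y where "y = op_add (op_scale z (lreg G s)) (op_scale (cnj z) (lreg G (inv s)))"
  define x where "x = op_diff (op_scale (of_real \<epsilon>) (lreg G \<one>)) (op_scale (1 / 2) y)"
  have yC: "y \<in> Cred G" unfolding y_def by (intro Cred_op_add Cred_op_scale Cr)
  note yB = Cred_Bop[OF yC]
  have "adjoints y (op_add (op_scale (cnj z) (lreg G (inv s))) (op_scale (cnj (cnj z)) (lreg G s)))"
    unfolding y_def using lreg_adjoints[OF s] adjoints_sym
    by (intro adjoints_add adjoints_scale Bop_op_scale B) blast+
  also have "op_add (op_scale (cnj z) (lreg G (inv s))) (op_scale (cnj (cnj z)) (lreg G s)) = y"
    by (simp add: y_def op_add_def add.commute)
  finally have ya: "adjoints y y" .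
  have xC: "x \<in> Cred G" unfolding x_def by (intro Cred_op_diff Cred_op_scale J_Cred yC)
  have xa: "adjoints x x"
    using adjoints_diff[OF Bop_op_scale[OF J_Bop] Bop_op_scale[OF yB] Bop_op_scale[OF J_Bop] Bop_op_scale[OF yB]
        scale_J_adjoints adjoints_scale[OF yB yB ya, of "1/2"]] unfolding x_def by simp
  have "quad (\<lambda>g. - F g) \<xi> \<le> Re (ip (x \<xi>) \<xi>)" if \<xi>: "\<xi> \<in> l2 G" for \<xi>
  proof -
    define a where "a = (\<lambda>g. cmod (\<xi> g))"
    have ls: "lreg G s \<xi> \<in> l2 G" "lreg G (inv s) \<xi> \<in> l2 G" using lreg_l2(1)[OF _ \<xi>] s by auto
    have sumF: "(\<lambda>g. F g * (a g)\<^sup>2) summable_on C" unfolding a_def by (rule quad_summable[OF F(1) \<xi>])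
    have suma: "(\<lambda>g. (a g)\<^sup>2) summable_on C" unfolding a_def by (rule l2_summable[OF \<xi>])
    \<comment> \<open>Boundedness of \<open>e\<close> and \<open>k\<close> is not assumed; each
      weighted square is summable because it is dominated by the one with \<open>F\<close>.\<close>
    have "(\<lambda>g. (e g)\<^sup>2 / (2 * \<epsilon>) * (a g)\<^sup>2) summable_on C"
    proof (rule summable_on_comparison_test[OF sumF])
      show "(e g)\<^sup>2 / (2 * \<epsilon>) * (a g)\<^sup>2 \<le> F g * (a g)\<^sup>2" if "g \<in> C" for g
        using F(2)[OF that] \<epsilon> by (intro mult_right_mono) (simp_all add: divide_right_mono)
    qed (use \<epsilon> in auto)
    then have sume: "(\<lambda>g. (e g)\<^sup>2 / (2 * \<epsilon>) * (a g)\<^sup>2) summable_on C" .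
    have "(\<lambda>g. (k g)\<^sup>2 / (2 * \<epsilon>) * (a g)\<^sup>2) summable_on C"
    proof (rule summable_on_comparison_test[OF sumF])
      show "(k g)\<^sup>2 / (2 * \<epsilon>) * (a g)\<^sup>2 \<le> F g * (a g)\<^sup>2" if "g \<in> C" for g
        using F(2)[OF that] \<epsilon> by (intro mult_right_mono) (simp_all add: divide_right_mono)
    qed (use \<epsilon> in auto)
    then have sumk: "(\<lambda>g. (k g)\<^sup>2 / (2 * \<epsilon>) * (a g)\<^sup>2) summable_on C" .
    \<comment> \<open>The two remainders \<open>\<epsilon> / 2\<close> are exchanged between the
      summands: \<open>P\<close> collects what is evaluated at \<open>g\<close>, and
      \<open>Q\<close> what is evaluated at \<open>inv s \<otimes> g\<close>. Reindexing
      \<open>Q\<close> then gives \<open>F + \<epsilon>\<close>.\<close>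
    define P where "P = (\<lambda>g. (e g)\<^sup>2 / (2 * \<epsilon>) * (a g)\<^sup>2 + \<epsilon> / 2 * (a g)\<^sup>2)"
    define Q where "Q = (\<lambda>g. (k g)\<^sup>2 / (2 * \<epsilon>) * (a g)\<^sup>2 + \<epsilon> / 2 * (a g)\<^sup>2)"
    have P: "P summable_on C" unfolding P_def by (intro summable_on_add summable_on_cmult_right sume suma)
    have Q: "Q summable_on C" unfolding Q_def by (intro summable_on_add summable_on_cmult_right sumk suma)
    have Q': "(\<lambda>g. Q (inv s \<otimes> g)) summable_on C"
      using summable_on_reindex_bij_betw[OF lmult_bij[OF s], of Q] Q by simp
    have amgm: "\<bar>c\<bar> * (d * d') \<le> c\<^sup>2 / (2 * \<epsilon>) * d\<^sup>2 + \<epsilon> / 2 * d'\<^sup>2" if "0 \<le> d" "0 \<le> d'" for c d d'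
    proof -
      have "0 \<le> (\<bar>c\<bar> * d - \<epsilon> * d')\<^sup>2 / (2 * \<epsilon>)" using \<epsilon> by simp
      also have "\<dots> = c\<^sup>2 / (2 * \<epsilon>) * d\<^sup>2 + \<epsilon> / 2 * d'\<^sup>2 - \<bar>c\<bar> * (d * d')"
        using \<epsilon> by (simp add: power2_diff power_mult_distrib field_simps power2_eq_square[of \<epsilon>])
      finally show ?thesis by simp
    qed
    have bound: "cmod (lreg G s \<xi> g * cnj (\<xi> g))
        \<le> ((e g)\<^sup>2 / (2 * \<epsilon>) * (a g)\<^sup>2 + \<epsilon> / 2 * (a (inv s \<otimes> g))\<^sup>2)
        + ((k (inv s \<otimes> g))\<^sup>2 / (2 * \<epsilon>) * (a (inv s \<otimes> g))\<^sup>2 + \<epsilon> / 2 * (a g)\<^sup>2)" if g: "g \<in> C" for g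
    proof -
      define w where "w = a (inv s \<otimes> g)"
      have nn: "0 \<le> a g" "0 \<le> w" by (simp_all add: a_def w_def)
      have "cmod (lreg G s \<xi> g * cnj (\<xi> g)) = (e g + k (inv s \<otimes> g)) * (w * a g)"
        using ek[OF g] g \<xi> by (simp add: lreg_def norm_mult a_def w_def)
      also have "\<dots> \<le> \<bar>e g\<bar> * (a g * w) + \<bar>k (inv s \<otimes> g)\<bar> * (w * a g)"
        using nn by (simp add: distrib_right mult.commute[of w] add_mono mult_right_mono)
      also have "\<dots> \<le> ((e g)\<^sup>2 / (2 * \<epsilon>) * (a g)\<^sup>2 + \<epsilon> / 2 * w\<^sup>2)
          + ((k (inv s \<otimes> g))\<^sup>2 / (2 * \<epsilon>) * w\<^sup>2 + \<epsilon> / 2 * (a g)\<^sup>2)"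
        by (rule add_mono[OF amgm[OF nn] amgm[OF nn(2,1)]])
      finally show ?thesis by (simp add: w_def)
    qed
    have "cmod (ip (lreg G s \<xi>) \<xi>) \<le> (\<Sum>\<^sub>\<infinity>g\<in>C. cmod (lreg G s \<xi> g * cnj (\<xi> g)))"
      unfolding l2inner_def by (rule norm_infsum_bound[OF ip_summable[OF ls(1) \<xi>]])
    also have "\<dots> \<le> (\<Sum>\<^sub>\<infinity>g\<in>C. P g + Q (inv s \<otimes> g))"
    proof (rule infsum_mono[OF ip_summable[OF ls(1) \<xi>] summable_on_add[OF P Q']])
      show "cmod (lreg G s \<xi> g * cnj (\<xi> g)) \<le> P g + Q (inv s \<otimes> g)" if "g \<in> C" for g
        using bound[OF that] by (simp add: P_def Q_def)
    qed
    also have "\<dots> = infsum P C + infsum Q C"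
      using infsum_add[OF P Q'] infsum_reindex_bij_betw[OF lmult_bij[OF s], of Q] by simp
    also have "\<dots> = (\<Sum>\<^sub>\<infinity>g\<in>C. P g + Q g)" by (rule infsum_add[OF P Q, symmetric])
    also have "\<dots> = (\<Sum>\<^sub>\<infinity>g\<in>C. F g * (a g)\<^sup>2 + \<epsilon> * (a g)\<^sup>2)"
      using F(2) by (intro infsum_cong) (simp add: P_def Q_def add_divide_distrib distrib_right)
    also have "\<dots> = quad F \<xi> + \<epsilon> * (l2n \<xi>)\<^sup>2"
      using infsum_add[OF sumF summable_on_cmult_right[OF suma, of \<epsilon>]]
      by (simp add: quad_def a_def l2norm_power2 infsum_cmult_right')
    finally have main: "cmod (ip (lreg G s \<xi>) \<xi>) \<le> quad F \<xi> + \<epsilon> * (l2n \<xi>)\<^sup>2" .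
    have conj: "ip (lreg G (inv s) \<xi>) \<xi> = cnj (ip (lreg G s \<xi>) \<xi>)"
      using adjointsD[OF lreg_adjoints[OF s] \<xi> \<xi>] ip_commute[of "lreg G (inv s) \<xi>" \<xi>] by simp
    have "ip (y \<xi>) \<xi> = z * ip (lreg G s \<xi>) \<xi> + cnj z * ip (lreg G (inv s) \<xi>) \<xi>"
      unfolding y_def op_add_def op_scale_def
      using ip_add_left[OF l2_scale(1)[OF ls(1), of z] l2_scale(1)[OF ls(2), of "cnj z"] \<xi>]
        ip_scale_left[OF ls(1) \<xi>, of z] ip_scale_left[OF ls(2) \<xi>, of "cnj z"] by simp
    then have rey: "Re (ip (y \<xi>) \<xi>) = 2 * Re (z * ip (lreg G s \<xi>) \<xi>)" by (simp add: conj)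
    have "ip (x \<xi>) \<xi> = of_real \<epsilon> * ip \<xi> \<xi> - 1 / 2 * ip (y \<xi>) \<xi>"
      unfolding x_def op_diff_def op_scale_def lreg_one[OF \<xi>]
      using ip_diff_left[OF l2_scale(1)[OF \<xi>, of "of_real \<epsilon>"] l2_scale(1)[OF Bop_l2[OF yB \<xi>], of "1/2"] \<xi>]
        ip_scale_left[OF \<xi> \<xi>, of "of_real \<epsilon>"] ip_scale_left[OF Bop_l2[OF yB \<xi>] \<xi>, of "1/2"] by simp
    then have "Re (ip (x \<xi>) \<xi>) = \<epsilon> * (l2n \<xi>)\<^sup>2 - Re (ip (y \<xi>) \<xi>) / 2" by (simp add: ip_self[OF \<xi>])
    then have rex: "Re (ip (x \<xi>) \<xi>) = \<epsilon> * (l2n \<xi>)\<^sup>2 - Re (z * ip (lreg G s \<xi>) \<xi>)"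
      unfolding rey by linarith
    have "Re (z * ip (lreg G s \<xi>) \<xi>) \<le> cmod (z * ip (lreg G s \<xi>) \<xi>)" by (rule complex_Re_le_cmod)
    also have "\<dots> \<le> 1 * cmod (ip (lreg G s \<xi>) \<xi>)" unfolding norm_mult using z by (intro mult_right_mono) auto
    finally have "Re (z * ip (lreg G s \<xi>) \<xi>) \<le> quad F \<xi> + \<epsilon> * (l2n \<xi>)\<^sup>2" using main by simp
    then show ?thesis using quad_scale[of "-1" F \<xi>] by (simp add: rex)
  qed
  then have "majorizes (\<lambda>g. - F g) x" using xC xa by (simp add: majorizes_def)
  from upper_le[OF V_uminus[OF F(1)] this] have le: "upper (\<lambda>g. - F g) \<le> Re (\<tau> x)" .
  have "\<tau> y = z * \<tau> (lreg G s) + cnj (z * \<tau> (lreg G s))"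
    by (simp add: y_def \<tau>_add \<tau>_scale \<tau>_lreg_inv s Cr Cred_op_scale)
  then have "Re (\<tau> y) = 2 * Re (z * \<tau> (lreg G s))" by (simp only: complex_add_cnj Re_complex_of_real)
  moreover have "Re (\<tau> x) = \<epsilon> - Re (\<tau> y) / 2"
    by (simp add: x_def \<tau>_diff \<tau>_scale \<tau>_one J_Cred yC Cred_op_scale)
  ultimately have "Re (\<tau> x) = \<epsilon> - Re (z * \<tau> (lreg G s))" by linarith
  then show ?thesis using le by simp
qed

end

text \<open>Truncating a finite combination to \<open>H\<close> discards only terms of trace 0;
  continuity of the trace extends this to limits.\<close>

lemma (in traced) \<tau>_cond_exp:
  assumes H: "subgroup H G" and van: "\<And>s. s \<in> C \<Longrightarrow> s \<notin> H \<Longrightarrow> \<tau> (lreg G s) = 0" and X: "X \<in> Cred G"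
  shows "\<tau> X = \<tau> (cond_exp G H X)"
proof -
  obtain S c where S: "\<And>n. finite (S n)" "\<And>n. S n \<subseteq> C" "\<And>n. bd (op_diff X (comb (S n) (c n))) (1 / real (Suc n))"
    and Y: "cond_exp G H X \<in> Cred G" "\<And>n. bd (op_diff (cond_exp G H X) (comb (S n \<inter> H) (c n))) (2 / real (Suc n))"
    using cond_exp_approx[OF H X] by metis
  have \<tau>comb: "\<tau> (comb S c) = (\<Sum>s\<in>S. c s * \<tau> (lreg G s))" if "finite S" "S \<subseteq> C" for S c
    using that
    by (induction S rule: finite_induct)
      (simp_all add: comb_empty comb_insert \<tau>_add \<tau>_scale J_Cred lreg_Cred Cred_op_scale comb_Cred)
  have "cmod (\<tau> X - \<tau> (cond_exp G H X)) \<le> 6 * (1 / real (Suc n))" for n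
  proof -
    let ?T = "comb (S n) (c n)" and ?R = "comb (S n \<inter> H) (c n)"
    have SH: "finite (S n \<inter> H)" "S n \<inter> H \<subseteq> C" using S(1,2) by auto
    have TC: "?T \<in> Cred G" and RC: "?R \<in> Cred G" by (rule comb_Cred[OF S(1,2)] comb_Cred[OF SH])+
    have "\<tau> ?R = \<tau> ?T"
      unfolding \<tau>comb[OF SH] \<tau>comb[OF S(1,2)] using S(1,2) van by (intro sum.mono_neutral_left) auto
    then have "\<tau> X - \<tau> (cond_exp G H X) = \<tau> (op_diff X ?T) - \<tau> (op_diff (cond_exp G H X) ?R)"
      by (simp add: \<tau>_diff X Y(1) TC RC)
    then have "cmod (\<tau> X - \<tau> (cond_exp G H X)) \<le> cmod (\<tau> (op_diff X ?T)) + cmod (\<tau> (op_diff (cond_exp G H X) ?R))"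
      by (metis norm_triangle_ineq4)
    \<comment> \<open>The factors 2 in front come from \<open>\<tau>_bound\<close>, the numerators 1
      and 2 from the two approximation rates; together they give 6.\<close>
    also have "\<dots> \<le> 2 * (1 / real (Suc n)) + 2 * (2 / real (Suc n))"
      by (rule add_mono[OF \<tau>_bound[OF Cred_op_diff[OF X TC] S(3)] \<tau>_bound[OF Cred_op_diff[OF Y(1) RC] Y(2)]])
    finally show ?thesis by simp
  qed
  moreover have "(\<lambda>n. 6 * (1 / real (Suc n))) \<longlonglongrightarrow> 6 * 0" by (intro tendsto_intros inverse_Suc_tendsto)
  ultimately have "cmod (\<tau> X - \<tau> (cond_exp G H X)) \<le> 0"
    by (intro LIMSEQ_le_const[of "\<lambda>n. 6 * (1 / real (Suc n))"]) simp_all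
  then show ?thesis by simp
qed

section \<open>Vanishing off the amenable radical\<close>

locale traced_flow = traced + minimal_flow
begin

text \<open>Linear functionals below \<open>upper\<close> play the role of the restrictions to bounded functions of
  the states extending \<open>\<tau>\<close>.\<close>
lemma extension_exists:
  assumes x0: "dominated x0" and x: "dominated x"
  obtains m where "linear_func V m" "\<And>f. f \<in> V \<Longrightarrow> m f \<le> upper f" "\<And>f. f \<in> V \<Longrightarrow> m (poisson x0 f) = x f"
proof -
  \<comment> \<open>One-sided constraints over a linear space: imposing them for \<open>f\<close>
    and \<open>- f\<close> prescribes the values exactly.\<close>
  define A where "A = (\<lambda>f. (poisson x0 f, x f)) ` V"
  have xl: "linear_func V x" using x by (simp add: dominated_def)
  have us: "sublinear V upper" using upper_inv_sublinear by (simp add: inv_sublinear_def)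
  have z: "(\<lambda>_. 0) \<in> V" by (rule lin_space_zero[OF lin_space_linf])
  have "\<exists>m. linear_func V m \<and> (\<forall>f\<in>V. m f \<le> upper f) \<and> (\<forall>k c. (k, c) \<in> A \<longrightarrow> c \<le> m k)"
  proof (rule hahn_banach_constrained[OF lin_space_linf us, where A = A])
    show "k \<in> V" if "(k, c) \<in> A" for k c using that poisson_closed[OF x0] by (auto simp: A_def)
    show "((\<lambda>_. 0), 0) \<in> A"
      using poisson_scale[OF x0 z, of 0] linear_func_scale[OF xl z, of 0] z
      by (auto simp: A_def intro!: image_eqI[of _ _ "\<lambda>_. 0"])
    show "((\<lambda>g. k g + k' g), c + c') \<in> A" if kc: "(k, c) \<in> A" "(k', c') \<in> A" for k c k' c'
    proof -
      obtain f f' where f: "f \<in> V" "f' \<in> V" "k = poisson x0 f" "k' = poisson x0 f'" "c = x f" "c' = x f'"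
        using kc by (auto simp: A_def)
      show ?thesis unfolding A_def
        by (rule image_eqI[of _ _ "\<lambda>g. f g + f' g"])
          (simp_all add: f V_add poisson_add[OF x0 f(1,2)] linear_func_add[OF xl f(1,2)])
    qed
    show "((\<lambda>g. t * k g), t * c) \<in> A" if kc: "(k, c) \<in> A" for k c t
    proof -
      obtain f where f: "f \<in> V" "k = poisson x0 f" "c = x f" using kc by (auto simp: A_def)
      show ?thesis unfolding A_def
        by (rule image_eqI[of _ _ "\<lambda>g. t * f g"])
          (simp_all add: f V_scale poisson_scale[OF x0 f(1)] linear_func_scale[OF xl f(1)])
    qed
    \<comment> \<open>Compatibility is \<open>x f <= p f = upper (poisson x0 f)\<close>; the
      equality, due to minimality, is what makes every point of the flow attainable.\<close>
    show "c \<le> upper k" if kc: "(k, c) \<in> A" for k c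
      using kc x inv_sublinear_poisson[OF upper_inv_sublinear x0] by (auto simp: A_def dominated_def)
  qed blast
  then obtain m where m: "linear_func V m" "\<forall>f\<in>V. m f \<le> upper f" "\<forall>k c. (k, c) \<in> A \<longrightarrow> c \<le> m k" by blast
  have ge: "x f \<le> m (poisson x0 f)" if "f \<in> V" for f using m(3) that by (auto simp: A_def)
  have "m (poisson x0 f) = x f" if f: "f \<in> V" for f
  proof -
    have "- x f \<le> - m (poisson x0 f)"
      using ge[OF V_uminus[OF f]] linear_func_uminus[OF xl f] poisson_scale[OF x0 f, of "-1"]
        linear_func_uminus[OF m(1) poisson_closed[OF x0 f]] by simp
    then show ?thesis using ge[OF f] by simp
  qed
  then show ?thesis using m(1,2) that by blast
qed

text \<open>Near a maximum of a strictly convex quadratic function on the convex planar set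
  \<open>{(x a, x b) | x dominated}\<close>, the barycentre identity forces the extension to concentrate.\<close>
lemma \<tau>_vanish_aux:
  assumes s: "s \<in> C" and x: "dominated x" and a: "a \<in> V" and gt: "x (ltrans (inv s) a) < x a"
    and z: "cmod z \<le> 1" and \<epsilon>: "\<epsilon> > 0"
  shows "Re (z * \<tau> (lreg G s)) \<le> 2 * \<epsilon>"
proof -
  define b where "b = ltrans (inv s) a"
  have b: "b \<in> V" unfolding b_def by (rule ltrans_closed[OF inv_closed[OF s] a])
  obtain M where M: "\<forall>h\<in>C. \<bar>a h\<bar> \<le> M" using linf_bound[OF a] by blast
  have M0: "0 \<le> M" using M abs_ge_zero order_trans one_closed by blast
  have bM: "\<forall>h\<in>C. \<bar>b h\<bar> \<le> M" using M s by (simp add: b_def ltrans_def)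
  have le: "\<bar>y c\<bar> \<le> M" if "dominated y" "c \<in> V" "\<forall>h\<in>C. \<bar>c h\<bar> \<le> M" for y c
  proof -
    have "y c \<le> M" using that(3) by (intro dominated_le[OF that(1,2)]) (auto simp: abs_le_iff)
    moreover have "- M \<le> y c" using that(3) by (intro dominated_ge[OF that(1,2)]) (force simp: abs_le_iff)
    ultimately show ?thesis by (simp add: abs_le_iff)
  qed
  have sq: "(y c)\<^sup>2 \<le> M\<^sup>2" if "dominated y" "c \<in> V" "\<forall>h\<in>C. \<bar>c h\<bar> \<le> M" for y c
    using le[OF that] M0 by (simp add: abs_le_square_iff[symmetric])
  define D where "D = x a - x b"
  have D: "D > 0" using gt by (simp add: D_def b_def)
  \<comment> \<open>The squares in \<open>q\<close> contribute at most \<open>2 M^2\<close> and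
    \<open>q x >= T * D\<close>. Hence any \<open>y\<close> within 1 of the supremum satisfies
    \<open>T * (y a - y b) >= 1\<close>, so \<open>s\<close> still moves it.\<close>
  define T where "T = (2 * M\<^sup>2 + 2) / D"
  have T: "T > 0" "T * D = 2 * M\<^sup>2 + 2" using D by (auto simp: T_def intro!: divide_pos_pos add_nonneg_pos)
  \<comment> \<open>The squares turn near-maximality into a variance bound; the linear term keeps
    the two coordinates apart.\<close>
  define q where "q = (\<lambda>y :: ('a \<Rightarrow> real) \<Rightarrow> real. (y a)\<^sup>2 + (y b)\<^sup>2 + T * (y a - y b))"
  define Q where "Q = (SUP y\<in>{y. dominated y}. q y)"
  have bdd: "bdd_above (q ` {y. dominated y})"
  proof (rule bdd_aboveI2[where M = "2 * M\<^sup>2 + T * (2 * M)"])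
    fix y assume "y \<in> {y. dominated y}"
    then have y: "dominated y" by simp
    have "y a - y b \<le> 2 * M" using le[OF y a M] le[OF y b bM] by linarith
    then have "T * (y a - y b) \<le> T * (2 * M)" using T(1) by simp
    then show "q y \<le> 2 * M\<^sup>2 + T * (2 * M)" using sq[OF y a M] sq[OF y b bM] by (simp add: q_def)
  qed
  have qQ: "q y \<le> Q" if "dominated y" for y
    unfolding Q_def using that by (intro cSUP_upper bdd) simp
  \<comment> \<open>A real number here, not the point mass. The bound 1 serves the separation of
    coordinates; the other one makes the final error \<open>c * \<delta>\<close> at most
    \<epsilon>.\<close>
  define \<delta> where "\<delta> = min 1 (2 * \<epsilon>\<^sup>2 / T\<^sup>2)"
  have \<delta>: "0 < \<delta>" "\<delta> \<le> 1" "\<delta> * T\<^sup>2 \<le> 2 * \<epsilon>\<^sup>2"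
  proof -
    show "0 < \<delta>" "\<delta> \<le> 1" using T \<epsilon> by (auto simp: \<delta>_def)
    have "\<delta> * T\<^sup>2 \<le> (2 * \<epsilon>\<^sup>2 / T\<^sup>2) * T\<^sup>2" by (intro mult_right_mono) (auto simp: \<delta>_def)
    then show "\<delta> * T\<^sup>2 \<le> 2 * \<epsilon>\<^sup>2" using T(1) by simp
  qed
  obtain y where y: "dominated y" "Q - \<delta> < q y"
  proof -
    have "\<exists>y\<in>{y. dominated y}. Q - \<delta> < q y"
      unfolding Q_def using less_cSUP_iff[OF _ bdd, of "Q - \<delta>"] x \<delta>(1) Q_def by auto
    then show ?thesis using that by blast
  qed
  define u0 where "u0 = y a"
  define v0 where "v0 = y b"
  have sep: "1 \<le> T * (u0 - v0)"
  proof -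
    have "T * D \<le> q x" by (simp add: q_def D_def)
    moreover have "q y \<le> 2 * M\<^sup>2 + T * (u0 - v0)"
      using sq[OF y(1) a M] sq[OF y(1) b bM] by (simp add: q_def u0_def v0_def)
    ultimately show ?thesis using T(2) y(2) qQ[OF x] \<delta>(2) by linarith
  qed
  have uv: "u0 - v0 > 0" using sep T(1) by (smt (verit) mult_nonneg_nonpos)
  have "1 * 1 \<le> (T * (u0 - v0)) * (T * (u0 - v0))" using sep by (intro mult_mono) auto
  then have sep2: "1 \<le> T\<^sup>2 * (u0 - v0)\<^sup>2" by (simp add: power2_eq_square mult_ac)
  obtain x0 where x0: "dominated x0" using dominated_exists by blast
  obtain m where m: "linear_func V m" "\<And>f. f \<in> V \<Longrightarrow> m f \<le> upper f" "\<And>f. f \<in> V \<Longrightarrow> m (poisson x0 f) = y f"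
    using extension_exists[OF x0 y(1)] by metis
  define u where "u = poisson x0 a"
  define v where "v = poisson x0 b"
  have u: "u \<in> V" and v: "v \<in> V" unfolding u_def v_def by (rule poisson_closed[OF x0 a] poisson_closed[OF x0 b])+
  \<comment> \<open>Equivariance makes \<open>v\<close> the translate of \<open>u\<close> by
    \<open>inv s\<close>; this produces the relation between \<open>e\<close> and \<open>k\<close>
    below.\<close>
  have vu: "v (inv s \<otimes> g) = u g" if "g \<in> C" for g
    using poisson_ltrans[OF inv_closed[OF s], of x0 a] s that
    by (simp add: u_def v_def b_def ltrans_def m_assoc[symmetric])
  have mu: "m u = u0" and mv: "m v = v0" using m(3) a b by (simp_all add: u_def v_def u0_def v0_def)
  \<comment> \<open>This is \<open>q\<close> read along the orbit of \<open>x0\<close>, hence at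
    most \<open>Q\<close> everywhere.\<close>
  define h where "h = (\<lambda>g. (u g * u g + v g * v g) + (T * u g + (- T) * v g))"
  have h: "h \<in> V" unfolding h_def by (intro V_add V_scale linf_mult u v)
  have "h g \<le> Q" if g: "g \<in> C" for g
  proof -
    have "dominated (\<lambda>f. x0 (ltrans (inv g) f))" by (rule dominated_ltrans[OF x0 inv_closed[OF g]])
    from qQ[OF this] show ?thesis using g
      by (simp add: q_def h_def u_def v_def poisson_def power2_eq_square algebra_simps)
  qed
  then have "upper h \<le> Q" by (intro inv_sublinear_le[OF upper_inv_sublinear h])
  then have mh: "m h \<le> Q" using m(2)[OF h] by linarith
  define I where "I = (\<lambda>g. if g \<in> C then 1 else 0 :: real)"
  have I: "I \<in> V" unfolding I_def by (rule linf_const)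
  have "upper I \<le> 1" by (intro inv_sublinear_le[OF upper_inv_sublinear I]) (simp add: I_def)
  then have mI: "m I \<le> 1" using m(2)[OF I] by linarith
  \<comment> \<open>Completing squares cancels the linear term of \<open>h\<close> and leaves
    \<open>(u - u0)^2 + (v - v0)^2\<close>. Its value under \<open>m\<close> is the variance about
    the barycentre, at most \<open>Q - q y < \<delta>\<close>.\<close>
  define w where "w = (\<lambda>g. h g + ((- T - 2 * u0) * u g + ((T - 2 * v0) * v g + (u0\<^sup>2 + v0\<^sup>2) * I g)))"
  have w: "w \<in> V" unfolding w_def by (intro V_add V_scale h u v I)
  have weq: "w g = (u g - u0)\<^sup>2 + (v g - v0)\<^sup>2" if "g \<in> C" for g
    using that by (simp add: w_def h_def I_def power2_eq_square algebra_simps)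
  have "m w = m h + ((- T - 2 * u0) * u0 + ((T - 2 * v0) * v0 + (u0\<^sup>2 + v0\<^sup>2) * m I))"
    unfolding w_def
    by (simp only: linear_func_add[OF m(1)] linear_func_scale[OF m(1)] V_add V_scale h u v I mu mv)
  also have "\<dots> \<le> Q + ((- T - 2 * u0) * u0 + ((T - 2 * v0) * v0 + (u0\<^sup>2 + v0\<^sup>2) * 1))"
    by (intro add_mono[OF mh] add_left_mono mult_left_mono[OF mI]) simp
  also have "\<dots> = Q - q y" by (simp add: q_def u0_def v0_def power2_eq_square algebra_simps)
  finally have mw: "m w \<le> \<delta>" using y(2) by linarith
  define c where "c = 1 / (2 * \<epsilon> * (u0 - v0)\<^sup>2)"
  have c: "c > 0" using uv \<epsilon> by (simp add: c_def)
  define F where "F = (\<lambda>g. c * w g)"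
  have F: "F \<in> V" unfolding F_def by (rule V_scale[OF w])
  \<comment> \<open>The weights are \<open>e = (u0 - u) / (u0 - v0)\<close> and
    \<open>k = (v - v0) / (u0 - v0)\<close>. In \<open>e g + k (inv s \<otimes> g)\<close> the two
    values \<open>u g\<close> cancel by \<open>vu\<close>, leaving 1, and the sum of squares is
    proportional to \<open>w\<close>.\<close>
  have est: "Re (z * \<tau> (lreg G s)) \<le> \<epsilon> - upper (\<lambda>g. - F g)"
  proof (rule lreg_trace_estimate[OF s \<epsilon> z _ F])
    show "(u0 - u g) / (u0 - v0) + (v (inv s \<otimes> g) - v0) / (u0 - v0) = 1" if "g \<in> C" for g
      using vu[OF that] uv by (simp flip: add_divide_distrib)
    show "F g = (((u0 - u g) / (u0 - v0))\<^sup>2 + ((v g - v0) / (u0 - v0))\<^sup>2) / (2 * \<epsilon>)" if "g \<in> C" for g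
      using weq[OF that] uv \<epsilon> by (simp add: F_def c_def power_divide power2_commute[of u0] flip: add_divide_distrib)
  qed
  have "- m F \<le> upper (\<lambda>g. - F g)"
    using m(2)[OF V_uminus[OF F]] linear_func_uminus[OF m(1) F] by simp
  moreover have "m F \<le> c * \<delta>" unfolding F_def linear_func_scale[OF m(1) w] using mw c by simp
  moreover have "c * \<delta> \<le> \<epsilon>"
  proof -
    have "\<delta> * 1 \<le> \<delta> * (T\<^sup>2 * (u0 - v0)\<^sup>2)" using sep2 \<delta>(1) by (intro mult_left_mono) auto
    also have "\<dots> \<le> 2 * \<epsilon>\<^sup>2 * (u0 - v0)\<^sup>2" using mult_right_mono[OF \<delta>(3), of "(u0 - v0)\<^sup>2"] by (simp add: mult.assoc)
    finally have "\<delta> \<le> \<epsilon> * (2 * \<epsilon> * (u0 - v0)\<^sup>2)" by (simp add: power2_eq_square mult_ac)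
    then show ?thesis using uv \<epsilon> by (simp add: c_def divide_le_eq)
  qed
  ultimately show ?thesis using est by linarith
qed

lemma \<tau>_vanish:
  assumes s: "s \<in> C" and nk: "s \<notin> kern" shows "\<tau> (lreg G s) = 0"
proof -
  obtain x a where x: "dominated x" and a: "a \<in> V" and ne: "x (ltrans s a) \<noteq> x a"
    using s nk by (auto simp: kern_def)
  have xl: "linear_func V x" using x by (simp add: dominated_def)
  define a' where "a' = ltrans s a"
  have a': "a' \<in> V" unfolding a'_def by (rule ltrans_closed[OF s a])
  have ltb: "ltrans (inv s) a' = a" using s a by (simp add: a'_def ltrans_ltrans ltrans_one)
  \<comment> \<open>The strict inequality needs a direction; if it fails for \<open>a'\<close> it
    holds for \<open>- a'\<close>.\<close>
  have "\<exists>f\<in>V. x (ltrans (inv s) f) < x f"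
  proof (cases "x a < x a'")
    case True
    then show ?thesis using ltb a' by auto
  next
    case False
    have "x (ltrans (inv s) (\<lambda>g. - a' g)) = - x a"
      using ltrans_scale[of "inv s" "-1" a'] ltb linear_func_uminus[OF xl a] by simp
    moreover have "x (\<lambda>g. - a' g) = - x a'" by (rule linear_func_uminus[OF xl a'])
    ultimately show ?thesis using False ne V_uminus[OF a'] by (intro bexI[of _ "\<lambda>g. - a' g"]) (auto simp: a'_def)
  qed
  then obtain f where f: "f \<in> V" "x (ltrans (inv s) f) < x f" by blast
  define t where "t = \<tau> (lreg G s)"
  \<comment> \<open>A phase rotating the trace onto its modulus, so that bounding real parts
    suffices.\<close>
  define z where "z = cnj (sgn t)"
  have z: "cmod z \<le> 1" by (simp add: z_def norm_sgn)
  have "sgn t * cmod t = t" by (simp add: sgn_div_norm scaleR_conv_of_real field_simps)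
  then have "z * t = cnj (sgn t) * sgn t * of_real (cmod t)" by (simp add: z_def mult.assoc)
  also have "cnj (sgn t) * sgn t = of_real ((cmod (sgn t))\<^sup>2)" by (metis complex_norm_square mult.commute)
  finally have "z * t = of_real (cmod t)" by (cases "t = 0") (simp_all add: norm_sgn)
  then have "cmod (\<tau> (lreg G s)) \<le> 2 * \<epsilon>" if "\<epsilon> > 0" for \<epsilon>
    using \<tau>_vanish_aux[OF s x f z that] by (simp add: t_def)
  then have "cmod (\<tau> (lreg G s)) \<le> 0 + \<epsilon>" if "\<epsilon> > 0" for \<epsilon> using that by (metis add_0 field_sum_of_halves half_gt_zero mult_2)
  then have "cmod (\<tau> (lreg G s)) \<le> 0" by (rule field_le_epsilon)
  then show ?thesis by simp
qed

end

theorem theorem4p1: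
  fixes G :: "'a monoid" and \<tau> :: "'a op \<Rightarrow> complex"
  assumes "group G"
    and "tracial_state G \<tau>"
  shows "(\<forall>x\<in>Cred G. \<tau> x = \<tau> (cond_exp G (amenable_radical G) x))
       \<and> (\<forall>s\<in>carrier G - amenable_radical G. \<tau> (lreg G s) = 0)"
proof -
  interpret group G by fact
  interpret traced G \<tau> by unfold_locales fact
  obtain p where "minimal_flow G p" using minimal_flow_exists by blast
  then interpret minimal_flow G p .
  interpret traced_flow G \<tau> p ..
  have "subgroup kern G" using kern_normal by (simp add: normal_inv_iff)
  then show ?thesis
    unfolding amenable_radical_eq_kern using \<tau>_cond_exp[of kern] \<tau>_vanish by blast
qed

end
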